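(* Let $\Gamma$ be a finite connected graph which becomes a tree when all of its loops are removed, with vertices colored alternately blue and red along the non-loop edges. Let $M$ be a graph of circle bundles based on $\Gamma$, with vertex genera $g_v\ge 1$ and gluing integers $n_e$ (one for each non-loop edge $e$) and $m_l$ (one for each loop $l$), as described in the context. Let $A$ be the alphabet and $R$ the set of rewriting rules defined in the context. Then $R$ is a finite complete rewriting system for $(\pi_1(M),A)$.
   Context: **Rewriting systems.** Let $G$ be a group with a finite set $A$ of letters mapping to $G$ such that the induced monoid homomorphism $A^*\to G$, $w\mapsto\overline{w}$, from the free monoid $A^*$ is onto. A rewriting system over $A$ is a subset $R\subset A^*\times A^*$; a pair $(u,v)\in R$ is written $u\to v$, and then $xuy\to xvy$ for all $x,y\in A^*$. A finite set $R=\{u_i\to v_i\}$ is a finite complete rewriting system for $(G,A)$ if: (1) $\langle A\mid u_i=v_i\rangle$ is a monoid presentation of the underlying monoid of $G$; (2) for each $g\in G$ there is exactly one word $w\in A^*$ with $g=\overline{w}$ that contains no $u_i$ as a substring; (3) there is no infinite sequence of rewritings $w_0\to w_1\to w_2\to\cdots$. **The graph.** A loop is an edge with the same initial and terminal vertex. $V$ is the set of vertices of $\Gamma$, $E$ the set of edges that are not loops, and $L$ the set of loops. Since $\Gamma$ minus its loops is a tree, the vertices can be colored red and blue so that each $e\in E$ joins a blue vertex to a red vertex; orient $e$ so that its initial vertex $\iota(e)$ is blue and its terminal vertex $\tau(e)$ is red. For $l\in L$, $\iota(l)$ is the vertex at which $l$ is based. At each vertex, the incident non-loop edges and the loops are each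 listed in a fixed order, and all products below over these edges or loops are taken in that order. Write $[a,b]=aba^{-1}b^{-1}$. **The manifold and its fundamental group.** At each vertex $v$ the vertex manifold $M_v$ is a circle bundle over a punctured surface of genus $g_v\ge1$, with one boundary torus for each $e\in E$ incident to $v$ and two for each loop at $v$, and $$\pi_1(M_v)=\Big\langle a_{v1},\dots,a_{vg_v},b_{v1},\dots,b_{vg_v},\{p_e\mid e\in E,\iota(e)=v\},\{q_e\mid e\in E,\tau(e)=v\},\{r_l,s_l\mid l\in L,\iota(l)=v\}\ \Big|\ \prod_{\iota(e)=v}p_e\prod_{\tau(e)=v}q_e\prod_{\iota(l)=v}r_ls_l=\prod_{j=1}^{g_v}[a_{vj},b_{vj}]\Big\rangle\times\langle x_v\rangle .$$ (At a blue vertex there are no $q_e$; at a red vertex there are no $p_e$.) The manifold $M$ is obtained by gluing the $M_v$ along boundary tori according to the edges of $\Gamma$. Its fundamental group is generated by the groups $\pi_1(M_v)$, $v\in V$, together with one additional generator $t_l$ for each $l\in L$, subject to the relations of the groups $\pi_1(M_v)$ and the following gluing relations, where $n_e,m_l\in\mathbb{Z}$: - for each $e\in E$ with $\iota(e)=v$, $\tau(e)=w$: $\ x_v=q_ex_w^{n_e}$ and $p_e=x_w$; - for each $l\in L$ with $\iota(l)=v$: $\ t_lx_vt_l^{-1}=s_lx_v^{m_l}$ and $t_lr_lt_l^{-1}=x_v$. (That is, the gluing matrices are $\begin{pmatrix}1&n_e\\0&1\end{pmatrix}$ and $\begin{pmatrix}1&m_l\\0&1\end{pmatrix}$.) For each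 red vertex $w$ put $n_w=\sum_{e\in E,\ \tau(e)=w}n_e$. **The alphabet.** The generators $p_e$ and $q_e$ are eliminated via $p_e=x_{\tau(e)}$ and $q_e=x_{\iota(e)}x_{\tau(e)}^{-n_e}$. Let $$S=\{x_v,a_{vj},b_{vj},r_l,s_l,t_l\mid v\in V,\ 1\le j\le g_v,\ l\in L\},\qquad A=S\cup S^{-1},$$ where $S^{-1}$ is the set of formal inverses. **Conventions for words.** Integer powers, commutators and inverses of words denote the corresponding words over $A$ (for $n<0$, $x^n$ is the word $(x^{-1})^{|n|}$, and the formal inverse of a word takes its letters in the opposite order with signs changed). $\prod_{j=g}^{2}[b_j,a_j]$ denotes $[b_g,a_g][b_{g-1},a_{g-1}]\cdots[b_2,a_2]$, and $\prod_{j=2}^{g}[a_j,b_j]$ denotes $[a_2,b_2]\cdots[a_g,b_g]$ (both are empty if $g=1$). In a rule of the form $y^{\pm1}z^{\pm1}\to z^{\pm1}y^{\pm1}$ the signs of $y$ and $z$ range independently, each letter keeping its sign on both sides. For a blue vertex $v$ and a red vertex $w$ let $$\Lambda_v=\prod_{\iota(e)=v}x_{\tau(e)}\prod_{\iota(k)=v}r_ks_k,\qquad \Omega_w=\prod_{\tau(e)=w}x_{\iota(e)}\prod_{\iota(l)=w}r_ls_l,$$ with $e$ ranging over $E$ and $k,l$ over $L$; $\Lambda_v^{-1}$ and $\Omega_w^{-1}$ are the formal inverse words. **The rules $R$.** $R$ consists of the following rules, where $v$ ranges over all blue vertices, $w$ over all red vertices, $e$ over $E$, $k$ over all loops at blue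 vertices, $l$ over all loops at red vertices, and $i$ over $1,\dots,g_v$ (respectively $1,\dots,g_w$): - inverse cancellation relators: $zz^{-1}\to1$, $z^{-1}z\to1$ for $z\in S$; - blue vertex relators: $x_v^{\pm1}a_{vi}^{\pm1}\to a_{vi}^{\pm1}x_v^{\pm1}$, $\ x_v^{\pm1}b_{vi}^{\pm1}\to b_{vi}^{\pm1}x_v^{\pm1}$, $\ x_{\iota(k)}^{\pm1}r_k^{\pm1}\to r_k^{\pm1}x_{\iota(k)}^{\pm1}$, $\ x_{\iota(k)}^{\pm1}s_k^{\pm1}\to s_k^{\pm1}x_{\iota(k)}^{\pm1}$; - red vertex relators: $a_{wi}^{\pm1}x_w^{\pm1}\to x_w^{\pm1}a_{wi}^{\pm1}$, $\ b_{wi}^{\pm1}x_w^{\pm1}\to x_w^{\pm1}b_{wi}^{\pm1}$, $\ r_l^{\pm1}x_{\iota(l)}^{\pm1}\to x_{\iota(l)}^{\pm1}r_l^{\pm1}$, $\ s_l^{\pm1}x_{\iota(l)}^{\pm1}\to x_{\iota(l)}^{\pm1}s_l^{\pm1}$; - edge relators: $x_{\iota(e)}^{\pm1}x_{\tau(e)}^{\pm1}\to x_{\tau(e)}^{\pm1}x_{\iota(e)}^{\pm1}$; - blue amalgam relators: $a_{v1}b_{v1}\to\Lambda_v\prod_{j=g_v}^{2}[b_{vj},a_{vj}]\,b_{v1}a_{v1}$, $a_{v1}b_{v1}^{-1}\to b_{v1}^{-1}\prod_{j=2}^{g_v}[a_{vj},b_{vj}]\,\Lambda_v^{-1}a_{v1}$,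 $a_{v1}^{-1}\Lambda_v\prod_{j=g_v}^{2}[b_{vj},a_{vj}]\,b_{v1}\to b_{v1}a_{v1}^{-1}$, $a_{v1}^{-1}b_{v1}^{-1}\to b_{v1}^{-1}a_{v1}^{-1}\Lambda_v\prod_{j=g_v}^{2}[b_{vj},a_{vj}]$; - red amalgam relators: $a_{w1}b_{w1}\to x_w^{-n_w}\Omega_w\prod_{j=g_w}^{2}[b_{wj},a_{wj}]\,b_{w1}a_{w1}$, $a_{w1}b_{w1}^{-1}\to x_w^{n_w}b_{w1}^{-1}\prod_{j=2}^{g_w}[a_{wj},b_{wj}]\,\Omega_w^{-1}a_{w1}$, $a_{w1}^{-1}\Omega_w\prod_{j=g_w}^{2}[b_{wj},a_{wj}]\,b_{w1}\to x_w^{n_w}b_{w1}a_{w1}^{-1}$, $a_{w1}^{-1}b_{w1}^{-1}\to x_w^{-n_w}b_{w1}^{-1}a_{w1}^{-1}\Omega_w\prod_{j=g_w}^{2}[b_{wj},a_{wj}]$; - blue HNN relators: $x_{\iota(k)}t_k\to t_kr_k$, $\ x_{\iota(k)}^{-1}t_k\to t_kr_k^{-1}$, $\ r_kt_k^{-1}\to t_k^{-1}x_{\iota(k)}$, $\ r_k^{-1}t_k^{-1}\to t_k^{-1}x_{\iota(k)}^{-1}$, $s_kt_k\to t_kr_k^{-m_k}x_{\iota(k)}$, $\ s_k^{-1}t_k\to t_kr_k^{m_k}x_{\iota(k)}^{-1}$, $\ x_{\iota(k)}t_k^{-1}\to t_k^{-1}s_kx_{\iota(k)}^{m_k}$, $\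 x_{\iota(k)}^{-1}t_k^{-1}\to t_k^{-1}s_k^{-1}x_{\iota(k)}^{-m_k}$; - red HNN relators: $t_lr_l\to x_{\iota(l)}t_l$, $\ t_lr_l^{-1}\to x_{\iota(l)}^{-1}t_l$, $\ t_l^{-1}x_{\iota(l)}\to r_lt_l^{-1}$, $\ t_l^{-1}x_{\iota(l)}^{-1}\to r_l^{-1}t_l^{-1}$, $t_lx_{\iota(l)}\to x_{\iota(l)}^{m_l}s_lt_l$, $\ t_lx_{\iota(l)}^{-1}\to x_{\iota(l)}^{-m_l}s_l^{-1}t_l$, $\ t_l^{-1}s_l\to x_{\iota(l)}r_l^{-m_l}t_l^{-1}$, $\ t_l^{-1}s_l^{-1}\to x_{\iota(l)}^{-1}r_l^{m_l}t_l^{-1}$. *)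

theory Defs
  imports
    "HOL-Algebra.Group"
    "HOL-Library.Sublist"
    "Graph_Theory.Digraph_Component"
begin

section \<open>Monoid presentations and complete rewriting systems\<close>

text \<open>The congruence on the free monoid of words over \<open>A\<close> generated by the pairs in \<open>R\<close>.\<close>

inductive_set pres_cong :: "'a set \<Rightarrow> ('a list \<times> 'a list) set \<Rightarrow> ('a list \<times> 'a list) set"
  for A :: "'a set" and R :: "('a list \<times> 'a list) set" where
  rel: "(u, v) \<in> R \<Longrightarrow> u \<in> lists A \<Longrightarrow> v \<in> lists A \<Longrightarrow> (u, v) \<in> pres_cong A R"
| refl: "u \<in> lists A \<Longrightarrow> (u, u) \<in> pres_cong A R"
| sym: "(u, v) \<in> pres_cong A R \<Longrightarrow> (v, u) \<in> pres_cong A R"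
| trans: "(u, v) \<in> pres_cong A R \<Longrightarrow> (v, w) \<in> pres_cong A R \<Longrightarrow> (u, w) \<in> pres_cong A R"
| append: "(u, v) \<in> pres_cong A R \<Longrightarrow> (u', v') \<in> pres_cong A R \<Longrightarrow> (u @ u', v @ v') \<in> pres_cong A R"

definition presented_monoid :: "'a set \<Rightarrow> ('a list \<times> 'a list) set \<Rightarrow> 'a list set monoid" where
  "presented_monoid A R =
    \<lparr>carrier = lists A // pres_cong A R,
     monoid.mult = (\<lambda>C D. \<Union>u\<in>C. \<Union>v\<in>D. pres_cong A R `` {u @ v}),
     one = pres_cong A R `` {[]}\<rparr>"

lemma pres_cong_lists:
  assumes "(u, v) \<in> pres_cong A R"
  shows "u \<in> lists A \<and> v \<in> lists A"
  using assms by induction auto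

lemma equiv_pres_cong: "equiv (lists A) (pres_cong A R)"
proof (rule equivI)
  show "pres_cong A R \<subseteq> lists A \<times> lists A"
    using pres_cong_lists by fast
  show "refl_on (lists A) (pres_cong A R)"
    by (rule refl_onI) (rule pres_cong.refl)
  show "sym (pres_cong A R)"
    by (rule symI) (rule pres_cong.sym)
  show "trans (pres_cong A R)"
    by (rule transI) (rule pres_cong.trans)
qed

lemma pres_class_mult:
  assumes "u \<in> lists A" "v \<in> lists A"
  shows "pres_cong A R `` {u} \<otimes>\<^bsub>presented_monoid A R\<^esub> pres_cong A R `` {v} = pres_cong A R `` {u @ v}"
proof -
  let ?r = "pres_cong A R"
  have "?r `` {u' @ v'} = ?r `` {u @ v}" if "(u, u') \<in> ?r" "(v, v') \<in> ?r" for u' v'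
    by (rule equiv_class_eq[OF equiv_pres_cong pres_cong.append[OF that], symmetric])
  then have "(\<Union>u'\<in>?r `` {u}. \<Union>v'\<in>?r `` {v}. ?r `` {u' @ v'}) =
      (\<Union>u'\<in>?r `` {u}. \<Union>v'\<in>?r `` {v}. ?r `` {u @ v})"
    by (intro SUP_cong HOL.refl) simp
  also have "\<dots> = ?r `` {u @ v}"
    using pres_cong.refl[OF assms(1), of R] pres_cong.refl[OF assms(2), of R] by blast
  finally show ?thesis
    by (simp add: presented_monoid_def)
qed

lemma carrier_presented_monoid:
  "carrier (presented_monoid A R) = (\<lambda>w. pres_cong A R `` {w}) ` lists A"
  by (auto simp: presented_monoid_def quotient_def)

lemma one_presented_monoid: "\<one>\<^bsub>presented_monoid A R\<^esub> = pres_cong A R `` {[]}"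
  by (simp add: presented_monoid_def)

lemma monoid_presented_monoid: "monoid (presented_monoid A R)"
  by (rule monoidI; unfold carrier_presented_monoid one_presented_monoid; (elim imageE)?)
     (simp_all add: pres_class_mult)

text \<open>The value of a word in \<open>G\<close> when the letters are mapped to \<open>G\<close> by \<open>\<phi>\<close>.\<close>

definition word_value :: "('g, 'm) monoid_scheme \<Rightarrow> ('a \<Rightarrow> 'g) \<Rightarrow> 'a list \<Rightarrow> 'g" where
  "word_value G \<phi> w = foldr (\<lambda>a y. \<phi> a \<otimes>\<^bsub>G\<^esub> y) w \<one>\<^bsub>G\<^esub>"

definition is_monoid_presentation ::
    "('g, 'm) monoid_scheme \<Rightarrow> 'a set \<Rightarrow> ('a \<Rightarrow> 'g) \<Rightarrow> ('a list \<times> 'a list) set \<Rightarrow> bool" where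
  "is_monoid_presentation G A \<phi> R \<longleftrightarrow>
    (\<exists>h \<in> iso (presented_monoid A R) G.
       \<forall>w \<in> lists A. h (pres_cong A R `` {w}) = word_value G \<phi> w)"

definition rewrite_step :: "'a set \<Rightarrow> ('a list \<times> 'a list) set \<Rightarrow> ('a list \<times> 'a list) set" where
  "rewrite_step A R =
    {(x @ u @ y, x @ v @ y) | x u v y. x \<in> lists A \<and> y \<in> lists A \<and> (u, v) \<in> R}"

text \<open>In the following definition \<^const>\<open>sublist\<close> means contiguous subword.\<close>

definition finite_complete_rewriting_system ::
    "('g, 'm) monoid_scheme \<Rightarrow> 'a set \<Rightarrow> ('a \<Rightarrow> 'g) \<Rightarrow> ('a list \<times> 'a list) set \<Rightarrow> bool" where
  "finite_complete_rewriting_system G A \<phi> R \<longleftrightarrow>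
     group G \<and> finite A \<and> (\<forall>a\<in>A. \<phi> a \<in> carrier G) \<and> word_value G \<phi> ` lists A = carrier G \<and>
     finite R \<and> R \<subseteq> lists A \<times> lists A \<and>
     is_monoid_presentation G A \<phi> R \<and>
     (\<forall>g \<in> carrier G. \<exists>!w. w \<in> lists A \<and> word_value G \<phi> w = g \<and> (\<forall>(u, v) \<in> R. \<not> sublist u w)) \<and>
     (\<nexists>w :: nat \<Rightarrow> 'a list. \<forall>i. (w i, w (Suc i)) \<in> rewrite_step A R)"


section \<open>Signed letters and group presentations\<close>

text \<open>
  The pair \<open>(s, True)\<close> is the letter \<open>s\<close>, and \<open>(s, False)\<close> is its formal inverse.
\<close>

type_synonym 'x gword = "('x \<times> bool) list"

abbreviation letter :: "'x \<Rightarrow> 'x gword" where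
  "letter s \<equiv> [(s, True)]"

definition inv_word :: "'x gword \<Rightarrow> 'x gword" ("_\<^sup>-" [1000] 999) where
  "w\<^sup>- = rev (map (\<lambda>(s, \<epsilon>). (s, \<not> \<epsilon>)) w)"

definition pow_word :: "'x gword \<Rightarrow> int \<Rightarrow> 'x gword" (infixr "\<up>" 80) where
  "w \<up> k = concat (replicate (nat \<bar>k\<bar>) (if k < 0 then w\<^sup>- else w))"

definition comm_word :: "'x gword \<Rightarrow> 'x gword \<Rightarrow> 'x gword" where
  "comm_word u v = u @ v @ u\<^sup>- @ v\<^sup>-"

definition signed_letters :: "'x set \<Rightarrow> ('x \<times> bool) set" where
  "signed_letters X = X \<times> UNIV"

definition cancellation_rules :: "'x set \<Rightarrow> ('x gword \<times> 'x gword) set" where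
  "cancellation_rules X = {([(z, \<epsilon>), (z, \<not> \<epsilon>)], []) | z \<epsilon>. z \<in> X}"

text \<open>
  The group with generators \<open>X\<close> and defining relations \<open>Q\<close>, realised as the quotient of the free
  monoid on \<open>X\<close> and its formal inverses by the congruence generated by free cancellation and \<open>Q\<close>.
\<close>

definition presented_group :: "'x set \<Rightarrow> ('x gword \<times> 'x gword) set \<Rightarrow> 'x gword set monoid" where
  "presented_group X Q = presented_monoid (signed_letters X) (cancellation_rules X \<union> Q)"

definition group_letter ::
    "'x set \<Rightarrow> ('x gword \<times> 'x gword) set \<Rightarrow> 'x \<times> bool \<Rightarrow> 'x gword set" where
  "group_letter X Q a = pres_cong (signed_letters X) (cancellation_rules X \<union> Q) `` {[a]}"

lemma group_presented_group: "group (presented_group X Q)"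
proof -
  let ?A = "signed_letters X" and ?R = "cancellation_rules X \<union> Q"
  have inv_lists: "w\<^sup>- \<in> lists ?A" if "w \<in> lists ?A" for w
    using that by (auto simp: inv_word_def signed_letters_def)
  have cancel: "(w\<^sup>- @ w, []) \<in> pres_cong ?A ?R" if "w \<in> lists ?A" for w
    using that
  proof (induction w)
    case Nil
    then show ?case by (auto simp: inv_word_def intro: pres_cong.refl)
  next
    case (Cons c w)
    obtain z \<epsilon> where c: "c = (z, \<epsilon>)" by (cases c)
    have "([(z, \<not> \<epsilon>), (z, \<epsilon>)], []) \<in> cancellation_rules X"
      using Cons.hyps c by (auto simp: cancellation_rules_def signed_letters_def)
    then have "([(z, \<not> \<epsilon>), (z, \<epsilon>)], []) \<in> pres_cong ?A ?R"
      using Cons.hyps c by (intro pres_cong.rel) (auto simp: signed_letters_def)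
    from pres_cong.append[OF pres_cong.refl[OF inv_lists[OF Cons.hyps(2)]]
        pres_cong.append[OF this pres_cong.refl[OF Cons.hyps(2)]]]
    have "((c # w)\<^sup>- @ (c # w), w\<^sup>- @ w) \<in> pres_cong ?A ?R"
      by (simp add: inv_word_def c)
    from pres_cong.trans[OF this Cons.IH] show ?case .
  qed
  show ?thesis
    unfolding presented_group_def
  proof (rule monoid.group_l_invI[OF monoid_presented_monoid], goal_cases)
    case (1 C)
    then obtain w where w: "w \<in> lists ?A" "C = pres_cong ?A ?R `` {w}"
      by (auto simp: carrier_presented_monoid)
    then have "pres_cong ?A ?R `` {w\<^sup>-} \<otimes>\<^bsub>presented_monoid ?A ?R\<^esub> C = \<one>\<^bsub>presented_monoid ?A ?R\<^esub>"
      using equiv_class_eq[OF equiv_pres_cong cancel]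
      by (simp add: pres_class_mult one_presented_monoid inv_lists)
    then show ?case
      using inv_lists[OF w(1)] by (auto simp: carrier_presented_monoid)
  qed
qed

lemma word_value_presented_group:
  assumes "w \<in> lists (signed_letters X)"
  shows "word_value (presented_group X Q) (group_letter X Q) w =
    pres_cong (signed_letters X) (cancellation_rules X \<union> Q) `` {w}"
  using assms
proof (induction w)
  case Nil
  then show ?case by (simp add: word_value_def presented_group_def one_presented_monoid)
next
  case (Cons c w)
  then show ?case
    using pres_class_mult[of "[c]" "signed_letters X" w]
    by (simp add: word_value_def presented_group_def group_letter_def)
qed


section \<open>Graphs of circle bundles\<close>

subsection \<open>The graph\<close>

text \<open>
  The multigraph is given with an orientation of its edges, so that \<^const>\<open>tail\<close> and \<^const>\<open>head\<close>
  are the initial and terminal vertices. The library's \<^const>\<open>forest\<close> and \<^const>\<open>tree\<close> only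
  exclude directed cycles (and an orientation from blue to red never has any), so trees are defined
  here through undirected cycles: closed walks that may traverse edges in either direction, do not
  repeat a vertex and do not use an edge twice. Parallel edges form such a cycle.
\<close>

definition bidirected :: "('v, 'e) pre_digraph \<Rightarrow> ('v, 'e \<times> bool) pre_digraph" where
  "bidirected \<Gamma> =
    \<lparr>verts = verts \<Gamma>, arcs = arcs \<Gamma> \<times> UNIV,
     tail = (\<lambda>(e, \<epsilon>). if \<epsilon> then tail \<Gamma> e else head \<Gamma> e),
     head = (\<lambda>(e, \<epsilon>). if \<epsilon> then head \<Gamma> e else tail \<Gamma> e)\<rparr>"

definition undirected_tree :: "('v, 'e) pre_digraph \<Rightarrow> bool" where
  "undirected_tree \<Gamma> \<longleftrightarrow>
    connected \<Gamma> \<and> \<not> (\<exists>p. pre_digraph.cycle (bidirected \<Gamma>) p \<and> distinct (map fst p))"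

definition edges :: "('v, 'e) pre_digraph \<Rightarrow> 'e set" where
  "edges \<Gamma> = {e \<in> arcs \<Gamma>. tail \<Gamma> e \<noteq> head \<Gamma> e}"

definition loops :: "('v, 'e) pre_digraph \<Rightarrow> 'e set" where
  "loops \<Gamma> = {l \<in> arcs \<Gamma>. tail \<Gamma> l = head \<Gamma> l}"

definition remove_loops :: "('v, 'e) pre_digraph \<Rightarrow> ('v, 'e) pre_digraph" where
  "remove_loops \<Gamma> = \<Gamma>\<lparr>arcs := edges \<Gamma>\<rparr>"

subsection \<open>The defining data\<close>

text \<open>
  \<open>edge_order v\<close> and \<open>loop_order v\<close> are the fixed listings of the non-loop edges and of the loops
  at \<open>v\<close>; \<open>edge_int e\<close> and \<open>loop_int l\<close> are the gluing integers \<open>n\<^sub>e\<close> and \<open>m\<^sub>l\<close>.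
\<close>

record ('v, 'e) bundle_data =
  base :: "('v, 'e) pre_digraph"
  blue :: "'v \<Rightarrow> bool"
  edge_order :: "'v \<Rightarrow> 'e list"
  loop_order :: "'v \<Rightarrow> 'e list"
  genus :: "'v \<Rightarrow> nat"
  edge_int :: "'e \<Rightarrow> int"
  loop_int :: "'e \<Rightarrow> int"

abbreviation Vs :: "('v, 'e) bundle_data \<Rightarrow> 'v set" where "Vs D \<equiv> verts (base D)"
abbreviation Es :: "('v, 'e) bundle_data \<Rightarrow> 'e set" where "Es D \<equiv> edges (base D)"
abbreviation Ls :: "('v, 'e) bundle_data \<Rightarrow> 'e set" where "Ls D \<equiv> loops (base D)"
abbreviation \<iota> :: "('v, 'e) bundle_data \<Rightarrow> 'e \<Rightarrow> 'v" where "\<iota> D \<equiv> tail (base D)"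
abbreviation \<tau> :: "('v, 'e) bundle_data \<Rightarrow> 'e \<Rightarrow> 'v" where "\<tau> D \<equiv> head (base D)"

definition alternating_colouring :: "('v, 'e) bundle_data \<Rightarrow> bool" where
  "alternating_colouring D \<longleftrightarrow> (\<forall>e \<in> Es D. blue D (\<iota> D e) \<and> \<not> blue D (\<tau> D e))"

definition valid_orders :: "('v, 'e) bundle_data \<Rightarrow> bool" where
  "valid_orders D \<longleftrightarrow>
    (\<forall>v \<in> Vs D.
      distinct (edge_order D v) \<and> set (edge_order D v) = {e \<in> Es D. \<iota> D e = v \<or> \<tau> D e = v} \<and>
      distinct (loop_order D v) \<and> set (loop_order D v) = {l \<in> Ls D. \<iota> D l = v})"

definition blue_verts :: "('v, 'e) bundle_data \<Rightarrow> 'v set" where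
  "blue_verts D = {v \<in> Vs D. blue D v}"

definition red_verts :: "('v, 'e) bundle_data \<Rightarrow> 'v set" where
  "red_verts D = {w \<in> Vs D. \<not> blue D w}"

definition blue_loops :: "('v, 'e) bundle_data \<Rightarrow> 'e set" where
  "blue_loops D = {k \<in> Ls D. blue D (\<iota> D k)}"

definition red_loops :: "('v, 'e) bundle_data \<Rightarrow> 'e set" where
  "red_loops D = {l \<in> Ls D. \<not> blue D (\<iota> D l)}"

definition out_edges :: "('v, 'e) bundle_data \<Rightarrow> 'v \<Rightarrow> 'e list" where
  "out_edges D v = filter (\<lambda>e. \<iota> D e = v) (edge_order D v)"

definition in_edges :: "('v, 'e) bundle_data \<Rightarrow> 'v \<Rightarrow> 'e list" where
  "in_edges D v = filter (\<lambda>e. \<tau> D e = v) (edge_order D v)"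

definition n_red :: "('v, 'e) bundle_data \<Rightarrow> 'v \<Rightarrow> int" where
  "n_red D w = (\<Sum>e \<in> {e \<in> Es D. \<tau> D e = w}. edge_int D e)"

subsection \<open>The fundamental group\<close>

datatype ('v, 'e) gen =
  Gx 'v | Ga 'v nat | Gb 'v nat | Gp 'e | Gq 'e | Gr 'e | Gs 'e | Gt 'e

abbreviation wx :: "'v \<Rightarrow> ('v, 'e) gen gword" where "wx v \<equiv> letter (Gx v)"
abbreviation wa :: "'v \<Rightarrow> nat \<Rightarrow> ('v, 'e) gen gword" where "wa v j \<equiv> letter (Ga v j)"
abbreviation wb :: "'v \<Rightarrow> nat \<Rightarrow> ('v, 'e) gen gword" where "wb v j \<equiv> letter (Gb v j)"
abbreviation wp :: "'e \<Rightarrow> ('v, 'e) gen gword" where "wp e \<equiv> letter (Gp e)"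
abbreviation wq :: "'e \<Rightarrow> ('v, 'e) gen gword" where "wq e \<equiv> letter (Gq e)"
abbreviation wr :: "'e \<Rightarrow> ('v, 'e) gen gword" where "wr l \<equiv> letter (Gr l)"
abbreviation ws :: "'e \<Rightarrow> ('v, 'e) gen gword" where "ws l \<equiv> letter (Gs l)"
abbreviation wt :: "'e \<Rightarrow> ('v, 'e) gen gword" where "wt l \<equiv> letter (Gt l)"

definition surface_gens :: "('v, 'e) bundle_data \<Rightarrow> 'v \<Rightarrow> ('v, 'e) gen set" where
  "surface_gens D v =
     Ga v ` {1..genus D v} \<union> Gb v ` {1..genus D v} \<union>
     Gp ` {e \<in> Es D. \<iota> D e = v} \<union> Gq ` {e \<in> Es D. \<tau> D e = v} \<union>
     Gr ` {l \<in> Ls D. \<iota> D l = v} \<union> Gs ` {l \<in> Ls D. \<iota> D l = v}"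

definition loop_product :: "('v, 'e) bundle_data \<Rightarrow> 'v \<Rightarrow> ('v, 'e) gen gword" where
  "loop_product D v = concat (map (\<lambda>l. wr l @ ws l) (loop_order D v))"

text \<open>Relations of \<open>\<pi>\<^sub>1(M\<^sub>v)\<close>: the surface relation, and \<open>x\<^sub>v\<close> generates a direct factor.\<close>

definition vertex_relations ::
    "('v, 'e) bundle_data \<Rightarrow> 'v \<Rightarrow> (('v, 'e) gen gword \<times> ('v, 'e) gen gword) set" where
  "vertex_relations D v =
     {(concat (map wp (out_edges D v)) @ concat (map wq (in_edges D v)) @ loop_product D v,
       concat (map (\<lambda>j. comm_word (wa v j) (wb v j)) [1..<Suc (genus D v)]))} \<union>
     {(wx v @ letter y, letter y @ wx v) | y. y \<in> surface_gens D v}"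

definition gluing_relations ::
    "('v, 'e) bundle_data \<Rightarrow> (('v, 'e) gen gword \<times> ('v, 'e) gen gword) set" where
  "gluing_relations D =
     {(wx (\<iota> D e), wq e @ wx (\<tau> D e) \<up> edge_int D e) | e. e \<in> Es D} \<union>
     {(wp e, wx (\<tau> D e)) | e. e \<in> Es D} \<union>
     {(wt l @ wx (\<iota> D l) @ (wt l)\<^sup>-, ws l @ wx (\<iota> D l) \<up> loop_int D l) | l. l \<in> Ls D} \<union>
     {(wt l @ wr l @ (wt l)\<^sup>-, wx (\<iota> D l)) | l. l \<in> Ls D}"

definition pi1_gens :: "('v, 'e) bundle_data \<Rightarrow> ('v, 'e) gen set" where
  "pi1_gens D = (\<Union>v \<in> Vs D. insert (Gx v) (surface_gens D v)) \<union> Gt ` Ls D"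

definition pi1_relations ::
    "('v, 'e) bundle_data \<Rightarrow> (('v, 'e) gen gword \<times> ('v, 'e) gen gword) set" where
  "pi1_relations D = (\<Union>v \<in> Vs D. vertex_relations D v) \<union> gluing_relations D"

definition pi1 :: "('v, 'e) bundle_data \<Rightarrow> ('v, 'e) gen gword set monoid" where
  "pi1 D = presented_group (pi1_gens D) (pi1_relations D)"

definition pi1_letter :: "('v, 'e) bundle_data \<Rightarrow> ('v, 'e) gen \<times> bool \<Rightarrow> ('v, 'e) gen gword set" where
  "pi1_letter D = group_letter (pi1_gens D) (pi1_relations D)"


subsection \<open>The alphabet\<close>

definition S_gens :: "('v, 'e) bundle_data \<Rightarrow> ('v, 'e) gen set" where
  "S_gens D = Gx ` Vs D \<union>
     {Ga v j | v j. v \<in> Vs D \<and> j \<in> {1..genus D v}} \<union>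
     {Gb v j | v j. v \<in> Vs D \<and> j \<in> {1..genus D v}} \<union>
     Gr ` Ls D \<union> Gs ` Ls D \<union> Gt ` Ls D"

definition alphabet :: "('v, 'e) bundle_data \<Rightarrow> (('v, 'e) gen \<times> bool) set" where
  "alphabet D = signed_letters (S_gens D)"


subsection \<open>The rewriting rules\<close>

definition commuting_rules :: "'x \<Rightarrow> 'x \<Rightarrow> ('x gword \<times> 'x gword) set" where
  "commuting_rules y z = {([(y, \<delta>), (z, \<epsilon>)], [(z, \<epsilon>), (y, \<delta>)]) | \<delta> \<epsilon>. True}"

definition \<Lambda> :: "('v, 'e) bundle_data \<Rightarrow> 'v \<Rightarrow> ('v, 'e) gen gword" where
  "\<Lambda> D v = concat (map (\<lambda>e. wx (\<tau> D e)) (out_edges D v)) @ loop_product D v"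

definition \<Omega> :: "('v, 'e) bundle_data \<Rightarrow> 'v \<Rightarrow> ('v, 'e) gen gword" where
  "\<Omega> D w = concat (map (\<lambda>e. wx (\<iota> D e)) (in_edges D w)) @ loop_product D w"

text \<open>\<open>[b\<^sub>g, a\<^sub>g] \<dots> [b\<^sub>2, a\<^sub>2]\<close> and \<open>[a\<^sub>2, b\<^sub>2] \<dots> [a\<^sub>g, b\<^sub>g]\<close>.\<close>

definition comms_down :: "('v, 'e) bundle_data \<Rightarrow> 'v \<Rightarrow> ('v, 'e) gen gword" where
  "comms_down D v = concat (map (\<lambda>j. comm_word (wb v j) (wa v j)) (rev [2..<Suc (genus D v)]))"

definition comms_up :: "('v, 'e) bundle_data \<Rightarrow> 'v \<Rightarrow> ('v, 'e) gen gword" where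
  "comms_up D v = concat (map (\<lambda>j. comm_word (wa v j) (wb v j)) [2..<Suc (genus D v)])"

definition blue_vertex_rules ::
    "('v, 'e) bundle_data \<Rightarrow> (('v, 'e) gen gword \<times> ('v, 'e) gen gword) set" where
  "blue_vertex_rules D =
     (\<Union>v \<in> blue_verts D. \<Union>i \<in> {1..genus D v}.
        commuting_rules (Gx v) (Ga v i) \<union> commuting_rules (Gx v) (Gb v i)) \<union>
     (\<Union>k \<in> blue_loops D.
        commuting_rules (Gx (\<iota> D k)) (Gr k) \<union> commuting_rules (Gx (\<iota> D k)) (Gs k))"

definition red_vertex_rules ::
    "('v, 'e) bundle_data \<Rightarrow> (('v, 'e) gen gword \<times> ('v, 'e) gen gword) set" where
  "red_vertex_rules D =
     (\<Union>w \<in> red_verts D. \<Union>i \<in> {1..genus D w}.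
        commuting_rules (Ga w i) (Gx w) \<union> commuting_rules (Gb w i) (Gx w)) \<union>
     (\<Union>l \<in> red_loops D.
        commuting_rules (Gr l) (Gx (\<iota> D l)) \<union> commuting_rules (Gs l) (Gx (\<iota> D l)))"

definition edge_rules ::
    "('v, 'e) bundle_data \<Rightarrow> (('v, 'e) gen gword \<times> ('v, 'e) gen gword) set" where
  "edge_rules D = (\<Union>e \<in> Es D. commuting_rules (Gx (\<iota> D e)) (Gx (\<tau> D e)))"

definition blue_amalgam_rules ::
    "('v, 'e) bundle_data \<Rightarrow> (('v, 'e) gen gword \<times> ('v, 'e) gen gword) set" where
  "blue_amalgam_rules D = (\<Union>v \<in> blue_verts D.
     {(wa v 1 @ wb v 1,
         \<Lambda> D v @ comms_down D v @ wb v 1 @ wa v 1),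
      (wa v 1 @ (wb v 1)\<^sup>-,
         (wb v 1)\<^sup>- @ comms_up D v @ (\<Lambda> D v)\<^sup>- @ wa v 1),
      ((wa v 1)\<^sup>- @ \<Lambda> D v @ comms_down D v @ wb v 1,
         wb v 1 @ (wa v 1)\<^sup>-),
      ((wa v 1)\<^sup>- @ (wb v 1)\<^sup>-,
         (wb v 1)\<^sup>- @ (wa v 1)\<^sup>- @ \<Lambda> D v @ comms_down D v)})"

definition red_amalgam_rules ::
    "('v, 'e) bundle_data \<Rightarrow> (('v, 'e) gen gword \<times> ('v, 'e) gen gword) set" where
  "red_amalgam_rules D = (\<Union>w \<in> red_verts D.
     {(wa w 1 @ wb w 1,
         wx w \<up> (- n_red D w) @ \<Omega> D w @ comms_down D w @ wb w 1 @ wa w 1),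
      (wa w 1 @ (wb w 1)\<^sup>-,
         wx w \<up> n_red D w @ (wb w 1)\<^sup>- @ comms_up D w @ (\<Omega> D w)\<^sup>- @ wa w 1),
      ((wa w 1)\<^sup>- @ \<Omega> D w @ comms_down D w @ wb w 1,
         wx w \<up> n_red D w @ wb w 1 @ (wa w 1)\<^sup>-),
      ((wa w 1)\<^sup>- @ (wb w 1)\<^sup>-,
         wx w \<up> (- n_red D w) @ (wb w 1)\<^sup>- @ (wa w 1)\<^sup>- @ \<Omega> D w @ comms_down D w)})"

definition blue_hnn_rules ::
    "('v, 'e) bundle_data \<Rightarrow> (('v, 'e) gen gword \<times> ('v, 'e) gen gword) set" where
  "blue_hnn_rules D = (\<Union>k \<in> blue_loops D.
     let x = wx (\<iota> D k); r = wr k; s = ws k; t = wt k; m = loop_int D k in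
     {(x @ t, t @ r),
      (x\<^sup>- @ t, t @ r\<^sup>-),
      (r @ t\<^sup>-, t\<^sup>- @ x),
      (r\<^sup>- @ t\<^sup>-, t\<^sup>- @ x\<^sup>-),
      (s @ t, t @ r \<up> (- m) @ x),
      (s\<^sup>- @ t, t @ r \<up> m @ x\<^sup>-),
      (x @ t\<^sup>-, t\<^sup>- @ s @ x \<up> m),
      (x\<^sup>- @ t\<^sup>-, t\<^sup>- @ s\<^sup>- @ x \<up> (- m))})"

definition red_hnn_rules ::
    "('v, 'e) bundle_data \<Rightarrow> (('v, 'e) gen gword \<times> ('v, 'e) gen gword) set" where
  "red_hnn_rules D = (\<Union>l \<in> red_loops D.
     let x = wx (\<iota> D l); r = wr l; s = ws l; t = wt l; m = loop_int D l in
     {(t @ r, x @ t),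
      (t @ r\<^sup>-, x\<^sup>- @ t),
      (t\<^sup>- @ x, r @ t\<^sup>-),
      (t\<^sup>- @ x\<^sup>-, r\<^sup>- @ t\<^sup>-),
      (t @ x, x \<up> m @ s @ t),
      (t @ x\<^sup>-, x \<up> (- m) @ s\<^sup>- @ t),
      (t\<^sup>- @ s, x @ r \<up> (- m) @ t\<^sup>-),
      (t\<^sup>- @ s\<^sup>-, x\<^sup>- @ r \<up> m @ t\<^sup>-)})"

definition rules ::
    "('v, 'e) bundle_data \<Rightarrow> (('v, 'e) gen gword \<times> ('v, 'e) gen gword) set" where
  "rules D = cancellation_rules (S_gens D) \<union>
     blue_vertex_rules D \<union> red_vertex_rules D \<union> edge_rules D \<union>
     blue_amalgam_rules D \<union> red_amalgam_rules D \<union> blue_hnn_rules D \<union> red_hnn_rules D"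

end

theory Submission
  imports Defs "HOL-Library.Multiset"
begin

text \<open>
  The rules are a terminating and locally confluent system, so by Newman's lemma every congruence
  class of words over the alphabet contains exactly one irreducible word; and the congruence that they
  generate is that of the fundamental group.

  The system becomes transparent when the rules are grouped by what they do. At a blue vertex the
  fibre \<open>x\<^sub>v\<close> moves to the right past every letter that commutes with it, at a red vertex to the left.
  The four amalgam relators at \<open>v\<close> solve one relation \<open>a\<^sub>1 b\<^sub>1 = x\<^sub>v\<^sup>-\<^sup>n W b\<^sub>1 a\<^sub>1\<close> for the four products
  \<open>a\<^sub>1\<^sup>\<plusminus>\<^sup>1 b\<^sub>1\<^sup>\<plusminus>\<^sup>1\<close>, where \<open>W\<close> does not contain \<open>a\<^sub>1\<close> or \<open>b\<^sub>1\<close>. The rules of a loop move letters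
  through the stable letter, to the right at a blue vertex and to the left at a red one; the rules of
  a red loop are those of a blue loop read backwards, with \<open>t\<close> and \<open>t\<^sup>-\<^sup>1\<close> exchanged.

  Termination (\<open>wf_rules\<close>). A rule lowers one of three numbers without raising those listed before it.
  The first is the number of pairs \<open>a\<^sub>v\<^sub>1 \<dots> b\<^sub>v\<^sub>1\<close> in a word, which only amalgam and cancellation rules
  change. Without amalgam rules the colours interact only when two fibres change places, so each
  colour may be measured separately: a word acts on the natural numbers, with \<open>t\<^sub>k\<close> multiplying by more
  than the number of letters that one letter can become when it crosses \<open>t\<^sub>k\<close>. This second number falls
  under the loop and cancellation rules and is not affected by commutations, which lower the third
  number, that of the pairs still to be exchanged.

  Local confluence (\<open>locally_confluent_rules\<close>). Left-hand sides overlap in at most one letter and are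
  not contained in one another. The overlaps that are not resolved at once are those with a
  cancellation rule and those of a moving fibre with an amalgam or loop rule.

  The presentation (\<open>rules_cong_iff_pi1_cong\<close>). Eliminating \<open>p\<^sub>e\<close> and \<open>q\<^sub>e\<close> leaves a presentation on the
  letters of the alphabet, isolated in the locale \<open>bundle_congruence\<close>. It holds both in the
  fundamental group and modulo the rules; conversely it implies every rule and, after the elimination,
  every relation of the fundamental group.
\<close>

section \<open>String rewriting\<close>

lemma rewrite_step_context:
  assumes "(u, v) \<in> rewrite_step UNIV R"
  shows "(x @ u @ y, x @ v @ y) \<in> rewrite_step UNIV R"
proof -
  obtain p s t q where "u = p @ s @ q" "v = p @ t @ q" "(s, t) \<in> R"
    using assms by (auto simp: rewrite_step_def)
  then have "x @ u @ y = (x @ p) @ s @ (q @ y) \<and> x @ v @ y = (x @ p) @ t @ (q @ y) \<and> (s, t) \<in> R"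
    by simp
  then show ?thesis
    unfolding rewrite_step_def mem_Collect_eq lists_UNIV by blast
qed

lemma rewrite_step_rule: "(u, v) \<in> R \<Longrightarrow> (u, v) \<in> rewrite_step UNIV R"
  unfolding rewrite_step_def
  by (rule CollectI, intro exI[of _ "[]"] exI[of _ u] exI[of _ v]) auto

lemma rewrites_context:
  assumes "(u, v) \<in> (rewrite_step UNIV R)\<^sup>*"
  shows "(x @ u @ y, x @ v @ y) \<in> (rewrite_step UNIV R)\<^sup>*"
  using assms by induction (auto intro: rewrite_step_context rtrancl.rtrancl_into_rtrancl)

definition joinable :: "('a list \<times> 'a list) set \<Rightarrow> 'a list \<Rightarrow> 'a list \<Rightarrow> bool" where
  "joinable R u v \<longleftrightarrow> (\<exists>w. (u, w) \<in> (rewrite_step UNIV R)\<^sup>* \<and> (v, w) \<in> (rewrite_step UNIV R)\<^sup>*)"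

definition locally_confluent :: "('a list \<times> 'a list) set \<Rightarrow> bool" where
  "locally_confluent R \<longleftrightarrow> (\<forall>w w1 w2. (w, w1) \<in> rewrite_step UNIV R \<longrightarrow>
     (w, w2) \<in> rewrite_step UNIV R \<longrightarrow> joinable R w1 w2)"

definition confluent :: "('a list \<times> 'a list) set \<Rightarrow> bool" where
  "confluent R \<longleftrightarrow> (\<forall>w w1 w2. (w, w1) \<in> (rewrite_step UNIV R)\<^sup>* \<longrightarrow>
     (w, w2) \<in> (rewrite_step UNIV R)\<^sup>* \<longrightarrow> joinable R w1 w2)"

lemma joinable_refl: "joinable R u u"
  by (auto simp: joinable_def)

lemma joinable_sym: "joinable R u v \<Longrightarrow> joinable R v u"
  by (auto simp: joinable_def)

lemma joinable_context: "joinable R u v \<Longrightarrow> joinable R (x @ u @ y) (x @ v @ y)"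
  unfolding joinable_def using rewrites_context by blast

text \<open>
  Two redexes in one word are disjoint, or overlap in a proper suffix of one that is a proper prefix
  of the other, or one lies inside the other. Disjoint redexes can be rewritten in either order, so
  only the other two cases have to be checked.
\<close>

lemma critical_pairs_imp_locally_confluent:
  assumes inside: "\<And>p u r v v'. (p @ u @ r, v) \<in> R \<Longrightarrow> (u, v') \<in> R \<Longrightarrow> joinable R v (p @ v' @ r)"
    and overlap: "\<And>p q r v v'. (p @ q, v) \<in> R \<Longrightarrow> (q @ r, v') \<in> R \<Longrightarrow>
      p \<noteq> [] \<Longrightarrow> q \<noteq> [] \<Longrightarrow> r \<noteq> [] \<Longrightarrow> joinable R (v @ r) (p @ v')"
  shows "locally_confluent R"
proof -
  \<comment> \<open>By symmetry, the redex \<open>u\<close> starts no later than the redex \<open>u'\<close>.\<close>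
  have ordered: "joinable R (x @ v @ y) (x @ z @ v' @ y')"
    if R: "(u, v) \<in> R" "(u', v') \<in> R" and eq: "u @ y = z @ u' @ y'" for x u v y z u' v' y'
  proof -
    consider (disjoint) s where "z = u @ s" "y = s @ u' @ y'"
      | (inside) s where "u = z @ u' @ s" "y' = s @ y"
      | (prefix) s where "z = []" "u' = u @ s" "y = s @ y'"
      | (overlap) s t where "u = z @ s" "u' = s @ t" "y = t @ y'" "z \<noteq> []" "s \<noteq> []" "t \<noteq> []"
    proof -
      obtain s where "u = z @ s \<and> s @ y = u' @ y' \<or> u @ s = z \<and> y = s @ u' @ y'"
        using eq unfolding append_eq_append_conv2 by blast
      then show thesis
      proof
        assume s: "u = z @ s \<and> s @ y = u' @ y'"
        then obtain t where "s = u' @ t \<and> t @ y = y' \<or> s @ t = u' \<and> y = t @ y'"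
          unfolding append_eq_append_conv2 by blast
        then show thesis
        proof
          assume t: "s @ t = u' \<and> y = t @ y'"
          consider "z = []" | "s = []" | "t = []" | "z \<noteq> []" "s \<noteq> []" "t \<noteq> []" by blast
          then show thesis
            using s t that by cases auto
        qed (use s that in auto)
      qed (use that in auto)
    qed
    then show ?thesis
    proof cases
      case disjoint
      have "(v @ s @ u', v @ s @ v') \<in> rewrite_step UNIV R" "(u @ s @ v', v @ s @ v') \<in> rewrite_step UNIV R"
        using rewrite_step_context[OF rewrite_step_rule[OF R(2)], of "v @ s" "[]"]
          rewrite_step_context[OF rewrite_step_rule[OF R(1)], of "[]" "s @ v'"] by simp_all
      then have "joinable R (v @ s @ u') (u @ s @ v')"
        by (auto simp: joinable_def)
      from joinable_context[OF this, of x y'] show ?thesis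
        using disjoint by simp
    next
      case inside
      then show ?thesis
        using joinable_context[OF assms(1)[of z u' s v v'], of x y] R by simp
    next
      case prefix
      then show ?thesis
        using joinable_context[OF joinable_sym[OF assms(1)[of "[]" u s v' v]], of x y'] R by simp
    next
      case overlap
      then show ?thesis
        using joinable_context[OF assms(2)[of z s v t v'], of x y'] R by simp
    qed
  qed
  show ?thesis
    unfolding locally_confluent_def
  proof (intro allI impI)
    fix w w1 w2
    assume steps: "(w, w1) \<in> rewrite_step UNIV R" "(w, w2) \<in> rewrite_step UNIV R"
    obtain x u v y where 1: "w = x @ u @ y" "w1 = x @ v @ y" "(u, v) \<in> R"
      using steps(1) by (auto simp: rewrite_step_def)
    obtain x' u' v' y' where 2: "w = x' @ u' @ y'" "w2 = x' @ v' @ y'" "(u', v') \<in> R"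
      using steps(2) by (auto simp: rewrite_step_def)
    from 1 2 have "x @ u @ y = x' @ u' @ y'" by simp
    then obtain z where "x = x' @ z \<and> z @ u @ y = u' @ y' \<or> x @ z = x' \<and> u @ y = z @ u' @ y'"
      unfolding append_eq_append_conv2 by blast
    then show "joinable R w1 w2"
    proof
      assume z: "x = x' @ z \<and> z @ u @ y = u' @ y'"
      then have "joinable R w2 w1"
        using ordered[of u' v' u v y' z y x'] 1 2 by simp
      then show ?thesis by (rule joinable_sym)
    next
      assume "x @ z = x' \<and> u @ y = z @ u' @ y'"
      then show ?thesis
        using ordered[of u v u' v' y z y' x] 1 2 by auto
    qed
  qed
qed

text \<open>Newman's lemma, by well-founded induction on the common source of the two reductions.\<close>

lemma locally_confluent_terminating_imp_confluent:
  assumes wf: "wf ((rewrite_step UNIV R)\<inverse>)"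
    and local: "locally_confluent R"
  shows "confluent R"
proof -
  have "joinable R w1 w2" if "(w, w1) \<in> (rewrite_step UNIV R)\<^sup>*" "(w, w2) \<in> (rewrite_step UNIV R)\<^sup>*" for w w1 w2
    using wf that
  proof (induction w arbitrary: w1 w2 rule: wf_induct_rule)
    case (less w)
    note trans = rtrancl_trans[where r = "rewrite_step UNIV R"]
    show ?case
    proof (cases "w = w1 \<or> w = w2")
      case True
      then show ?thesis using less.prems by (auto simp: joinable_def)
    next
      case False
      obtain u1 where u1: "(w, u1) \<in> rewrite_step UNIV R" "(u1, w1) \<in> (rewrite_step UNIV R)\<^sup>*"
        using less.prems(1) False by (meson converse_rtranclE)
      obtain u2 where u2: "(w, u2) \<in> rewrite_step UNIV R" "(u2, w2) \<in> (rewrite_step UNIV R)\<^sup>*"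
        using less.prems(2) False by (meson converse_rtranclE)
      obtain c where c: "(u1, c) \<in> (rewrite_step UNIV R)\<^sup>*" "(u2, c) \<in> (rewrite_step UNIV R)\<^sup>*"
        using local u1(1) u2(1) unfolding locally_confluent_def joinable_def by blast
      obtain d where d: "(w1, d) \<in> (rewrite_step UNIV R)\<^sup>*" "(c, d) \<in> (rewrite_step UNIV R)\<^sup>*"
        using less.IH[of u1 w1 c] u1 c by (auto simp: joinable_def)
      obtain e where "(w2, e) \<in> (rewrite_step UNIV R)\<^sup>*" "(d, e) \<in> (rewrite_step UNIV R)\<^sup>*"
        using less.IH[of u2 w2 d] u2 trans[OF c(2) d(2)] by (auto simp: joinable_def)
      then show ?thesis
        using trans[OF d(1)] by (auto simp: joinable_def)
    qed
  qed
  then show ?thesis by (auto simp: confluent_def)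
qed

text \<open>
  The Church--Rosser property: confluence is what makes joinability transitive, and the other closure
  properties of a congruence hold for joinability in any rewriting system.
\<close>

lemma pres_cong_imp_joinable:
  assumes confluent: "confluent R"
    and "(u, v) \<in> pres_cong A R"
  shows "joinable R u v"
  using assms(2)
proof induction
  case (rel u v)
  then show ?case
    by (auto simp: joinable_def intro: rewrite_step_rule)
next
  case (trans u v w)
  then obtain c d where cd: "(u, c) \<in> (rewrite_step UNIV R)\<^sup>*" "(v, c) \<in> (rewrite_step UNIV R)\<^sup>*"
    "(v, d) \<in> (rewrite_step UNIV R)\<^sup>*" "(w, d) \<in> (rewrite_step UNIV R)\<^sup>*"
    by (auto simp: joinable_def)
  have "joinable R c d"
    using confluent cd(2,3) unfolding confluent_def by blast
  then show ?case
    using cd(1,4) by (auto simp: joinable_def intro: rtrancl_trans)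
next
  case (append u v u' v')
  then obtain c c' where "(u, c) \<in> (rewrite_step UNIV R)\<^sup>*" "(v, c) \<in> (rewrite_step UNIV R)\<^sup>*"
    "(u', c') \<in> (rewrite_step UNIV R)\<^sup>*" "(v', c') \<in> (rewrite_step UNIV R)\<^sup>*"
    by (auto simp: joinable_def)
  then have "(u @ u', c @ c') \<in> (rewrite_step UNIV R)\<^sup>*" "(v @ v', c @ c') \<in> (rewrite_step UNIV R)\<^sup>*"
    using rewrites_context[of u c R "[]" u'] rewrites_context[of u' c' R c "[]"]
      rewrites_context[of v c R "[]" v'] rewrites_context[of v' c' R c "[]"]
    by (auto intro: rtrancl_trans)
  then show ?case by (auto simp: joinable_def)
qed (auto simp: joinable_refl joinable_sym)

lemma irreducible_iff:
  "(\<forall>(u, v) \<in> R. \<not> sublist u w) \<longleftrightarrow> (\<nexists>w'. (w, w') \<in> rewrite_step UNIV R)"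
  by (fastforce simp: sublist_def rewrite_step_def)

lemma rewrites_in_lists:
  assumes "(u, v) \<in> (rewrite_step UNIV R)\<^sup>*" "u \<in> lists A" "R \<subseteq> lists A \<times> lists A"
  shows "v \<in> lists A \<and> (u, v) \<in> pres_cong A R"
  using assms(1)
proof induction
  case base
  then show ?case using assms(2) by (auto intro: pres_cong.refl)
next
  case (step v w)
  then obtain x s t y where st: "v = x @ s @ y" "w = x @ t @ y" "(s, t) \<in> R"
    by (auto simp: rewrite_step_def)
  then have lists: "x \<in> lists A" "y \<in> lists A" "s \<in> lists A" "t \<in> lists A"
    using step.IH assms(3) by auto
  then have "(v, w) \<in> pres_cong A R"
    unfolding st by (intro pres_cong.append pres_cong.refl pres_cong.rel st)
  then show ?case
    using step.IH st lists by (auto intro: pres_cong.trans)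
qed

text \<open>
  Termination provides an irreducible word in every congruence class, and irreducible words that are
  joinable coincide.
\<close>

lemma ex1_irreducible:
  assumes R: "R \<subseteq> lists A \<times> lists A"
    and wf: "wf ((rewrite_step UNIV R)\<inverse>)"
    and local: "locally_confluent R"
    and w: "w \<in> lists A"
  shows "\<exists>!w'. (w, w') \<in> pres_cong A R \<and> (\<forall>(u, v) \<in> R. \<not> sublist u w')"
proof (rule ex_ex1I)
  have "\<exists>w'. (w, w') \<in> (rewrite_step UNIV R)\<^sup>* \<and> (\<nexists>z. (w', z) \<in> rewrite_step UNIV R)"
    using wf
  proof (induction w rule: wf_induct_rule)
    case (less w)
    then show ?case
      by (metis converse_iff converse_rtrancl_into_rtrancl rtrancl.rtrancl_refl)
  qed
  then show "\<exists>w'. (w, w') \<in> pres_cong A R \<and> (\<forall>(u, v) \<in> R. \<not> sublist u w')"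
    unfolding irreducible_iff using rewrites_in_lists[OF _ w R] by blast
next
  fix w1 w2
  assume 1: "(w, w1) \<in> pres_cong A R \<and> (\<forall>(u, v) \<in> R. \<not> sublist u w1)"
    and 2: "(w, w2) \<in> pres_cong A R \<and> (\<forall>(u, v) \<in> R. \<not> sublist u w2)"
  then have "(w1, w2) \<in> pres_cong A R"
    by (meson pres_cong.sym pres_cong.trans)
  then have "joinable R w1 w2"
    by (rule pres_cong_imp_joinable[OF locally_confluent_terminating_imp_confluent[OF wf local]])
  then obtain z where "(w1, z) \<in> (rewrite_step UNIV R)\<^sup>*" "(w2, z) \<in> (rewrite_step UNIV R)\<^sup>*"
    by (auto simp: joinable_def)
  then show "w1 = w2"
    using 1 2 unfolding irreducible_iff by (metis converse_rtranclE)
qed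

text \<open>
  Calculations in a presented group are free of side conditions if every letter may be cancelled
  against its inverse, whether or not it belongs to the alphabet. This changes nothing on words over
  the alphabet: the other letters can be deleted from a derivation.
\<close>

lemma pres_cong_UNIV_imp_pres_cong:
  assumes Q: "Q \<subseteq> lists (signed_letters X) \<times> lists (signed_letters X)"
    and "(u, v) \<in> pres_cong UNIV (cancellation_rules UNIV \<union> Q)"
    and "u \<in> lists (signed_letters X)" "v \<in> lists (signed_letters X)"
  shows "(u, v) \<in> pres_cong (signed_letters X) (cancellation_rules X \<union> Q)"
proof -
  let ?A = "signed_letters X"
  define del where "del = filter (\<lambda>c. c \<in> ?A)"
  have del_id: "del w = w" if "w \<in> lists ?A" for w
    using that by (simp add: del_def filter_id_conv in_lists_conv_set)
  have del_in: "del w \<in> lists ?A" for w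
    by (auto simp: del_def)
  have "(del u, del v) \<in> pres_cong ?A (cancellation_rules X \<union> Q)"
    using assms(2)
  proof induction
    case (rel u v)
    show ?case
    proof (cases "(u, v) \<in> Q")
      case True
      then have "u \<in> lists ?A" "v \<in> lists ?A" using Q by blast+
      then show ?thesis using True by (simp add: del_id pres_cong.rel)
    next
      case False
      then obtain z \<epsilon> where z: "u = [(z, \<epsilon>), (z, \<not> \<epsilon>)]" "v = []"
        using rel by (auto simp: cancellation_rules_def)
      show ?thesis
      proof (cases "z \<in> X")
        case True
        then show ?thesis
          unfolding z by (intro pres_cong.rel)
            (auto simp: del_def signed_letters_def cancellation_rules_def)
      next
        case False
        then show ?thesis
          unfolding z by (auto simp: del_def signed_letters_def intro: pres_cong.refl)
      qed
    qed
  next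
    case (append u v u' v')
    then show ?case
      using pres_cong.append[OF append.IH] by (simp add: del_def)
  qed (use del_in in \<open>auto intro: pres_cong.refl pres_cong.sym pres_cong.trans\<close>)
  then show ?thesis using del_id assms(3,4) by simp
qed

lemma pres_cong_mono:
  assumes "(u, v) \<in> pres_cong A R"
    and "\<And>u v. (u, v) \<in> R \<Longrightarrow> (u, v) \<in> pres_cong B R'" "A \<subseteq> B"
  shows "(u, v) \<in> pres_cong B R'"
  using assms(1)
proof induction
  case (refl u)
  then show ?case using assms(3) by (intro pres_cong.refl) (auto simp: in_lists_conv_set)
qed (auto intro: assms(2) pres_cong.sym pres_cong.trans pres_cong.append)

section \<open>Signed words\<close>

lemma inv_word_simps [simp]:
  "([] :: 'x gword)\<^sup>- = []"
  "(((z, \<epsilon>) # w) :: 'x gword)\<^sup>- = w\<^sup>- @ [(z, \<not> \<epsilon>)]"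
  "((u @ v) :: 'x gword)\<^sup>- = v\<^sup>- @ u\<^sup>-"
  by (simp_all add: inv_word_def)

lemma inv_word_inv_word [simp]: "(w\<^sup>-)\<^sup>- = w"
  by (induction w) auto

lemma fst_set_inv_word [simp]: "fst ` set (w\<^sup>-) = fst ` set w"
  by (auto simp: inv_word_def image_iff split: prod.splits) force+

lemma pow_word_0 [simp]: "w \<up> 0 = []"
  by (simp add: pow_word_def)

lemma letter_pow: "letter s \<up> k = replicate (nat \<bar>k\<bar>) (s, 0 \<le> k)"
  by (cases "k < 0") (auto simp: pow_word_def inv_word_def concat_replicate_trivial)

lemma fst_set_letter_pow: "fst ` set (letter s \<up> k) \<subseteq> {s}"
  by (auto simp: letter_pow)

lemma inv_letter_pow: "(letter s \<up> k)\<^sup>- = letter s \<up> (- k)"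
  by (cases "k = 0") (auto simp: letter_pow inv_word_def rev_replicate)

lemma in_lists_signed_letters: "w \<in> lists (signed_letters X) \<longleftrightarrow> fst ` set w \<subseteq> X"
  by (auto simp: signed_letters_def in_lists_conv_set)

text \<open>
  A rule for a letter \<open>y\<close> and the rule for \<open>y\<^sup>-\<^sup>1\<close> differ by the sign of the exponent; this function
  allows one formula for both.
\<close>

definition signed_int :: "bool \<Rightarrow> int \<Rightarrow> int" where
  "signed_int \<delta> m = (if \<delta> then m else - m)"

lemma signed_int_simps [simp]:
  "signed_int True m = m" "signed_int False m = - m"
  "signed_int (\<not> \<delta>) m = - signed_int \<delta> m" "signed_int \<delta> (- m) = - signed_int \<delta> m"
  by (auto simp: signed_int_def)

lemma letter_pow_unit: "letter s \<up> signed_int \<delta> 1 = [(s, \<delta>)]"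
  by (auto simp: letter_pow signed_int_def)

section \<open>The rules in uniform notation\<close>

text \<open>
  The generators that commute with the fibre \<open>x\<^sub>v\<close>: those of the surface group at \<open>v\<close>, where
  \<open>p\<^sub>e\<close> and \<open>q\<^sub>e\<close> are replaced by the fibre of the adjacent vertex.
\<close>

definition local_gens :: "('v, 'e) bundle_data \<Rightarrow> 'v \<Rightarrow> ('v, 'e) gen set" where
  "local_gens D v =
     Ga v ` {1..genus D v} \<union> Gb v ` {1..genus D v} \<union>
     Gr ` {l \<in> Ls D. \<iota> D l = v} \<union> Gs ` {l \<in> Ls D. \<iota> D l = v} \<union>
     (\<lambda>e. Gx (\<tau> D e)) ` {e \<in> Es D. \<iota> D e = v} \<union> (\<lambda>e. Gx (\<iota> D e)) ` {e \<in> Es D. \<tau> D e = v}"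

text \<open>
  Blue fibres move to the right and red fibres to the left; an edge relator does both at once.
\<close>

definition commuting_pair :: "('v, 'e) bundle_data \<Rightarrow> ('v, 'e) gen \<Rightarrow> ('v, 'e) gen \<Rightarrow> bool" where
  "commuting_pair D y z \<longleftrightarrow>
     (\<exists>v \<in> blue_verts D. y = Gx v \<and> z \<in> local_gens D v) \<or>
     (\<exists>w \<in> red_verts D. z = Gx w \<and> y \<in> local_gens D w)"

text \<open>
  At a red vertex \<open>w\<close> each \<open>q\<^sub>e = x\<^sub>v x\<^sub>w\<^sup>-\<^sup>n\<close> contributes a power of the fibre \<open>x\<^sub>w\<close> to the surface relation;
  at a blue vertex \<open>p\<^sub>e\<close> is a single letter, and there is nothing to collect.
\<close>

definition twist :: "('v, 'e) bundle_data \<Rightarrow> 'v \<Rightarrow> int" where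
  "twist D v = (if blue D v then 0 else n_red D v)"

definition boundary_word :: "('v, 'e) bundle_data \<Rightarrow> 'v \<Rightarrow> ('v, 'e) gen gword" where
  "boundary_word D v = (if blue D v then \<Lambda> D v else \<Omega> D v)"

text \<open>
  With \<open>W\<close> for the following word, the surface relation at \<open>v\<close> reads
  \<open>a\<^sub>1 b\<^sub>1 = x\<^sub>v\<^sup>-\<^sup>n W b\<^sub>1 a\<^sub>1\<close>, where \<open>n\<close> is the twist; the four amalgam relators solve it for
  the four products \<open>a\<^sub>1\<^sup>\<plusminus>\<^sup>1 b\<^sub>1\<^sup>\<plusminus>\<^sup>1\<close>.
\<close>

definition surface_word :: "('v, 'e) bundle_data \<Rightarrow> 'v \<Rightarrow> ('v, 'e) gen gword" where
  "surface_word D v = boundary_word D v @ comms_down D v"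

definition amalgam_lhs :: "('v, 'e) bundle_data \<Rightarrow> 'v \<Rightarrow> bool \<Rightarrow> bool \<Rightarrow> ('v, 'e) gen gword" where
  "amalgam_lhs D v \<alpha> \<beta> =
     (Ga v 1, \<alpha>) # (if \<not> \<alpha> \<and> \<beta> then surface_word D v else []) @ [(Gb v 1, \<beta>)]"

definition amalgam_rhs :: "('v, 'e) bundle_data \<Rightarrow> 'v \<Rightarrow> bool \<Rightarrow> bool \<Rightarrow> ('v, 'e) gen gword" where
  "amalgam_rhs D v \<alpha> \<beta> =
     (if \<alpha> \<and> \<beta> then surface_word D v else []) @ [(Gb v 1, \<beta>)] @
     (if \<alpha> \<and> \<not> \<beta> then (surface_word D v)\<^sup>- else []) @ [(Ga v 1, \<alpha>)] @
     (if \<not> \<alpha> \<and> \<not> \<beta> then surface_word D v else [])"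

definition amalgam_twist :: "('v, 'e) bundle_data \<Rightarrow> 'v \<Rightarrow> bool \<Rightarrow> bool \<Rightarrow> int" where
  "amalgam_twist D v \<alpha> \<beta> = (if \<alpha> = \<beta> then - twist D v else twist D v)"

text \<open>
  Rules that differ only in signs are one clause. The clause \<open>commute\<close> comprises the vertex and edge
  relators, and \<open>amalgam\<close> the amalgam relators of both colours: the twist vanishes at a blue vertex.
\<close>

inductive_set uniform_rules ::
    "('v, 'e) bundle_data \<Rightarrow> (('v, 'e) gen gword \<times> ('v, 'e) gen gword) set"
  for D :: "('v, 'e) bundle_data" where
  cancel: "z \<in> S_gens D \<Longrightarrow> ([(z, \<epsilon>), (z, \<not> \<epsilon>)], []) \<in> uniform_rules D"
| commute: "commuting_pair D y z \<Longrightarrow> ([(y, \<delta>), (z, \<epsilon>)], [(z, \<epsilon>), (y, \<delta>)]) \<in> uniform_rules D"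
| amalgam: "v \<in> Vs D \<Longrightarrow>
    (amalgam_lhs D v \<alpha> \<beta>, wx v \<up> amalgam_twist D v \<alpha> \<beta> @ amalgam_rhs D v \<alpha> \<beta>) \<in> uniform_rules D"
| blue_x_t: "k \<in> blue_loops D \<Longrightarrow>
    ([(Gx (\<iota> D k), \<delta>), (Gt k, True)], [(Gt k, True), (Gr k, \<delta>)]) \<in> uniform_rules D"
| blue_r_t: "k \<in> blue_loops D \<Longrightarrow>
    ([(Gr k, \<delta>), (Gt k, False)], [(Gt k, False), (Gx (\<iota> D k), \<delta>)]) \<in> uniform_rules D"
| blue_s_t: "k \<in> blue_loops D \<Longrightarrow>
    ([(Gs k, \<delta>), (Gt k, True)],
     (Gt k, True) # wr k \<up> (- signed_int \<delta> (loop_int D k)) @ [(Gx (\<iota> D k), \<delta>)]) \<in> uniform_rules D"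
| blue_x_t': "k \<in> blue_loops D \<Longrightarrow>
    ([(Gx (\<iota> D k), \<delta>), (Gt k, False)],
     (Gt k, False) # (Gs k, \<delta>) # wx (\<iota> D k) \<up> signed_int \<delta> (loop_int D k)) \<in> uniform_rules D"
| red_t_x: "l \<in> red_loops D \<Longrightarrow>
    ([(Gt l, False), (Gx (\<iota> D l), \<delta>)], [(Gr l, \<delta>), (Gt l, False)]) \<in> uniform_rules D"
| red_t_r: "l \<in> red_loops D \<Longrightarrow>
    ([(Gt l, True), (Gr l, \<delta>)], [(Gx (\<iota> D l), \<delta>), (Gt l, True)]) \<in> uniform_rules D"
| red_t_s: "l \<in> red_loops D \<Longrightarrow>
    ([(Gt l, False), (Gs l, \<delta>)],
     (Gx (\<iota> D l), \<delta>) # wr l \<up> (- signed_int \<delta> (loop_int D l)) @ [(Gt l, False)]) \<in> uniform_rules D"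
| red_t_x': "l \<in> red_loops D \<Longrightarrow>
    ([(Gt l, True), (Gx (\<iota> D l), \<delta>)],
     wx (\<iota> D l) \<up> signed_int \<delta> (loop_int D l) @ [(Gs l, \<delta>), (Gt l, True)]) \<in> uniform_rules D"

lemma inv_comms_down: "(comms_down D v)\<^sup>- = comms_up D v"
proof -
  have "(concat (map (\<lambda>j. comm_word (wb v j) (wa v j)) (rev js)))\<^sup>- =
      concat (map (\<lambda>j. comm_word (wa v j) (wb v j)) js)" for js
    by (induction js) (simp_all add: comm_word_def)
  then show ?thesis
    by (simp add: comms_down_def comms_up_def del: upt_Suc)
qed

lemmas amalgam_defs = amalgam_lhs_def amalgam_rhs_def amalgam_twist_def surface_word_def
  boundary_word_def twist_def inv_comms_down

locale circle_bundles =
  fixes D :: "('v, 'e) bundle_data"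
  assumes fin: "fin_digraph (base D)"
    and colouring: "alternating_colouring D"
    and orders: "valid_orders D"
    and genus: "\<And>v. v \<in> Vs D \<Longrightarrow> genus D v \<ge> 1"
begin

lemma ends_in_Vs [simp]:
  "e \<in> Es D \<Longrightarrow> \<iota> D e \<in> Vs D" "e \<in> Es D \<Longrightarrow> \<tau> D e \<in> Vs D"
  "l \<in> Ls D \<Longrightarrow> \<iota> D l \<in> Vs D"
  using fin by (auto simp: edges_def loops_def fin_digraph_def wf_digraph_def)

lemma ends_colour [simp]: "e \<in> Es D \<Longrightarrow> blue D (\<iota> D e)" "e \<in> Es D \<Longrightarrow> \<not> blue D (\<tau> D e)"
  using colouring by (auto simp: alternating_colouring_def)

lemma set_orders:
  assumes "v \<in> Vs D"
  shows "set (loop_order D v) = {l \<in> Ls D. \<iota> D l = v}"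
    "set (out_edges D v) = {e \<in> Es D. \<iota> D e = v}"
    "set (in_edges D v) = {e \<in> Es D. \<tau> D e = v}" "distinct (in_edges D v)"
  using orders assms by (auto simp: valid_orders_def out_edges_def in_edges_def)

lemma finite_graph: "finite (Vs D)" "finite (Es D)" "finite (Ls D)"
  using fin by (auto simp: fin_digraph_def fin_digraph_axioms_def edges_def loops_def)

lemma commuting_pairI:
  "v \<in> Vs D \<Longrightarrow> blue D v \<Longrightarrow> z \<in> local_gens D v \<Longrightarrow> commuting_pair D (Gx v) z"
  "w \<in> Vs D \<Longrightarrow> \<not> blue D w \<Longrightarrow> y \<in> local_gens D w \<Longrightarrow> commuting_pair D y (Gx w)"
  by (auto simp: commuting_pair_def blue_verts_def red_verts_def)

lemma rules_eq: "rules D = uniform_rules D"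
proof
  note uniform = uniform_rules.intros
  have commute: "commuting_rules y z \<subseteq> uniform_rules D" if "commuting_pair D y z" for y z
    using that by (auto simp: commuting_rules_def intro: uniform_rules.commute)
  have "blue_vertex_rules D \<subseteq> uniform_rules D" "red_vertex_rules D \<subseteq> uniform_rules D"
    "edge_rules D \<subseteq> uniform_rules D"
    unfolding blue_vertex_rules_def red_vertex_rules_def edge_rules_def
    by (intro Un_least UN_least commute commuting_pairI;
        force simp: blue_verts_def red_verts_def blue_loops_def red_loops_def local_gens_def)+
  moreover have "blue_amalgam_rules D \<subseteq> uniform_rules D"
  proof -
    have v: "v \<in> Vs D" "blue D v" if "v \<in> blue_verts D" for v
      using that by (simp_all add: blue_verts_def)
    note rule = uniform(3)[OF v(1), unfolded amalgam_defs]
    show ?thesis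
      unfolding blue_amalgam_rules_def
      using rule[of _ True True] rule[of _ True False] rule[of _ False True] rule[of _ False False] v
      by (intro UN_least insert_subsetI empty_subsetI) (simp_all add: inv_comms_down)
  qed
  moreover have "red_amalgam_rules D \<subseteq> uniform_rules D"
  proof -
    have v: "v \<in> Vs D" "\<not> blue D v" if "v \<in> red_verts D" for v
      using that by (simp_all add: red_verts_def)
    note rule = uniform(3)[OF v(1), unfolded amalgam_defs]
    show ?thesis
      unfolding red_amalgam_rules_def
      using rule[of _ True True] rule[of _ True False] rule[of _ False True] rule[of _ False False] v
      by (intro UN_least insert_subsetI empty_subsetI) (simp_all add: inv_comms_down)
  qed
  moreover have "blue_hnn_rules D \<subseteq> uniform_rules D" "red_hnn_rules D \<subseteq> uniform_rules D"
    using uniform(4)[of _ D True] uniform(4)[of _ D False] uniform(5)[of _ D True]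
      uniform(5)[of _ D False] uniform(6)[of _ D True] uniform(6)[of _ D False]
      uniform(7)[of _ D True] uniform(7)[of _ D False] uniform(8)[of _ D True]
      uniform(8)[of _ D False] uniform(9)[of _ D True] uniform(9)[of _ D False]
      uniform(10)[of _ D True] uniform(10)[of _ D False] uniform(11)[of _ D True]
      uniform(11)[of _ D False]
    by (auto simp: blue_hnn_rules_def red_hnn_rules_def Let_def)
  moreover have "cancellation_rules (S_gens D) \<subseteq> uniform_rules D"
    by (auto simp: cancellation_rules_def intro: uniform_rules.cancel)
  ultimately show "rules D \<subseteq> uniform_rules D"
    unfolding rules_def by blast
next
  have blue: "{([(Gx (\<iota> D k), \<delta>), (Gt k, True)], [(Gt k, True), (Gr k, \<delta>)]),
      ([(Gr k, \<delta>), (Gt k, False)], [(Gt k, False), (Gx (\<iota> D k), \<delta>)]),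
      ([(Gs k, \<delta>), (Gt k, True)],
        (Gt k, True) # wr k \<up> (- signed_int \<delta> (loop_int D k)) @ [(Gx (\<iota> D k), \<delta>)]),
      ([(Gx (\<iota> D k), \<delta>), (Gt k, False)],
        (Gt k, False) # (Gs k, \<delta>) # wx (\<iota> D k) \<up> signed_int \<delta> (loop_int D k))} \<subseteq> blue_hnn_rules D"
    if "k \<in> blue_loops D" for k \<delta>
    unfolding blue_hnn_rules_def using that
    by (intro subset_trans[OF _ UN_upper[of k]]) (cases \<delta>; simp add: Let_def)+
  have red: "{([(Gt l, False), (Gx (\<iota> D l), \<delta>)], [(Gr l, \<delta>), (Gt l, False)]),
      ([(Gt l, True), (Gr l, \<delta>)], [(Gx (\<iota> D l), \<delta>), (Gt l, True)]),
      ([(Gt l, False), (Gs l, \<delta>)],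
        (Gx (\<iota> D l), \<delta>) # wr l \<up> (- signed_int \<delta> (loop_int D l)) @ [(Gt l, False)]),
      ([(Gt l, True), (Gx (\<iota> D l), \<delta>)],
        wx (\<iota> D l) \<up> signed_int \<delta> (loop_int D l) @ [(Gs l, \<delta>), (Gt l, True)])} \<subseteq> red_hnn_rules D"
    if "l \<in> red_loops D" for l \<delta>
    unfolding red_hnn_rules_def using that
    by (intro subset_trans[OF _ UN_upper[of l]]) (cases \<delta>; simp add: Let_def)+
  show "uniform_rules D \<subseteq> rules D"
  proof (clarify, elim uniform_rules.cases; clarify)
    fix z \<epsilon>
    assume "z \<in> S_gens D"
    then show "([(z, \<epsilon>), (z, \<not> \<epsilon>)], []) \<in> rules D"
      by (auto simp: rules_def cancellation_rules_def)
  next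
    fix y z \<delta> \<epsilon>
    assume "commuting_pair D y z"
    then have "commuting_rules y z \<subseteq> blue_vertex_rules D \<union> red_vertex_rules D \<union> edge_rules D"
      unfolding commuting_pair_def local_gens_def blue_vertex_rules_def red_vertex_rules_def
        edge_rules_def blue_loops_def red_loops_def blue_verts_def red_verts_def
      using ends_colour by (elim disjE bexE conjE UnE imageE) fastforce+
    then show "([(y, \<delta>), (z, \<epsilon>)], [(z, \<epsilon>), (y, \<delta>)]) \<in> rules D"
      by (force simp: rules_def commuting_rules_def)
  next
    fix v \<alpha> \<beta>
    assume v: "v \<in> Vs D"
    have "(amalgam_lhs D v \<alpha> \<beta>, wx v \<up> amalgam_twist D v \<alpha> \<beta> @ amalgam_rhs D v \<alpha> \<beta>)
        \<in> (if blue D v then blue_amalgam_rules D else red_amalgam_rules D)"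
      using v by (cases \<alpha>; cases \<beta>)
        (auto simp: blue_amalgam_rules_def red_amalgam_rules_def blue_verts_def red_verts_def
          amalgam_defs)
    then show "(amalgam_lhs D v \<alpha> \<beta>, wx v \<up> amalgam_twist D v \<alpha> \<beta> @ amalgam_rhs D v \<alpha> \<beta>) \<in> rules D"
      by (auto simp: rules_def split: if_splits)
  qed (use blue red in \<open>simp_all add: rules_def\<close>)
qed

lemma local_gens_subset: "v \<in> Vs D \<Longrightarrow> local_gens D v \<subseteq> S_gens D"
  by (auto simp: local_gens_def S_gens_def)

lemma Gx_in_S_gens: "v \<in> Vs D \<Longrightarrow> Gx v \<in> S_gens D"
  by (auto simp: S_gens_def)

lemma loop_gens:
  assumes "l \<in> Ls D"
  shows "Gx (\<iota> D l) \<in> S_gens D" "Gr l \<in> S_gens D" "Gs l \<in> S_gens D" "Gt l \<in> S_gens D"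
    "Gr l \<in> local_gens D (\<iota> D l)" "Gs l \<in> local_gens D (\<iota> D l)"
  using assms by (auto simp: S_gens_def local_gens_def)

lemma set_boundary_word:
  assumes "v \<in> Vs D" "c \<in> set (boundary_word D v)"
  shows "(\<exists>e \<in> Es D. \<iota> D e = v \<and> c = (Gx (\<tau> D e), True)) \<or>
    (\<exists>e \<in> Es D. \<tau> D e = v \<and> c = (Gx (\<iota> D e), True)) \<or>
    (\<exists>l \<in> Ls D. \<iota> D l = v \<and> (c = (Gr l, True) \<or> c = (Gs l, True)))"
  using assms set_orders[OF assms(1)]
  by (auto simp: boundary_word_def \<Lambda>_def \<Omega>_def loop_product_def split: if_splits)

lemma set_comms_down:
  assumes "c \<in> set (comms_down D v)"
  shows "\<exists>j \<in> {2..genus D v}. fst c = Ga v j \<or> fst c = Gb v j"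
  using assms by (force simp: comms_down_def comm_word_def)

lemma boundary_word_local: "v \<in> Vs D \<Longrightarrow> fst ` set (boundary_word D v) \<subseteq> local_gens D v"
proof (intro image_subsetI)
  fix c
  assume v: "v \<in> Vs D" "c \<in> set (boundary_word D v)"
  from set_boundary_word[OF this] show "fst c \<in> local_gens D v"
    using ends_colour by (auto simp: local_gens_def)
qed

lemma comms_down_local: "fst ` set (comms_down D v) \<subseteq> local_gens D v"
  by (force simp: local_gens_def dest: set_comms_down)

lemma surface_word_local: "v \<in> Vs D \<Longrightarrow> fst ` set (surface_word D v) \<subseteq> local_gens D v"
  using boundary_word_local comms_down_local by (auto simp: surface_word_def image_Un)

lemma ab1_local: "v \<in> Vs D \<Longrightarrow> Ga v (Suc 0) \<in> local_gens D v" "v \<in> Vs D \<Longrightarrow> Gb v (Suc 0) \<in> local_gens D v"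
  using genus by (force simp: local_gens_def)+

lemma amalgam_local:
  assumes "v \<in> Vs D"
  shows "fst ` set (amalgam_lhs D v \<alpha> \<beta>) \<subseteq> local_gens D v"
    "fst ` set (amalgam_rhs D v \<alpha> \<beta>) \<subseteq> local_gens D v"
  using surface_word_local[OF assms] ab1_local[OF assms]
  by (cases \<alpha>; cases \<beta>; simp add: amalgam_lhs_def amalgam_rhs_def image_Un)+

lemma rules_subset: "rules D \<subseteq> lists (alphabet D) \<times> lists (alphabet D)"
proof -
  have pow: "fst ` set (letter s \<up> k) \<subseteq> X" if "s \<in> X" for s :: "('v, 'e) gen" and X k
    using fst_set_letter_pow[of s k] that by blast
  have gens: "z \<in> S_gens D" if "z \<in> local_gens D v" "v \<in> Vs D" for z v
    using that local_gens_subset by blast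
  have loop: "Gx (\<iota> D l) \<in> S_gens D" "Gr l \<in> S_gens D" "Gs l \<in> S_gens D" "Gt l \<in> S_gens D"
    if "l \<in> blue_loops D \<or> l \<in> red_loops D" for l
    using that by (auto simp: S_gens_def blue_loops_def red_loops_def)
  have "fst ` set u \<subseteq> S_gens D \<and> fst ` set w \<subseteq> S_gens D" if "(u, w) \<in> uniform_rules D" for u w
    using that
  proof cases
    case (commute y z \<delta> \<epsilon>)
    then show ?thesis
      by (auto simp: commuting_pair_def blue_verts_def red_verts_def intro: gens Gx_in_S_gens)
  next
    case (amalgam v \<alpha> \<beta>)
    then show ?thesis
      using amalgam_local[of v \<alpha> \<beta>] local_gens_subset[of v] pow[OF Gx_in_S_gens, of v]
      by (auto simp: image_Un)
  qed (use loop pow in \<open>simp_all add: image_Un\<close>)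
  then show ?thesis
    by (intro subrelI) (simp only: rules_eq alphabet_def in_lists_signed_letters mem_Sigma_iff simp_thms)
qed

lemma finite_S_gens: "finite (S_gens D)"
proof -
  have "{f v j |v j. v \<in> Vs D \<and> j \<in> {1..genus D v}} = (\<Union>v \<in> Vs D. f v ` {1..genus D v})"
    for f :: "'v \<Rightarrow> nat \<Rightarrow> ('v, 'e) gen"
    by blast
  then show ?thesis
    using finite_graph unfolding S_gens_def by (simp only:) simp
qed

lemma finite_rules: "finite (rules D)"
proof -
  have "commuting_rules y z = (\<lambda>(\<delta>, \<epsilon>). ([(y, \<delta>), (z, \<epsilon>)], [(z, \<epsilon>), (y, \<delta>)])) ` UNIV"
    for y z :: "('v, 'e) gen"
    by (auto simp: commuting_rules_def)
  then have commuting: "finite (commuting_rules y z)" for y z :: "('v, 'e) gen"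
    by simp
  have "cancellation_rules (S_gens D) = (\<lambda>(z, \<epsilon>). ([(z, \<epsilon>), (z, \<not> \<epsilon>)], [])) ` (S_gens D \<times> UNIV)"
    by (auto simp: cancellation_rules_def)
  then have "finite (cancellation_rules (S_gens D))"
    using finite_S_gens by simp
  moreover have "finite (blue_verts D)" "finite (red_verts D)" "finite (blue_loops D)" "finite (red_loops D)"
    using finite_graph by (auto simp: blue_verts_def red_verts_def blue_loops_def red_loops_def)
  ultimately show ?thesis
    using finite_graph commuting
    by (simp add: rules_def blue_vertex_rules_def red_vertex_rules_def edge_rules_def
        blue_amalgam_rules_def red_amalgam_rules_def blue_hnn_rules_def red_hnn_rules_def Let_def)
qed

end

section \<open>Termination\<close>

primrec inversions :: "('a \<Rightarrow> 'a \<Rightarrow> bool) \<Rightarrow> 'a list \<Rightarrow> nat" where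
  "inversions P [] = 0"
| "inversions P (c # w) = length (filter (P c) w) + inversions P w"

lemma inversions_append:
  "inversions P (u @ v) = inversions P u + inversions P v + (\<Sum>c\<leftarrow>u. length (filter (P c) v))"
  by (induction u) auto

lemma inversions_delete: "inversions P (x @ y) \<le> inversions P (x @ u @ y)"
proof -
  have "(\<Sum>c\<leftarrow>x. length (filter (P c) y)) \<le> (\<Sum>c\<leftarrow>x. length (filter (P c) (u @ y)))"
    by (intro sum_list_mono) simp
  then show ?thesis
    by (simp add: inversions_append)
qed

lemma inversions_permute:
  assumes "mset u = mset v" "inversions P u < inversions P v"
  shows "inversions P (x @ u @ y) < inversions P (x @ v @ y)"
proof -
  have filter: "length (filter Q u) = length (filter Q v)" for Q
    using assms(1) by (metis mset_filter size_mset)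
  have "(\<Sum>c\<leftarrow>u. f c) = (\<Sum>c\<leftarrow>v. f c)" for f :: "'a \<Rightarrow> nat"
    using assms(1) by (metis mset_map sum_mset_sum_list)
  then show ?thesis
    using assms(2) by (simp add: inversions_append filter)
qed

lemma inversions_filter:
  assumes "\<And>c d. P c d \<Longrightarrow> Q c \<and> Q d"
  shows "inversions P (filter Q w) = inversions P w"
proof (induction w)
  case (Cons c w)
  have "filter (P c) (filter Q w) = filter (P c) w"
    by (auto simp: assms intro!: filter_cong)
  moreover have "filter (P c) w = []" if "\<not> Q c"
    using that assms by (auto simp: filter_empty_conv)
  ultimately show ?case
    using Cons by simp
qed simp

text \<open>
  An amalgam relator moves \<open>a\<^sub>v\<^sub>1\<close> to the right of \<open>b\<^sub>v\<^sub>1\<close>, and no rule moves these letters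
  the other way or creates one of them.
\<close>

definition ab_inversions :: "('v, 'e) gen gword \<Rightarrow> nat" where
  "ab_inversions = inversions (\<lambda>c d. \<exists>v. fst c = Ga v 1 \<and> fst d = Gb v 1)"

definition ab_letter :: "('v, 'e) gen \<times> bool \<Rightarrow> bool" where
  "ab_letter c \<longleftrightarrow> (\<exists>v. fst c = Ga v 1 \<or> fst c = Gb v 1)"

lemma ab_inversions_filter: "ab_inversions (filter ab_letter w) = ab_inversions w"
  unfolding ab_inversions_def by (rule inversions_filter) (auto simp: ab_letter_def)

fun owner :: "('v, 'e) bundle_data \<Rightarrow> ('v, 'e) gen \<Rightarrow> 'v" where
  "owner D (Gx v) = v"
| "owner D (Ga v j) = v"
| "owner D (Gb v j) = v"
| "owner D (Gp e) = \<iota> D e"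
| "owner D (Gq e) = \<tau> D e"
| "owner D (Gr l) = \<iota> D l"
| "owner D (Gs l) = \<iota> D l"
| "owner D (Gt l) = \<iota> D l"

text \<open>
  The letters of a word act on the natural numbers from left to right, those owned by vertices of
  the other colour trivially. A letter that crosses \<open>t\<^sub>k\<close> from left to right turns into at most
  \<open>\<bar>m\<^sub>k\<bar> + 1\<close> letters; the factor by which \<open>t\<^sub>k\<close> multiplies exceeds this number.
\<close>

definition act ::
    "('v, 'e) bundle_data \<Rightarrow> bool \<Rightarrow> nat \<Rightarrow> ('v, 'e) gen \<times> bool \<Rightarrow> nat" where
  "act D \<beta> n c =
     (if blue D (owner D (fst c)) \<noteq> \<beta> then n
      else case fst c of Gt k \<Rightarrow> (nat \<bar>loop_int D k\<bar> + 2) * n + 1 | _ \<Rightarrow> n + 1)"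

lemma act_strict_mono: "n < n' \<Longrightarrow> act D \<beta> n c < act D \<beta> n' c"
  by (auto simp: act_def split: gen.splits intro!: add_less_le_mono add_mono mult_le_mono2)

lemma act_mono: "n \<le> n' \<Longrightarrow> act D \<beta> n c \<le> act D \<beta> n' c"
  using act_strict_mono[of n n' D \<beta> c] by (cases "n = n'") auto

lemma foldl_act_strict_mono: "n < n' \<Longrightarrow> foldl (act D \<beta>) n w < foldl (act D \<beta>) n' w"
  by (induction w arbitrary: n n') (auto simp: act_strict_mono)

lemma foldl_act_mono: "n \<le> n' \<Longrightarrow> foldl (act D \<beta>) n w \<le> foldl (act D \<beta>) n' w"
  by (induction w arbitrary: n n') (auto simp: act_mono)

lemma foldl_act_ge: "n \<le> foldl (act D \<beta>) n w"
proof (induction w arbitrary: n)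
  case (Cons c w)
  have "n \<le> act D \<beta> n c"
    by (auto simp: act_def split: gen.splits)
  then show ?case
    using Cons[of "act D \<beta> n c"] by simp
qed simp

lemma foldl_act_letter_pow:
  assumes "\<And>k. s \<noteq> Gt k"
  shows "foldl (act D \<beta>) n (letter s \<up> i) =
    (if blue D (owner D s) = \<beta> then n + nat \<bar>i\<bar> else n)"
proof -
  have "foldl (act D \<beta>) n (replicate j (s, \<epsilon>)) = (if blue D (owner D s) = \<beta> then n + j else n)"
    for j \<epsilon>
    using assms by (induction j arbitrary: n) (auto simp: act_def split: gen.splits)
  then show ?thesis
    by (simp add: letter_pow)
qed

lemma rev_letter_pow: "rev (letter s \<up> i) = letter s \<up> i"
  by (simp add: letter_pow rev_replicate)

text \<open>
  Blue letters move to the right past stable letters and red letters move to the left, so red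
  weights are read from right to left.
\<close>

definition weight :: "('v, 'e) bundle_data \<Rightarrow> ('v, 'e) gen gword \<Rightarrow> nat" where
  "weight D w = foldl (act D True) 0 w + foldl (act D False) 0 (rev w)"

lemma weight_less:
  assumes "\<And>n. foldl (act D True) n v \<le> foldl (act D True) n u"
    and "\<And>n. foldl (act D False) n (rev v) \<le> foldl (act D False) n (rev u)"
    and "(\<forall>n. foldl (act D True) n v < foldl (act D True) n u) \<or>
      (\<forall>n. foldl (act D False) n (rev v) < foldl (act D False) n (rev u))"
  shows "weight D (x @ v @ y) < weight D (x @ u @ y)"
  using assms(3)
proof
  assume "\<forall>n. foldl (act D True) n v < foldl (act D True) n u"
  then show ?thesis
    using assms(2) by (auto simp: weight_def intro!: add_less_le_mono foldl_act_mono foldl_act_strict_mono)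
next
  assume "\<forall>n. foldl (act D False) n (rev v) < foldl (act D False) n (rev u)"
  then show ?thesis
    using assms(1) by (auto simp: weight_def intro!: add_le_less_mono foldl_act_mono foldl_act_strict_mono)
qed

context circle_bundles
begin

lemma ab_letter_surface_word:
  assumes "v \<in> Vs D"
  shows "filter ab_letter (surface_word D v) = []" "filter ab_letter ((surface_word D v)\<^sup>-) = []"
proof -
  have "fst c \<noteq> Ga v' 1 \<and> fst c \<noteq> Gb v' 1" if "c \<in> set (surface_word D v)" for c v'
    using that set_boundary_word[OF assms, of c] set_comms_down[of c v]
    by (auto simp: surface_word_def)
  then show "filter ab_letter (surface_word D v) = []" "filter ab_letter ((surface_word D v)\<^sup>-) = []"
    by (force simp: filter_empty_conv inv_word_def ab_letter_def)+
qed

lemma not_ab_letter_pow: "filter ab_letter (wx v \<up> i) = []" "filter ab_letter (wr l \<up> i) = []"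
  by (simp_all add: letter_pow ab_letter_def)

lemma commuting_pair_neq_Gt: "commuting_pair D y z \<Longrightarrow> y \<noteq> Gt k \<and> z \<noteq> Gt k"
  by (auto simp: commuting_pair_def local_gens_def)

text \<open>
  The first letter of a commuting pair is a blue fibre or one of \<open>a\<close>, \<open>b\<close>, \<open>r\<close>, \<open>s\<close> at a red vertex,
  the second is a red fibre or one of these letters at a blue vertex.
\<close>

lemma commuting_pair_no_chain: "commuting_pair D y z \<Longrightarrow> \<not> commuting_pair D z u"
  by (auto simp: commuting_pair_def local_gens_def blue_verts_def red_verts_def)
    (metis ends_colour)

lemma commuting_pair_irrefl: "\<not> commuting_pair D y y"
  using commuting_pair_no_chain by blast

definition fibre_inversions :: "('v, 'e) gen gword \<Rightarrow> nat" where
  "fibre_inversions = inversions (\<lambda>c d. commuting_pair D (fst c) (fst d))"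

text \<open>
  Amalgam relators lower the first component. The others do not raise it; cancellation and loop rules
  then lower the weight, because they delete letters or replace letters of one colour by others of the
  same colour whose action is smaller. A commutation exchanges two letters that act by adding 1 or
  trivially, so it preserves the weight and leaves one inversion less.
\<close>

lemma rule_decreases:
  assumes "(u, v) \<in> uniform_rules D"
  shows "((x @ v @ y, x @ u @ y) :: _ \<times> _) \<in>
    inv_image (less_than <*lex*> less_than <*lex*> less_than)
      (\<lambda>w. (ab_inversions w, weight D w, fibre_inversions w))"
proof -
  have ab_le: "ab_inversions (x @ v @ y) \<le> ab_inversions (x @ u @ y)"
    if "filter ab_letter v = filter ab_letter u \<or> filter ab_letter v = []"
  proof -
    have "ab_inversions (filter ab_letter (x @ v @ y)) \<le> ab_inversions (filter ab_letter (x @ u @ y))"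
      using that by (auto simp: ab_inversions_def inversions_delete)
    then show ?thesis
      by (simp only: ab_inversions_filter)
  qed
  have by_weight: ?thesis
    if "filter ab_letter v = filter ab_letter u \<or> filter ab_letter v = []"
      "\<And>n. foldl (act D True) n v \<le> foldl (act D True) n u"
      "\<And>n. foldl (act D False) n (rev v) \<le> foldl (act D False) n (rev u)"
      "(\<forall>n. foldl (act D True) n v < foldl (act D True) n u) \<or>
        (\<forall>n. foldl (act D False) n (rev v) < foldl (act D False) n (rev u))"
    using ab_le[OF that(1)] weight_less[of D v u x y] that by auto
  have blue_loop: "blue D (\<iota> D k)" if "k \<in> blue_loops D" for k
    using that by (simp add: blue_loops_def)
  have red_loop: "\<not> blue D (\<iota> D l)" if "l \<in> red_loops D" for l
    using that by (simp add: red_loops_def)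
  have nat_signed: "nat \<bar>signed_int \<delta> m\<bar> = nat \<bar>m\<bar>" for \<delta> m
    by (simp add: signed_int_def)
  note act_simps = foldl_act_letter_pow rev_letter_pow not_ab_letter_pow ab_letter_def nat_signed
  from assms show ?thesis
  proof cases
    case (cancel z \<epsilon>)
    have "n < act D \<beta> (act D \<beta> n (z, \<epsilon>)) (z, \<epsilon>')" if "blue D (owner D z) = \<beta>" for n \<beta> \<epsilon> \<epsilon>'
      using that by (auto simp: act_def split: gen.splits)
    moreover have "n \<le> act D \<beta> (act D \<beta> n (z, \<epsilon>)) (z, \<epsilon>')" for n \<beta> \<epsilon> \<epsilon>'
      using foldl_act_ge[of n D \<beta> "[(z, \<epsilon>), (z, \<epsilon>')]"] by simp
    ultimately show ?thesis
      using cancel by (cases "blue D (owner D z)"; intro by_weight) auto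
  next
    case (commute y' z \<delta> \<epsilon>)
    then have neq: "y' \<noteq> Gt k" "z \<noteq> Gt k" for k
      by (auto dest: commuting_pair_neq_Gt)
    have act: "act D \<beta> (act D \<beta> n (y', \<delta>)) (z, \<epsilon>) = act D \<beta> (act D \<beta> n (z, \<epsilon>)) (y', \<delta>)" for \<beta> n
      using neq by (auto simp: act_def split: gen.splits)
    then have "weight D (x @ v @ y) = weight D (x @ u @ y)"
      using commute by (simp add: weight_def)
    moreover have "fibre_inversions (x @ v @ y) < fibre_inversions (x @ u @ y)"
      unfolding fibre_inversions_def
      by (rule inversions_permute) (use commute commuting_pair_no_chain in auto)
    moreover have "ab_inversions (x @ v @ y) \<le> ab_inversions (x @ u @ y)"
      using commute by (intro ab_le) (auto simp: ab_letter_def commuting_pair_def local_gens_def)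
    ultimately show ?thesis
      by auto
  next
    case (amalgam v' \<alpha> \<beta>)
    have "filter ab_letter u = [(Ga v' 1, \<alpha>), (Gb v' 1, \<beta>)]"
      "filter ab_letter v = [(Gb v' 1, \<beta>), (Ga v' 1, \<alpha>)]"
      using amalgam ab_letter_surface_word
      by (simp_all add: amalgam_lhs_def amalgam_rhs_def not_ab_letter_pow) (simp_all add: ab_letter_def)
    then have "ab_inversions (filter ab_letter (x @ v @ y)) < ab_inversions (filter ab_letter (x @ u @ y))"
      unfolding ab_inversions_def filter_append by (intro inversions_permute) auto
    then have "ab_inversions (x @ v @ y) < ab_inversions (x @ u @ y)"
      by (simp only: ab_inversions_filter)
    then show ?thesis
      by simp
  qed (intro by_weight; insert blue_loop red_loop; simp add: act_simps; simp add: act_def algebra_simps; fail)+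
qed

lemma wf_rules: "wf ((rewrite_step UNIV (rules D))\<inverse>)"
proof (rule wf_subset)
  show "wf (inv_image (less_than <*lex*> less_than <*lex*> less_than)
      (\<lambda>w. (ab_inversions w, weight D w, fibre_inversions w)))"
    by auto
  show "(rewrite_step UNIV (rules D))\<inverse> \<subseteq> inv_image (less_than <*lex*> less_than <*lex*> less_than)
      (\<lambda>w. (ab_inversions w, weight D w, fibre_inversions w))"
    unfolding rules_eq rewrite_step_def using rule_decreases by blast
qed

end

section \<open>Calculating with reductions\<close>

text \<open>
  The calculations below are the same whether the relation is rewriting, rewriting of reversed words,
  or a congruence, so they are carried out for an arbitrary preorder that is compatible with
  concatenation.
\<close>

locale word_reduction =
  fixes red :: "'x gword \<Rightarrow> 'x gword \<Rightarrow> bool" (infix "\<leadsto>" 50)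
  assumes red_refl [simp]: "u \<leadsto> u"
    and red_trans [trans]: "u \<leadsto> v \<Longrightarrow> v \<leadsto> w \<Longrightarrow> u \<leadsto> w"
    and red_context: "u \<leadsto> v \<Longrightarrow> p @ u @ q \<leadsto> p @ v @ q"
begin

lemma red_append:
  assumes "u \<leadsto> u'" "v \<leadsto> v'"
  shows "u @ v \<leadsto> u' @ v'"
proof -
  have "u @ v \<leadsto> u' @ v"
    using red_context[OF assms(1), of "[]" v] by simp
  also have "\<dots> \<leadsto> u' @ v'"
    using red_context[OF assms(2), of u' "[]"] by simp
  finally show ?thesis .
qed

text \<open>
  A step inside a word. Source and target are separate variables so that the decomposition is checked
  by simplification and does not have to match the associativity and constructors of a goal.
\<close>

lemma red_at: "u \<leadsto> v \<Longrightarrow> s = p @ u @ q \<Longrightarrow> t = p @ v @ q \<Longrightarrow> s \<leadsto> t"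
  using red_context by simp

lemma slide_letter:
  assumes "\<And>d. d \<in> set w \<Longrightarrow> [c, d] \<leadsto> [d, c]"
  shows "c # w \<leadsto> w @ [c]"
  using assms
proof (induction w)
  case (Cons d w)
  have "c # d # w \<leadsto> d # c # w"
    by (rule red_at[of "[c, d]" "[d, c]" _ "[]" w]) (use Cons.prems in auto)
  also have "\<dots> \<leadsto> d # w @ [c]"
    by (rule red_at[of "c # w" "w @ [c]" _ "[d]" "[]"]) (use Cons in auto)
  finally show ?case by simp
qed simp

lemma slide:
  assumes "\<And>c d. c \<in> set u \<Longrightarrow> d \<in> set w \<Longrightarrow> [c, d] \<leadsto> [d, c]"
  shows "u @ w \<leadsto> w @ u"
  using assms
proof (induction u)
  case (Cons c u)
  have "c # u @ w \<leadsto> c # w @ u"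
    by (rule red_at[of "u @ w" "w @ u" _ "[c]" "[]"]) (use Cons in auto)
  moreover have "c # w \<leadsto> w @ [c]"
    by (rule slide_letter) (use Cons.prems in simp)
  then have "c # w @ u \<leadsto> w @ c # u"
    by (rule red_at[of _ _ _ "[]" u]) auto
  ultimately show ?case using red_trans by auto
qed simp

lemma convey:
  assumes "\<And>c. c \<in> set w \<Longrightarrow> [c, d] \<leadsto> [d, f c]"
  shows "w @ [d] \<leadsto> d # map f w"
  using assms
proof (induction w)
  case (Cons c w)
  have "c # w @ [d] \<leadsto> c # d # map f w"
    by (rule red_at[of "w @ [d]" "d # map f w" _ "[c]" "[]"]) (use Cons in auto)
  also have "\<dots> \<leadsto> d # f c # map f w"
    by (rule red_at[of "[c, d]" "[d, f c]" _ "[]" "map f w"]) (use Cons.prems in auto)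
  finally show ?case by simp
qed simp

lemma cancel_word:
  assumes "\<And>z \<epsilon>. z \<in> fst ` set w \<Longrightarrow> [(z, \<epsilon>), (z, \<not> \<epsilon>)] \<leadsto> []"
  shows "w @ w\<^sup>- \<leadsto> []" "w\<^sup>- @ w \<leadsto> []"
proof -
  have *: "w @ w\<^sup>- \<leadsto> []" if "\<And>z \<epsilon>. z \<in> fst ` set w \<Longrightarrow> [(z, \<epsilon>), (z, \<not> \<epsilon>)] \<leadsto> []" for w
    using that
  proof (induction w)
    case (Cons c w)
    obtain z \<epsilon> where c: "c = (z, \<epsilon>)" by (cases c)
    have "(c # w) @ (c # w)\<^sup>- \<leadsto> [(z, \<epsilon>), (z, \<not> \<epsilon>)]"
      by (rule red_at[of "w @ w\<^sup>-" "[]" _ "[c]" "[(z, \<not> \<epsilon>)]"]) (use Cons c in auto)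
    also have "\<dots> \<leadsto> []"
      using Cons.prems c by auto
    finally show ?case .
  qed simp
  show "w @ w\<^sup>- \<leadsto> []" using assms by (rule *)
  show "w\<^sup>- @ w \<leadsto> []" using *[of "w\<^sup>-"] assms by simp
qed

lemma letter_pow_add:
  assumes "\<And>\<epsilon>. [(s, \<epsilon>), (s, \<not> \<epsilon>)] \<leadsto> []"
  shows "letter s \<up> i @ letter s \<up> j \<leadsto> letter s \<up> (i + j)"
proof -
  have cancel: "replicate a (s, \<epsilon>) @ replicate b (s, \<not> \<epsilon>) \<leadsto>
      replicate (a - b) (s, \<epsilon>) @ replicate (b - a) (s, \<not> \<epsilon>)" for a b \<epsilon>
  proof (induction a arbitrary: b)
    case (Suc a)
    show ?case
    proof (cases b)
      case (Suc b')
      have "replicate (Suc a) (s, \<epsilon>) @ replicate b (s, \<not> \<epsilon>) \<leadsto>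
          replicate a (s, \<epsilon>) @ replicate b' (s, \<not> \<epsilon>)"
        by (rule red_at[OF assms, of _ "replicate a (s, \<epsilon>)" \<epsilon> "replicate b' (s, \<not> \<epsilon>)"])
          (simp_all add: Suc replicate_append_same[symmetric])
      also note Suc.IH[of b']
      finally show ?thesis by (simp add: Suc)
    qed simp
  qed simp
  show ?thesis
  proof (cases "(0 \<le> i) = (0 \<le> j)")
    case True
    then have "nat \<bar>i + j\<bar> = nat \<bar>i\<bar> + nat \<bar>j\<bar>" "(0 \<le> i + j) = (0 \<le> i)" by auto
    then show ?thesis
      using True by (simp add: letter_pow replicate_add)
  next
    case False
    then consider "0 \<le> i" "j < 0" | "i < 0" "0 \<le> j" by linarith
    then show ?thesis
    proof cases
      case 1
      then have "nat i - nat (- j) = nat (i + j)" "nat (- j) - nat i = nat (- (i + j))"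
        by linarith+
      with 1 show ?thesis
        using cancel[of "nat i" True "nat (- j)"] by (cases "0 \<le> i + j") (simp_all add: letter_pow)
    next
      case 2
      then have "nat (- i) - nat j = nat (- (i + j))" "nat j - nat (- i) = nat (i + j)"
        by linarith+
      with 2 show ?thesis
        using cancel[of "nat (- i)" False "nat j"] by (cases "0 \<le> i + j") (simp_all add: letter_pow)
    qed
  qed
qed

lemma letter_pow_cancel:
  assumes "\<And>\<epsilon>. [(s, \<epsilon>), (s, \<not> \<epsilon>)] \<leadsto> []"
  shows "letter s \<up> i @ letter s \<up> (- i) \<leadsto> []" "letter s \<up> (- i) @ letter s \<up> i \<leadsto> []"
  using letter_pow_add[OF assms, of i "- i"] letter_pow_add[OF assms, of "- i" i] by simp_all

definition joins :: "'x gword \<Rightarrow> 'x gword \<Rightarrow> bool" where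
  "joins u v \<longleftrightarrow> (\<exists>w. u \<leadsto> w \<and> v \<leadsto> w)"

text \<open>
  No rule exchanges two powers of one generator; both products reduce to the power with exponent
  \<open>i + j\<close>.
\<close>

lemma letter_pow_commute:
  assumes "\<And>\<epsilon>. [(s, \<epsilon>), (s, \<not> \<epsilon>)] \<leadsto> []"
  shows "joins (p @ letter s \<up> i @ letter s \<up> j @ q) (p @ letter s \<up> j @ letter s \<up> i @ q)"
  unfolding joins_def
  using red_context[OF letter_pow_add[OF assms, of i j], of p q]
    red_context[OF letter_pow_add[OF assms, of j i], of p q]
  by (auto simp: add.commute)

lemma joinsI: "u \<leadsto> u' \<Longrightarrow> v \<leadsto> v' \<Longrightarrow> joins u' v' \<Longrightarrow> joins u v"
  unfolding joins_def using red_trans by blast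

end

text \<open>
  The rules of a loop at a blue vertex, with \<open>t\<close> and \<open>t'\<close> for the stable letter and its inverse.
  The rules of a loop at a red vertex are the mirror image, with \<open>t\<close> and \<open>t'\<close> exchanged, so each
  critical pair has to be resolved for one colour only.
\<close>

locale stable_letter_reduction = word_reduction red
  for red :: "'x gword \<Rightarrow> 'x gword \<Rightarrow> bool" (infix "\<leadsto>" 50) +
  fixes x r s :: 'x and t t' :: "'x \<times> bool" and m :: int
  assumes cancel: "[(x, \<epsilon>), (x, \<not> \<epsilon>)] \<leadsto> []" "[(r, \<epsilon>), (r, \<not> \<epsilon>)] \<leadsto> []"
      "[(s, \<epsilon>), (s, \<not> \<epsilon>)] \<leadsto> []" "[t, t'] \<leadsto> []" "[t', t] \<leadsto> []"
    and x_r: "[(x, \<delta>), (r, \<epsilon>)] \<leadsto> [(r, \<epsilon>), (x, \<delta>)]"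
    and x_s: "[(x, \<delta>), (s, \<epsilon>)] \<leadsto> [(s, \<epsilon>), (x, \<delta>)]"
    and x_t: "[(x, \<delta>), t] \<leadsto> [t, (r, \<delta>)]"
    and r_t': "[(r, \<delta>), t'] \<leadsto> [t', (x, \<delta>)]"
    and s_t: "[(s, \<delta>), t] \<leadsto> t # letter r \<up> (- signed_int \<delta> m) @ [(x, \<delta>)]"
    and x_t': "[(x, \<delta>), t'] \<leadsto> t' # (s, \<delta>) # letter x \<up> signed_int \<delta> m"
begin

lemma x_r_pow: "(x, \<delta>) # letter r \<up> i \<leadsto> letter r \<up> i @ [(x, \<delta>)]"
  by (rule slide_letter) (auto simp: letter_pow x_r)

lemma x_pow_s: "letter x \<up> i @ [(s, \<delta>)] \<leadsto> (s, \<delta>) # letter x \<up> i"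
  using slide[of "letter x \<up> i" "[(s, \<delta>)]"] by (auto simp: letter_pow x_s)

lemma x_pow_t: "letter x \<up> i @ [t] \<leadsto> t # letter r \<up> i"
  using convey[of "letter x \<up> i" t "\<lambda>(_, \<epsilon>). (r, \<epsilon>)"] by (auto simp: letter_pow x_t)

lemma r_pow_t': "letter r \<up> i @ [t'] \<leadsto> t' # letter x \<up> i"
  using convey[of "letter r \<up> i" t' "\<lambda>(_, \<epsilon>). (x, \<epsilon>)"] by (auto simp: letter_pow r_t')

lemma overlap_x_r_t': "joins [(r, \<epsilon>), (x, \<delta>), t'] [(x, \<delta>), t', (x, \<epsilon>)]"
proof (rule joinsI)
  let ?i = "signed_int \<delta> m"
  have "[(r, \<epsilon>), (x, \<delta>), t'] \<leadsto> (r, \<epsilon>) # t' # (s, \<delta>) # letter x \<up> ?i"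
    by (rule red_at[OF x_t', of _ "[(r, \<epsilon>)]" \<delta> "[]"]) simp_all
  also have "\<dots> \<leadsto> t' # (x, \<epsilon>) # (s, \<delta>) # letter x \<up> ?i"
    by (rule red_at[OF r_t', of _ "[]" \<epsilon> "(s, \<delta>) # letter x \<up> ?i"]) simp_all
  also have "\<dots> \<leadsto> t' # (s, \<delta>) # (x, \<epsilon>) # letter x \<up> ?i"
    by (rule red_at[OF x_s, of _ "[t']" \<epsilon> \<delta> "letter x \<up> ?i"]) simp_all
  finally show "[(r, \<epsilon>), (x, \<delta>), t'] \<leadsto> t' # (s, \<delta>) # (x, \<epsilon>) # letter x \<up> ?i" .
  show "[(x, \<delta>), t', (x, \<epsilon>)] \<leadsto> t' # (s, \<delta>) # letter x \<up> ?i @ [(x, \<epsilon>)]"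
    by (rule red_at[OF x_t', of _ "[]" \<delta> "[(x, \<epsilon>)]"]) simp_all
  show "joins (t' # (s, \<delta>) # (x, \<epsilon>) # letter x \<up> ?i) (t' # (s, \<delta>) # letter x \<up> ?i @ [(x, \<epsilon>)])"
    using letter_pow_commute[OF cancel(1), of "[t', (s, \<delta>)]" "signed_int \<epsilon> 1" ?i "[]"]
    by (simp add: letter_pow_unit)
qed

lemma overlap_x_s_t:
  "joins [(s, \<epsilon>), (x, \<delta>), t] ((x, \<delta>) # t # letter r \<up> (- signed_int \<epsilon> m) @ [(x, \<epsilon>)])"
proof (rule joinsI)
  let ?i = "- signed_int \<epsilon> m"
  have "[(s, \<epsilon>), (x, \<delta>), t] \<leadsto> [(s, \<epsilon>), t, (r, \<delta>)]"
    by (rule red_at[OF x_t, of _ "[(s, \<epsilon>)]" \<delta> "[]"]) simp_all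
  also have "\<dots> \<leadsto> t # letter r \<up> ?i @ [(x, \<epsilon>), (r, \<delta>)]"
    by (rule red_at[OF s_t, of _ "[]" \<epsilon> "[(r, \<delta>)]"]) simp_all
  also have "\<dots> \<leadsto> t # letter r \<up> ?i @ [(r, \<delta>), (x, \<epsilon>)]"
    by (rule red_at[OF x_r, of _ "t # letter r \<up> ?i" \<epsilon> \<delta> "[]"]) simp_all
  finally show "[(s, \<epsilon>), (x, \<delta>), t] \<leadsto> t # letter r \<up> ?i @ [(r, \<delta>), (x, \<epsilon>)]" .
  show "(x, \<delta>) # t # letter r \<up> ?i @ [(x, \<epsilon>)] \<leadsto> t # (r, \<delta>) # letter r \<up> ?i @ [(x, \<epsilon>)]"
    by (rule red_at[OF x_t, of _ "[]" \<delta> "letter r \<up> ?i @ [(x, \<epsilon>)]"]) simp_all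
  show "joins (t # letter r \<up> ?i @ [(r, \<delta>), (x, \<epsilon>)]) (t # (r, \<delta>) # letter r \<up> ?i @ [(x, \<epsilon>)])"
    using letter_pow_commute[OF cancel(2), of "[t]" ?i "signed_int \<delta> 1" "[(x, \<epsilon>)]"]
    by (simp add: letter_pow_unit)
qed

lemma overlap_x_x_t: "[(x, \<delta>), t, (r, \<not> \<delta>)] \<leadsto> [t]"
proof -
  have "[(x, \<delta>), t, (r, \<not> \<delta>)] \<leadsto> [t, (r, \<delta>), (r, \<not> \<delta>)]"
    by (rule red_at[OF x_t, of _ "[]" \<delta> "[(r, \<not> \<delta>)]"]) simp_all
  also have "\<dots> \<leadsto> [t]"
    by (rule red_at[OF cancel(2), of _ "[t]" \<delta> "[]"]) simp_all
  finally show ?thesis .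
qed

lemma overlap_r_r_t': "[(r, \<delta>), t', (x, \<not> \<delta>)] \<leadsto> [t']"
proof -
  have "[(r, \<delta>), t', (x, \<not> \<delta>)] \<leadsto> [t', (x, \<delta>), (x, \<not> \<delta>)]"
    by (rule red_at[OF r_t', of _ "[]" \<delta> "[(x, \<not> \<delta>)]"]) simp_all
  also have "\<dots> \<leadsto> [t']"
    by (rule red_at[OF cancel(1), of _ "[t']" \<delta> "[]"]) simp_all
  finally show ?thesis .
qed

lemma overlap_s_s_t: "(s, \<delta>) # t # letter r \<up> signed_int \<delta> m @ [(x, \<not> \<delta>)] \<leadsto> [t]"
proof -
  let ?i = "signed_int \<delta> m"
  have "(s, \<delta>) # t # letter r \<up> ?i @ [(x, \<not> \<delta>)] \<leadsto>
      t # letter r \<up> (- ?i) @ (x, \<delta>) # letter r \<up> ?i @ [(x, \<not> \<delta>)]"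
    by (rule red_at[OF s_t, of _ "[]" \<delta> "letter r \<up> ?i @ [(x, \<not> \<delta>)]"]) simp_all
  also have "\<dots> \<leadsto> t # letter r \<up> (- ?i) @ letter r \<up> ?i @ [(x, \<delta>), (x, \<not> \<delta>)]"
    by (rule red_at[OF x_r_pow, of _ "t # letter r \<up> (- ?i)" \<delta> ?i "[(x, \<not> \<delta>)]"]) simp_all
  also have "\<dots> \<leadsto> [t, (x, \<delta>), (x, \<not> \<delta>)]"
    by (rule red_at[OF letter_pow_cancel(2)[OF cancel(2)], of _ "[t]" ?i]) simp_all
  also have "\<dots> \<leadsto> [t]"
    by (rule red_at[OF cancel(1), of _ "[t]" \<delta> "[]"]) simp_all
  finally show ?thesis .
qed

lemma overlap_x_x_t': "(x, \<delta>) # t' # (s, \<not> \<delta>) # letter x \<up> (- signed_int \<delta> m) \<leadsto> [t']"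
proof -
  let ?i = "signed_int \<delta> m"
  have "(x, \<delta>) # t' # (s, \<not> \<delta>) # letter x \<up> (- ?i) \<leadsto>
      t' # (s, \<delta>) # letter x \<up> ?i @ (s, \<not> \<delta>) # letter x \<up> (- ?i)"
    by (rule red_at[OF x_t', of _ "[]" \<delta> "(s, \<not> \<delta>) # letter x \<up> (- ?i)"]) simp_all
  also have "\<dots> \<leadsto> t' # (s, \<delta>) # (s, \<not> \<delta>) # letter x \<up> ?i @ letter x \<up> (- ?i)"
    by (rule red_at[OF x_pow_s, of _ "[t', (s, \<delta>)]" ?i "\<not> \<delta>" "letter x \<up> (- ?i)"]) simp_all
  also have "\<dots> \<leadsto> [t', (s, \<delta>), (s, \<not> \<delta>)]"
    by (rule red_at[OF letter_pow_cancel(1)[OF cancel(1)], of _ "[t', (s, \<delta>), (s, \<not> \<delta>)]" ?i "[]"]) simp_all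
  also have "\<dots> \<leadsto> [t']"
    by (rule red_at[OF cancel(3), of _ "[t']" \<delta> "[]"]) simp_all
  finally show ?thesis .
qed

lemma overlap_x_t_t': "[t, (r, \<delta>), t'] \<leadsto> [(x, \<delta>)]"
proof -
  have "[t, (r, \<delta>), t'] \<leadsto> [t, t', (x, \<delta>)]"
    by (rule red_at[OF r_t', of _ "[t]" \<delta> "[]"]) simp_all
  also have "\<dots> \<leadsto> [(x, \<delta>)]"
    by (rule red_at[OF cancel(4), of _ "[]" "[(x, \<delta>)]"]) simp_all
  finally show ?thesis .
qed

lemma overlap_r_t'_t: "[t', (x, \<delta>), t] \<leadsto> [(r, \<delta>)]"
proof -
  have "[t', (x, \<delta>), t] \<leadsto> [t', t, (r, \<delta>)]"
    by (rule red_at[OF x_t, of _ "[t']" \<delta> "[]"]) simp_all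
  also have "\<dots> \<leadsto> [(r, \<delta>)]"
    by (rule red_at[OF cancel(5), of _ "[]" "[(r, \<delta>)]"]) simp_all
  finally show ?thesis .
qed

lemma overlap_s_t_t': "t # letter r \<up> (- signed_int \<delta> m) @ [(x, \<delta>), t'] \<leadsto> [(s, \<delta>)]"
proof -
  let ?i = "signed_int \<delta> m"
  have "t # letter r \<up> (- ?i) @ [(x, \<delta>), t'] \<leadsto> t # letter r \<up> (- ?i) @ t' # (s, \<delta>) # letter x \<up> ?i"
    by (rule red_at[OF x_t', of _ "t # letter r \<up> (- ?i)" \<delta> "[]"]) simp_all
  also have "\<dots> \<leadsto> t # t' # letter x \<up> (- ?i) @ (s, \<delta>) # letter x \<up> ?i"
    by (rule red_at[OF r_pow_t', of _ "[t]" "- ?i" "(s, \<delta>) # letter x \<up> ?i"]) simp_all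
  also have "\<dots> \<leadsto> letter x \<up> (- ?i) @ (s, \<delta>) # letter x \<up> ?i"
    by (rule red_at[OF cancel(4), of _ "[]" "letter x \<up> (- ?i) @ (s, \<delta>) # letter x \<up> ?i"]) simp_all
  also have "\<dots> \<leadsto> (s, \<delta>) # letter x \<up> (- ?i) @ letter x \<up> ?i"
    by (rule red_at[OF x_pow_s, of _ "[]" "- ?i" \<delta> "letter x \<up> ?i"]) simp_all
  also have "\<dots> \<leadsto> [(s, \<delta>)]"
    by (rule red_at[OF letter_pow_cancel(2)[OF cancel(1)], of _ "[(s, \<delta>)]" ?i "[]"]) simp_all
  finally show ?thesis .
qed

lemma overlap_x_t'_t: "t' # (s, \<delta>) # letter x \<up> signed_int \<delta> m @ [t] \<leadsto> [(x, \<delta>)]"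
proof -
  let ?i = "signed_int \<delta> m"
  have "t' # (s, \<delta>) # letter x \<up> ?i @ [t] \<leadsto> t' # (s, \<delta>) # t # letter r \<up> ?i"
    by (rule red_at[OF x_pow_t, of _ "[t', (s, \<delta>)]" ?i "[]"]) simp_all
  also have "\<dots> \<leadsto> t' # t # letter r \<up> (- ?i) @ (x, \<delta>) # letter r \<up> ?i"
    by (rule red_at[OF s_t, of _ "[t']" \<delta> "letter r \<up> ?i"]) simp_all
  also have "\<dots> \<leadsto> letter r \<up> (- ?i) @ (x, \<delta>) # letter r \<up> ?i"
    by (rule red_at[OF cancel(5), of _ "[]" "letter r \<up> (- ?i) @ (x, \<delta>) # letter r \<up> ?i"]) simp_all
  also have "\<dots> \<leadsto> letter r \<up> (- ?i) @ letter r \<up> ?i @ [(x, \<delta>)]"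
    by (rule red_at[OF x_r_pow, of _ "letter r \<up> (- ?i)" \<delta> ?i "[]"]) simp_all
  also have "\<dots> \<leadsto> [(x, \<delta>)]"
    by (rule red_at[OF letter_pow_cancel(2)[OF cancel(2)], of _ "[]" ?i "[(x, \<delta>)]"]) simp_all
  finally show ?thesis .
qed

end

section \<open>Local confluence\<close>

locale circle_bundle_rewriting = circle_bundles D for D :: "('v, 'e) bundle_data"
begin

definition reduces :: "('v, 'e) gen gword \<Rightarrow> ('v, 'e) gen gword \<Rightarrow> bool" (infix "\<leadsto>" 50) where
  "u \<leadsto> v \<longleftrightarrow> (u, v) \<in> (rewrite_step UNIV (rules D))\<^sup>*"

sublocale word_reduction reduces
  by unfold_locales (auto simp: reduces_def intro: rewrites_context)

lemma joinable_iff_joins: "joinable (rules D) u v \<longleftrightarrow> joins u v"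
  by (simp add: joinable_def joins_def reduces_def)

lemma red_rule: "(u, v) \<in> uniform_rules D \<Longrightarrow> u \<leadsto> v"
  unfolding reduces_def rules_eq by (intro r_into_rtrancl rewrite_step_rule)

lemmas red_cancel = red_rule[OF uniform_rules.cancel]
lemmas red_commute = red_rule[OF uniform_rules.commute]
lemmas red_amalgam = red_rule[OF uniform_rules.amalgam]

lemma stable_letter_reduction_blue:
  assumes "k \<in> blue_loops D"
  shows "stable_letter_reduction reduces (Gx (\<iota> D k)) (Gr k) (Gs k) (Gt k, True) (Gt k, False) (loop_int D k)"
proof -
  have k: "k \<in> Ls D" "blue D (\<iota> D k)"
    using assms by (auto simp: blue_loops_def)
  note rule = red_rule[OF uniform_rules.intros(4)[OF assms]]
    red_rule[OF uniform_rules.intros(5)[OF assms]]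
    red_rule[OF uniform_rules.intros(6)[OF assms]]
    red_rule[OF uniform_rules.intros(7)[OF assms]]
  show ?thesis
    using loop_gens[OF k(1)] k rule red_cancel[OF loop_gens(4)[OF k(1)], of True]
      red_cancel[OF loop_gens(4)[OF k(1)], of False]
    by unfold_locales (auto intro!: red_cancel red_commute commuting_pairI)
qed

lemma stable_letter_reduction_red:
  assumes "l \<in> red_loops D"
  shows "stable_letter_reduction (\<lambda>u v. rev u \<leadsto> rev v)
    (Gx (\<iota> D l)) (Gr l) (Gs l) (Gt l, False) (Gt l, True) (loop_int D l)"
proof -
  have l: "l \<in> Ls D" "\<not> blue D (\<iota> D l)"
    using assms by (auto simp: red_loops_def)
  note rule = red_rule[OF uniform_rules.intros(8)[OF assms]]
    red_rule[OF uniform_rules.intros(9)[OF assms]]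
    red_rule[OF uniform_rules.intros(10)[OF assms]]
    red_rule[OF uniform_rules.intros(11)[OF assms]]
  have cancel: "[(z, \<not> \<epsilon>), (z, \<epsilon>)] \<leadsto> []" if "z \<in> S_gens D" for z \<epsilon>
    using red_cancel[OF that, of "\<not> \<epsilon>"] by simp
  show ?thesis
    using loop_gens[OF l(1)] l rule cancel[OF loop_gens(4)[OF l(1)], of True]
      cancel[OF loop_gens(4)[OF l(1)], of False]
    by unfold_locales
      (auto simp: rev_letter_pow intro: red_trans intro!: cancel red_commute commuting_pairI red_context)
qed

lemma cancel_local: "v \<in> Vs D \<Longrightarrow> z \<in> local_gens D v \<Longrightarrow> [(z, \<epsilon>), (z, \<not> \<epsilon>)] \<leadsto> []"
  using local_gens_subset by (auto intro: red_cancel)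

lemma cancel_fibre: "v \<in> Vs D \<Longrightarrow> [(Gx v, \<epsilon>), (Gx v, \<not> \<epsilon>)] \<leadsto> []"
  by (intro red_cancel Gx_in_S_gens)

lemma cancel_surface_word:
  assumes "v \<in> Vs D"
  shows "surface_word D v @ (surface_word D v)\<^sup>- \<leadsto> []" "(surface_word D v)\<^sup>- @ surface_word D v \<leadsto> []"
  using surface_word_local[OF assms] by (auto intro!: cancel_word cancel_local[OF assms])

lemma fibre_moves_right:
  assumes "v \<in> Vs D" "blue D v" "fst ` set w \<subseteq> local_gens D v"
  shows "letter (Gx v) \<up> i @ w \<leadsto> w @ letter (Gx v) \<up> i" "(Gx v, \<delta>) # w \<leadsto> w @ [(Gx v, \<delta>)]"
proof -
  show 1: "letter (Gx v) \<up> i @ w \<leadsto> w @ letter (Gx v) \<up> i" for i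
    by (rule slide) (use assms in \<open>auto simp: letter_pow intro!: red_commute commuting_pairI\<close>)
  show "(Gx v, \<delta>) # w \<leadsto> w @ [(Gx v, \<delta>)]"
    using 1[of "signed_int \<delta> 1"] by (simp add: letter_pow_unit)
qed

lemma fibre_moves_left:
  assumes "v \<in> Vs D" "\<not> blue D v" "fst ` set w \<subseteq> local_gens D v"
  shows "w @ letter (Gx v) \<up> i \<leadsto> letter (Gx v) \<up> i @ w" "w @ [(Gx v, \<delta>)] \<leadsto> (Gx v, \<delta>) # w"
proof -
  show 1: "w @ letter (Gx v) \<up> i \<leadsto> letter (Gx v) \<up> i @ w" for i
    by (rule slide) (use assms in \<open>auto simp: letter_pow intro!: red_commute commuting_pairI\<close>)
  show "w @ [(Gx v, \<delta>)] \<leadsto> (Gx v, \<delta>) # w"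
    using 1[of "signed_int \<delta> 1"] by (simp add: letter_pow_unit)
qed

text \<open>At a blue vertex the twist vanishes, at a red one the fibre moves to the left.\<close>

lemma twist_moves_left:
  assumes "v \<in> Vs D" "fst ` set w \<subseteq> local_gens D v" "i = twist D v \<or> i = - twist D v"
  shows "w @ wx v \<up> i \<leadsto> wx v \<up> i @ w"
  using fibre_moves_left(1)[OF assms(1) _ assms(2)] assms(3)
  by (cases "blue D v") (auto simp: twist_def)

text \<open>
  The overlap of \<open>a\<^sub>1\<^sup>-\<^sup>\<alpha> a\<^sub>1\<^sup>\<alpha>\<close> with an amalgam relator for \<open>a\<^sub>1\<^sup>\<alpha> b\<^sub>1\<^sup>\<beta>\<close>. The relators for \<open>a\<^sub>1\<^sup>\<alpha>\<close> and
  \<open>a\<^sub>1\<^sup>-\<^sup>\<alpha>\<close> are solutions of the same relation, so pushing \<open>a\<^sub>1\<^sup>-\<^sup>\<alpha>\<close> through the right-hand side undoes the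
  effect of pushing \<open>a\<^sub>1\<^sup>\<alpha>\<close> through \<open>b\<^sub>1\<^sup>\<beta>\<close>. The powers of the fibre meet and cancel.
\<close>

lemma cancel_before_amalgam:
  assumes v: "v \<in> Vs D"
  shows "(Ga v 1, \<not> \<alpha>) # wx v \<up> amalgam_twist D v \<alpha> \<beta> @ amalgam_rhs D v \<alpha> \<beta> \<leadsto> tl (amalgam_lhs D v \<alpha> \<beta>)"
proof -
  let ?W = "surface_word D v" and ?n = "twist D v"
  let ?x = "\<lambda>i. wx v \<up> i" and ?a = "(Ga v 1, \<alpha>)" and ?a' = "(Ga v 1, \<not> \<alpha>)" and ?b = "(Gb v 1, \<beta>)"
  have a: "[?a, ?a'] \<leadsto> []" "[?a', ?a] \<leadsto> []"
    using cancel_local[OF v, of "Ga v 1" \<alpha>] cancel_local[OF v, of "Ga v 1" "\<not> \<alpha>"] ab1_local[OF v] by simp_all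
  have x: "?x ?n @ ?x (- ?n) \<leadsto> []" "?x (- ?n) @ ?x ?n \<leadsto> []"
    using letter_pow_cancel[OF cancel_fibre[OF v]] by auto
  have move: "?a' # ?x (amalgam_twist D v \<alpha> \<beta>) @ w \<leadsto> ?x (amalgam_twist D v \<alpha> \<beta>) @ ?a' # w" for w
    by (rule red_at[OF twist_moves_left[OF v, of "[?a']" "amalgam_twist D v \<alpha> \<beta>"], of _ "[]" w])
      (auto simp: amalgam_twist_def ab1_local[OF v])
  have rule: "amalgam_lhs D v (\<not> \<alpha>) \<beta> \<leadsto> ?x (amalgam_twist D v (\<not> \<alpha>) \<beta>) @ amalgam_rhs D v (\<not> \<alpha>) \<beta>"
    by (rule red_amalgam[OF v])
  show ?thesis
  proof (cases \<alpha>; cases \<beta>)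
    assume \<alpha>: \<alpha> and \<beta>: \<beta>
    note move
    also have "?x (amalgam_twist D v \<alpha> \<beta>) @ ?a' # amalgam_rhs D v \<alpha> \<beta> \<leadsto> ?x (- ?n) @ ?x ?n @ [?b, ?a', ?a]"
      by (rule red_at[OF rule, of _ "?x (- ?n)" "[?a]"]) (simp_all add: amalgam_defs \<alpha> \<beta>)
    also have "\<dots> \<leadsto> [?b, ?a', ?a]"
      by (rule red_at[OF x(2), of _ "[]" "[?b, ?a', ?a]"]) simp_all
    also have "\<dots> \<leadsto> tl (amalgam_lhs D v \<alpha> \<beta>)"
      by (rule red_at[OF a(2), of _ "[?b]" "[]"]) (simp_all add: amalgam_defs \<alpha> \<beta>)
    finally show ?thesis .
  next
    assume \<alpha>: \<alpha> and \<beta>: "\<not> \<beta>"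
    note move
    also have "?x (amalgam_twist D v \<alpha> \<beta>) @ ?a' # amalgam_rhs D v \<alpha> \<beta> \<leadsto>
        ?x ?n @ ?x (- ?n) @ [?b, ?a'] @ ?W @ ?W\<^sup>- @ [?a]"
      by (rule red_at[OF rule, of _ "?x ?n" "?W\<^sup>- @ [?a]"]) (simp_all add: amalgam_lhs_def amalgam_rhs_def amalgam_twist_def \<alpha> \<beta>)
    also have "\<dots> \<leadsto> [?b, ?a'] @ ?W @ ?W\<^sup>- @ [?a]"
      by (rule red_at[OF x(1), of _ "[]" "[?b, ?a'] @ ?W @ ?W\<^sup>- @ [?a]"]) simp_all
    also have "\<dots> \<leadsto> [?b, ?a', ?a]"
      by (rule red_at[OF cancel_surface_word(1)[OF v], of _ "[?b, ?a']" "[?a]"]) simp_all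
    also have "\<dots> \<leadsto> tl (amalgam_lhs D v \<alpha> \<beta>)"
      by (rule red_at[OF a(2), of _ "[?b]" "[]"]) (simp_all add: amalgam_lhs_def \<alpha> \<beta>)
    finally show ?thesis .
  next
    assume \<alpha>: "\<not> \<alpha>" and \<beta>: \<beta>
    note move
    also have "?x (amalgam_twist D v \<alpha> \<beta>) @ ?a' # amalgam_rhs D v \<alpha> \<beta> \<leadsto> ?x ?n @ ?x (- ?n) @ ?W @ [?b, ?a', ?a]"
      by (rule red_at[OF rule, of _ "?x ?n" "[?a]"]) (simp_all add: amalgam_lhs_def amalgam_rhs_def amalgam_twist_def \<alpha> \<beta>)
    also have "\<dots> \<leadsto> ?W @ [?b, ?a', ?a]"
      by (rule red_at[OF x(1), of _ "[]" "?W @ [?b, ?a', ?a]"]) simp_all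
    also have "\<dots> \<leadsto> tl (amalgam_lhs D v \<alpha> \<beta>)"
      by (rule red_at[OF a(2), of _ "?W @ [?b]" "[]"]) (simp_all add: amalgam_lhs_def \<alpha> \<beta>)
    finally show ?thesis .
  next
    assume \<alpha>: "\<not> \<alpha>" and \<beta>: "\<not> \<beta>"
    note move
    also have "?x (amalgam_twist D v \<alpha> \<beta>) @ ?a' # amalgam_rhs D v \<alpha> \<beta> \<leadsto> ?x (- ?n) @ ?x ?n @ ?b # ?W\<^sup>- @ [?a', ?a] @ ?W"
      by (rule red_at[OF rule, of _ "?x (- ?n)" "?a # ?W"]) (simp_all add: amalgam_lhs_def amalgam_rhs_def amalgam_twist_def \<alpha> \<beta>)
    also have "\<dots> \<leadsto> ?b # ?W\<^sup>- @ [?a', ?a] @ ?W"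
      by (rule red_at[OF x(2), of _ "[]" "?b # ?W\<^sup>- @ [?a', ?a] @ ?W"]) simp_all
    also have "\<dots> \<leadsto> ?b # ?W\<^sup>- @ ?W"
      by (rule red_at[OF a(2), of _ "?b # ?W\<^sup>-" ?W]) simp_all
    also have "\<dots> \<leadsto> tl (amalgam_lhs D v \<alpha> \<beta>)"
      by (rule red_at[OF cancel_surface_word(2)[OF v], of _ "[?b]" "[]"]) (simp_all add: amalgam_lhs_def \<alpha> \<beta>)
    finally show ?thesis .
  qed
qed

text \<open>
  The overlap with \<open>b\<^sub>1\<^sup>\<beta> b\<^sub>1\<^sup>-\<^sup>\<beta>\<close>, for the same reason: the relators for \<open>b\<^sub>1\<^sup>\<beta>\<close> and \<open>b\<^sub>1\<^sup>-\<^sup>\<beta>\<close> undo each other.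
\<close>

lemma cancel_after_amalgam:
  assumes v: "v \<in> Vs D"
  shows "wx v \<up> amalgam_twist D v \<alpha> \<beta> @ amalgam_rhs D v \<alpha> \<beta> @ [(Gb v 1, \<not> \<beta>)] \<leadsto> butlast (amalgam_lhs D v \<alpha> \<beta>)"
proof -
  let ?W = "surface_word D v" and ?n = "twist D v"
  let ?x = "\<lambda>i. wx v \<up> i" and ?a = "(Ga v 1, \<alpha>)" and ?b = "(Gb v 1, \<beta>)" and ?b' = "(Gb v 1, \<not> \<beta>)"
  have b: "[?b, ?b'] \<leadsto> []"
    using cancel_local[OF v, of "Gb v 1" \<beta>] ab1_local[OF v] by simp
  have x: "?x ?n @ ?x (- ?n) \<leadsto> []" "?x (- ?n) @ ?x ?n \<leadsto> []"
    using letter_pow_cancel[OF cancel_fibre[OF v]] by auto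
  have collect: "?x i @ u @ ?x j @ w \<leadsto> u @ w"
    if "i = twist D v \<and> j = - twist D v \<or> i = - twist D v \<and> j = twist D v"
      "fst ` set u \<subseteq> local_gens D v" for i j u w
  proof -
    have "?x i @ u @ ?x j @ w \<leadsto> ?x i @ ?x j @ u @ w"
      by (rule red_at[OF twist_moves_left[OF v that(2), of j], of _ "?x i" w]) (use that in auto)
    also have "\<dots> \<leadsto> u @ w"
      by (rule red_at[of "?x i @ ?x j" "[]" _ "[]" "u @ w"]) (use that x in auto)
    finally show ?thesis .
  qed
  note local = ab1_local[OF v] surface_word_local[OF v]
  have rule: "amalgam_lhs D v \<alpha> (\<not> \<beta>) \<leadsto> ?x (amalgam_twist D v \<alpha> (\<not> \<beta>)) @ amalgam_rhs D v \<alpha> (\<not> \<beta>)"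
    by (rule red_amalgam[OF v])
  show ?thesis
  proof (cases \<alpha>; cases \<beta>)
    assume \<alpha>: \<alpha> and \<beta>: \<beta>
    have "?x (amalgam_twist D v \<alpha> \<beta>) @ amalgam_rhs D v \<alpha> \<beta> @ [?b'] \<leadsto> ?x (- ?n) @ (?W @ [?b]) @ ?x ?n @ ?b' # ?W\<^sup>- @ [?a]"
      by (rule red_at[OF rule, of _ "?x (- ?n) @ ?W @ [?b]" "[]"]) (simp_all add: amalgam_lhs_def amalgam_rhs_def amalgam_twist_def \<alpha> \<beta>)
    also have "\<dots> \<leadsto> (?W @ [?b]) @ ?b' # ?W\<^sup>- @ [?a]"
      by (rule collect) (use local in auto)
    also have "\<dots> \<leadsto> ?W @ ?W\<^sup>- @ [?a]"
      by (rule red_at[OF b, of _ ?W "?W\<^sup>- @ [?a]"]) simp_all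
    also have "\<dots> \<leadsto> butlast (amalgam_lhs D v \<alpha> \<beta>)"
      by (rule red_at[OF cancel_surface_word(1)[OF v], of _ "[]" "[?a]"]) (simp_all add: amalgam_lhs_def \<alpha> \<beta>)
    finally show ?thesis .
  next
    assume \<alpha>: \<alpha> and \<beta>: "\<not> \<beta>"
    have "?x (amalgam_twist D v \<alpha> \<beta>) @ amalgam_rhs D v \<alpha> \<beta> @ [?b'] \<leadsto>
        ?x ?n @ (?b # ?W\<^sup>-) @ ?x (- ?n) @ ?W @ [?b', ?a]"
      by (rule red_at[OF rule, of _ "?x ?n @ ?b # ?W\<^sup>-" "[]"]) (simp_all add: amalgam_lhs_def amalgam_rhs_def amalgam_twist_def \<alpha> \<beta>)
    also have "\<dots> \<leadsto> (?b # ?W\<^sup>-) @ ?W @ [?b', ?a]"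
      by (rule collect) (use local in auto)
    also have "\<dots> \<leadsto> [?b, ?b', ?a]"
      by (rule red_at[OF cancel_surface_word(2)[OF v], of _ "[?b]" "[?b', ?a]"]) simp_all
    also have "\<dots> \<leadsto> butlast (amalgam_lhs D v \<alpha> \<beta>)"
      by (rule red_at[OF b, of _ "[]" "[?a]"]) (simp_all add: amalgam_lhs_def \<alpha> \<beta>)
    finally show ?thesis .
  next
    assume \<alpha>: "\<not> \<alpha>" and \<beta>: \<beta>
    have "?x (amalgam_twist D v \<alpha> \<beta>) @ amalgam_rhs D v \<alpha> \<beta> @ [?b'] \<leadsto> ?x ?n @ [?b] @ ?x (- ?n) @ [?b', ?a] @ ?W"
      by (rule red_at[OF rule, of _ "?x ?n @ [?b]" "[]"]) (simp_all add: amalgam_lhs_def amalgam_rhs_def amalgam_twist_def \<alpha> \<beta>)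
    also have "\<dots> \<leadsto> [?b] @ [?b', ?a] @ ?W"
      by (rule collect) (use local in auto)
    also have "\<dots> \<leadsto> butlast (amalgam_lhs D v \<alpha> \<beta>)"
      by (rule red_at[OF b, of _ "[]" "?a # ?W"]) (simp_all add: amalgam_lhs_def \<alpha> \<beta> butlast_append)
    finally show ?thesis .
  next
    assume \<alpha>: "\<not> \<alpha>" and \<beta>: "\<not> \<beta>"
    have "?x (amalgam_twist D v \<alpha> \<beta>) @ amalgam_rhs D v \<alpha> \<beta> @ [?b'] \<leadsto> ?x (- ?n) @ [?b] @ ?x ?n @ [?b', ?a]"
      by (rule red_at[OF rule, of _ "?x (- ?n) @ [?b]" "[]"]) (simp_all add: amalgam_lhs_def amalgam_rhs_def amalgam_twist_def \<alpha> \<beta>)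
    also have "\<dots> \<leadsto> [?b] @ [?b', ?a]"
      by (rule collect) (use local in auto)
    also have "\<dots> \<leadsto> butlast (amalgam_lhs D v \<alpha> \<beta>)"
      by (rule red_at[OF b, of _ "[]" "[?a]"]) (simp_all add: amalgam_lhs_def \<alpha> \<beta>)
    finally show ?thesis .
  qed
qed

lemma amalgam_lhs_split:
  "amalgam_lhs D v \<alpha> \<beta> = (Ga v 1, \<alpha>) # tl (amalgam_lhs D v \<alpha> \<beta>)"
  "amalgam_lhs D v \<alpha> \<beta> = butlast (amalgam_lhs D v \<alpha> \<beta>) @ [(Gb v 1, \<beta>)]"
  by (simp_all add: amalgam_lhs_def butlast_append)

text \<open>
  A blue fibre passes through both sides of an amalgam relator, since all their letters commute with
  it; the same holds for a red fibre, except that it also meets the power of itself on the right-hand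
  side.
\<close>

lemma fibre_before_amalgam:
  assumes v: "v \<in> Vs D" and blue: "blue D v"
  shows "joins ((Ga v 1, \<alpha>) # (Gx v, \<delta>) # tl (amalgam_lhs D v \<alpha> \<beta>))
    ((Gx v, \<delta>) # wx v \<up> amalgam_twist D v \<alpha> \<beta> @ amalgam_rhs D v \<alpha> \<beta>)"
proof -
  have untwisted: "wx v \<up> amalgam_twist D v \<alpha> \<beta> = []"
    using blue by (simp add: amalgam_twist_def twist_def)
  have "fst ` set (tl (amalgam_lhs D v \<alpha> \<beta>)) \<subseteq> local_gens D v"
    using amalgam_local(1)[OF v, of \<alpha> \<beta>] by (subst (asm) amalgam_lhs_split(1)) auto
  from fibre_moves_right(2)[OF v blue this]
  have "(Ga v 1, \<alpha>) # (Gx v, \<delta>) # tl (amalgam_lhs D v \<alpha> \<beta>) \<leadsto> amalgam_lhs D v \<alpha> \<beta> @ [(Gx v, \<delta>)]"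
    by (rule red_at[of _ _ _ "[(Ga v 1, \<alpha>)]" "[]"]) (simp, subst amalgam_lhs_split(1), simp)
  also have "\<dots> \<leadsto> amalgam_rhs D v \<alpha> \<beta> @ [(Gx v, \<delta>)]"
    by (rule red_at[OF red_amalgam[OF v, of \<alpha> \<beta>], of _ "[]" "[(Gx v, \<delta>)]"]) (simp_all add: untwisted)
  finally show ?thesis
    unfolding joins_def untwisted using fibre_moves_right(2)[OF v blue amalgam_local(2)[OF v]] by auto
qed

lemma fibre_after_amalgam:
  assumes v: "v \<in> Vs D" and red: "\<not> blue D v"
  shows "joins (wx v \<up> amalgam_twist D v \<alpha> \<beta> @ amalgam_rhs D v \<alpha> \<beta> @ [(Gx v, \<delta>)])
    (butlast (amalgam_lhs D v \<alpha> \<beta>) @ [(Gx v, \<delta>), (Gb v 1, \<beta>)])"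
proof (rule joinsI)
  let ?i = "amalgam_twist D v \<alpha> \<beta>"
  show "wx v \<up> ?i @ amalgam_rhs D v \<alpha> \<beta> @ [(Gx v, \<delta>)] \<leadsto> wx v \<up> ?i @ (Gx v, \<delta>) # amalgam_rhs D v \<alpha> \<beta>"
    by (rule red_at[OF fibre_moves_left(2)[OF v red amalgam_local(2)[OF v]], of _ "wx v \<up> ?i" _ _ _ "[]"]) simp_all
  have "fst ` set (butlast (amalgam_lhs D v \<alpha> \<beta>)) \<subseteq> local_gens D v"
    using amalgam_local(1)[OF v, of \<alpha> \<beta>] by (subst (asm) amalgam_lhs_split(2)) auto
  from fibre_moves_left(2)[OF v red this]
  have "butlast (amalgam_lhs D v \<alpha> \<beta>) @ [(Gx v, \<delta>), (Gb v 1, \<beta>)] \<leadsto> (Gx v, \<delta>) # amalgam_lhs D v \<alpha> \<beta>"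
    by (rule red_at[of _ _ _ "[]" "[(Gb v 1, \<beta>)]"]) (simp, subst amalgam_lhs_split(2), simp)
  also have "\<dots> \<leadsto> (Gx v, \<delta>) # wx v \<up> ?i @ amalgam_rhs D v \<alpha> \<beta>"
    by (rule red_at[OF red_amalgam[OF v, of \<alpha> \<beta>], of _ "[(Gx v, \<delta>)]" "[]"]) simp_all
  finally show "butlast (amalgam_lhs D v \<alpha> \<beta>) @ [(Gx v, \<delta>), (Gb v 1, \<beta>)] \<leadsto>
    (Gx v, \<delta>) # wx v \<up> ?i @ amalgam_rhs D v \<alpha> \<beta>" .
  show "joins (wx v \<up> ?i @ (Gx v, \<delta>) # amalgam_rhs D v \<alpha> \<beta>)
      ((Gx v, \<delta>) # wx v \<up> ?i @ amalgam_rhs D v \<alpha> \<beta>)"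
    using letter_pow_commute[OF cancel_fibre[OF v], of "[]" ?i "signed_int \<delta> 1" "amalgam_rhs D v \<alpha> \<beta>"]
    by (simp add: letter_pow_unit)
qed

lemma hd_last_amalgam_lhs [simp]:
  "hd (amalgam_lhs D v \<alpha> \<beta>) = (Ga v 1, \<alpha>)" "last (amalgam_lhs D v \<alpha> \<beta>) = (Gb v 1, \<beta>)"
  by (simp_all add: amalgam_lhs_def)

text \<open>
  A last letter that is also a first letter leaves few combinations: a commutation followed by a
  commutation is excluded by \<open>commuting_pair_no_chain\<close>, an amalgam relator ends in a letter \<open>b\<^sub>1\<close>, which
  begins only a cancellation or, at a red vertex, a commutation, and a loop rule can only be preceded
  or followed by a cancellation or a commutation at the same vertex.
\<close>

lemma overlap_joins:
  assumes 1: "(u, w) \<in> uniform_rules D" and 2: "(u', w') \<in> uniform_rules D"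
    and overlap: "last u = hd u'"
  shows "joins (w @ tl u') (butlast u @ w')"
proof -
  have joins_red: "joins s t" if "t \<leadsto> s" for s t
    using that red_refl unfolding joins_def by blast
  have joins_red': "joins s t" if "s \<leadsto> t" for s t
    using that red_refl unfolding joins_def by blast
  from 1 show ?thesis
  proof cases
    case u: (cancel z \<epsilon>)
    from 2 show ?thesis
    proof cases
      case (cancel z' \<epsilon>')
      then show ?thesis using u overlap by (intro joins_red) auto
    next
      case (commute y' z' \<delta> \<epsilon>')
      have "[(z, \<epsilon>), (z', \<epsilon>'), (z, \<not> \<epsilon>)] \<leadsto> [(z', \<epsilon>'), (z, \<epsilon>), (z, \<not> \<epsilon>)]"
        by (rule red_at[OF red_commute, of z z' _ "[]" \<epsilon> \<epsilon>' "[(z, \<not> \<epsilon>)]"])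
          (use commute u overlap in auto)
      also have "\<dots> \<leadsto> [(z', \<epsilon>')]"
        by (rule red_at[OF red_cancel, of z _ "[(z', \<epsilon>')]" \<epsilon> "[]"]) (use u in auto)
      finally show ?thesis
        using commute u overlap by (intro joins_red) auto
    next
      case (amalgam v \<alpha> \<beta>)
      then show ?thesis
        using u overlap cancel_before_amalgam[of v \<alpha> \<beta>] by (intro joins_red) auto
    next
      case (blue_x_t k \<delta>)
      interpret stable_letter_reduction reduces "Gx (\<iota> D k)" "Gr k" "Gs k" "(Gt k, True)" "(Gt k, False)" "loop_int D k"
        by (rule stable_letter_reduction_blue[OF blue_x_t(3)])
      show ?thesis
        using u overlap blue_x_t overlap_x_x_t[of \<epsilon>] by (intro joins_red) auto
    next
      case (blue_r_t k \<delta>)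
      interpret stable_letter_reduction reduces "Gx (\<iota> D k)" "Gr k" "Gs k" "(Gt k, True)" "(Gt k, False)" "loop_int D k"
        by (rule stable_letter_reduction_blue[OF blue_r_t(3)])
      show ?thesis
        using u overlap blue_r_t overlap_r_r_t'[of \<epsilon>] by (intro joins_red) auto
    next
      case (blue_s_t k \<delta>)
      interpret stable_letter_reduction reduces "Gx (\<iota> D k)" "Gr k" "Gs k" "(Gt k, True)" "(Gt k, False)" "loop_int D k"
        by (rule stable_letter_reduction_blue[OF blue_s_t(3)])
      show ?thesis
        using u overlap blue_s_t overlap_s_s_t[of \<epsilon>] by (intro joins_red) auto
    next
      case (blue_x_t' k \<delta>)
      interpret stable_letter_reduction reduces "Gx (\<iota> D k)" "Gr k" "Gs k" "(Gt k, True)" "(Gt k, False)" "loop_int D k"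
        by (rule stable_letter_reduction_blue[OF blue_x_t'(3)])
      show ?thesis
        using u overlap blue_x_t' overlap_x_x_t'[of \<epsilon>] by (intro joins_red) auto
    next
      case (red_t_x l \<delta>)
      interpret dual: stable_letter_reduction "\<lambda>u v. rev u \<leadsto> rev v" "Gx (\<iota> D l)" "Gr l" "Gs l" "(Gt l, False)" "(Gt l, True)" "loop_int D l"
        by (rule stable_letter_reduction_red[OF red_t_x(3)])
      show ?thesis
        using u overlap red_t_x dual.overlap_x_t_t'[of \<delta>] by (intro joins_red) auto
    next
      case (red_t_r l \<delta>)
      interpret dual: stable_letter_reduction "\<lambda>u v. rev u \<leadsto> rev v" "Gx (\<iota> D l)" "Gr l" "Gs l" "(Gt l, False)" "(Gt l, True)" "loop_int D l"
        by (rule stable_letter_reduction_red[OF red_t_r(3)])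
      show ?thesis
        using u overlap red_t_r dual.overlap_r_t'_t[of \<delta>] by (intro joins_red) auto
    next
      case (red_t_s l \<delta>)
      interpret dual: stable_letter_reduction "\<lambda>u v. rev u \<leadsto> rev v" "Gx (\<iota> D l)" "Gr l" "Gs l" "(Gt l, False)" "(Gt l, True)" "loop_int D l"
        by (rule stable_letter_reduction_red[OF red_t_s(3)])
      show ?thesis
        using u overlap red_t_s dual.overlap_s_t_t'[of \<delta>] by (intro joins_red) (auto simp: rev_letter_pow)
    next
      case (red_t_x' l \<delta>)
      interpret dual: stable_letter_reduction "\<lambda>u v. rev u \<leadsto> rev v" "Gx (\<iota> D l)" "Gr l" "Gs l" "(Gt l, False)" "(Gt l, True)" "loop_int D l"
        by (rule stable_letter_reduction_red[OF red_t_x'(3)])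
      show ?thesis
        using u overlap red_t_x' dual.overlap_x_t'_t[of \<delta>] by (intro joins_red) (auto simp: rev_letter_pow)
    qed
  next
    case u: (commute y z \<delta> \<epsilon>)
    from 2 show ?thesis
    proof cases
      case (cancel z' \<epsilon>')
      have "[(z, \<epsilon>), (y, \<delta>), (z, \<not> \<epsilon>)] \<leadsto> [(z, \<epsilon>), (z, \<not> \<epsilon>), (y, \<delta>)]"
        by (rule red_at[OF red_commute, of y z _ "[(z, \<epsilon>)]" \<delta> "\<not> \<epsilon>" "[]"]) (use u in auto)
      also have "\<dots> \<leadsto> [(y, \<delta>)]"
        by (rule red_at[OF red_cancel, of z _ "[]" \<epsilon> "[(y, \<delta>)]"]) (use cancel u overlap in auto)
      finally show ?thesis
        using cancel u overlap by (intro joins_red') auto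
    next
      case (commute y' z' \<delta>' \<epsilon>')
      then show ?thesis using u overlap commuting_pair_no_chain by auto
    next
      case (amalgam v \<alpha> \<beta>)
      then have "blue D v" "y = Gx v"
        using u overlap by (auto simp: commuting_pair_def local_gens_def blue_verts_def)
      then show ?thesis
        using u overlap amalgam fibre_before_amalgam[of v \<alpha> \<delta> \<beta>] by auto
    next
      case (blue_x_t k \<delta>')
      then show ?thesis
        using u overlap ends_colour
        by (auto simp: commuting_pair_def local_gens_def blue_verts_def red_verts_def blue_loops_def)
    next
      case (blue_r_t k \<delta>')
      then have y: "y = Gx (\<iota> D k)"
        using u overlap by (auto simp: commuting_pair_def local_gens_def)
      interpret stable_letter_reduction reduces "Gx (\<iota> D k)" "Gr k" "Gs k" "(Gt k, True)" "(Gt k, False)" "loop_int D k"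
        by (rule stable_letter_reduction_blue[OF blue_r_t(3)])
      show ?thesis
        using u overlap y blue_r_t overlap_x_r_t'[of \<epsilon> \<delta>] by auto
    next
      case (blue_s_t k \<delta>')
      then have y: "y = Gx (\<iota> D k)"
        using u overlap by (auto simp: commuting_pair_def local_gens_def)
      interpret stable_letter_reduction reduces "Gx (\<iota> D k)" "Gr k" "Gs k" "(Gt k, True)" "(Gt k, False)" "loop_int D k"
        by (rule stable_letter_reduction_blue[OF blue_s_t(3)])
      show ?thesis
        using u overlap y blue_s_t overlap_x_s_t[of \<epsilon> \<delta>] by auto
    next
      case (blue_x_t' k \<delta>')
      then show ?thesis
        using u overlap ends_colour
        by (auto simp: commuting_pair_def local_gens_def blue_verts_def red_verts_def blue_loops_def)
    qed (use u overlap commuting_pair_neq_Gt in auto)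
  next
    case u: (amalgam v \<alpha> \<beta>)
    from 2 show ?thesis
    proof cases
      case (cancel z' \<epsilon>')
      then show ?thesis
        using u overlap cancel_after_amalgam[of v \<alpha> \<beta>] by (intro joins_red') auto
    next
      case (commute y' z' \<delta>' \<epsilon>')
      then have "\<not> blue D v" "z' = Gx v"
        using u overlap by (auto simp: commuting_pair_def local_gens_def red_verts_def)
      then show ?thesis
        using u overlap commute fibre_after_amalgam[of v \<alpha> \<beta> \<epsilon>'] by auto
    qed (use u overlap in auto)
  next
    case u: (blue_x_t k \<delta>)
    interpret stable_letter_reduction reduces "Gx (\<iota> D k)" "Gr k" "Gs k" "(Gt k, True)" "(Gt k, False)" "loop_int D k"
      by (rule stable_letter_reduction_blue[OF u(3)])
    from 2 show ?thesis
    proof cases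
      case (cancel z' \<epsilon>')
      then show ?thesis
        using u overlap overlap_x_t_t'[of \<delta>] by (intro joins_red') auto
    qed (use u overlap commuting_pair_neq_Gt in \<open>auto simp: blue_loops_def red_loops_def\<close>)
  next
    case u: (blue_r_t k \<delta>)
    interpret stable_letter_reduction reduces "Gx (\<iota> D k)" "Gr k" "Gs k" "(Gt k, True)" "(Gt k, False)" "loop_int D k"
      by (rule stable_letter_reduction_blue[OF u(3)])
    from 2 show ?thesis
    proof cases
      case (cancel z' \<epsilon>')
      then show ?thesis
        using u overlap overlap_r_t'_t[of \<delta>] by (intro joins_red') auto
    qed (use u overlap commuting_pair_neq_Gt in \<open>auto simp: blue_loops_def red_loops_def\<close>)
  next
    case u: (blue_s_t k \<delta>)
    interpret stable_letter_reduction reduces "Gx (\<iota> D k)" "Gr k" "Gs k" "(Gt k, True)" "(Gt k, False)" "loop_int D k"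
      by (rule stable_letter_reduction_blue[OF u(3)])
    from 2 show ?thesis
    proof cases
      case (cancel z' \<epsilon>')
      then show ?thesis
        using u overlap overlap_s_t_t'[of \<delta>] by (intro joins_red') auto
    qed (use u overlap commuting_pair_neq_Gt in \<open>auto simp: blue_loops_def red_loops_def\<close>)
  next
    case u: (blue_x_t' k \<delta>)
    interpret stable_letter_reduction reduces "Gx (\<iota> D k)" "Gr k" "Gs k" "(Gt k, True)" "(Gt k, False)" "loop_int D k"
      by (rule stable_letter_reduction_blue[OF u(3)])
    from 2 show ?thesis
    proof cases
      case (cancel z' \<epsilon>')
      then show ?thesis
        using u overlap overlap_x_t'_t[of \<delta>] by (intro joins_red') auto
    qed (use u overlap commuting_pair_neq_Gt in \<open>auto simp: blue_loops_def red_loops_def\<close>)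
  next
    case u: (red_t_x l \<delta>)
    interpret dual: stable_letter_reduction "\<lambda>u v. rev u \<leadsto> rev v" "Gx (\<iota> D l)" "Gr l" "Gs l" "(Gt l, False)" "(Gt l, True)" "loop_int D l"
      by (rule stable_letter_reduction_red[OF u(3)])
    from 2 show ?thesis
    proof cases
      case (cancel z' \<epsilon>')
      then show ?thesis
        using u overlap dual.overlap_x_x_t[of "\<not> \<delta>"] by (intro joins_red') auto
    qed (use u overlap in \<open>auto simp: blue_loops_def red_loops_def commuting_pair_def local_gens_def blue_verts_def red_verts_def\<close>)
  next
    case u: (red_t_r l \<delta>)
    interpret dual: stable_letter_reduction "\<lambda>u v. rev u \<leadsto> rev v" "Gx (\<iota> D l)" "Gr l" "Gs l" "(Gt l, False)" "(Gt l, True)" "loop_int D l"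
      by (rule stable_letter_reduction_red[OF u(3)])
    from 2 show ?thesis
    proof cases
      case (cancel z' \<epsilon>')
      then show ?thesis
        using u overlap dual.overlap_r_r_t'[of "\<not> \<delta>"] by (intro joins_red') auto
    next
      case (commute y z \<delta>' \<epsilon>)
      then have "z = Gx (\<iota> D l)"
        using u overlap by (auto simp: commuting_pair_def local_gens_def)
      then show ?thesis
        using u overlap commute dual.overlap_x_r_t'[of \<delta> \<epsilon>]
        by (auto simp: joins_def dual.joins_def)
    qed (use u overlap in \<open>auto simp: blue_loops_def red_loops_def commuting_pair_def local_gens_def blue_verts_def red_verts_def\<close>)
  next
    case u: (red_t_s l \<delta>)
    interpret dual: stable_letter_reduction "\<lambda>u v. rev u \<leadsto> rev v" "Gx (\<iota> D l)" "Gr l" "Gs l" "(Gt l, False)" "(Gt l, True)" "loop_int D l"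
      by (rule stable_letter_reduction_red[OF u(3)])
    from 2 show ?thesis
    proof cases
      case (cancel z' \<epsilon>')
      then show ?thesis
        using u overlap dual.overlap_s_s_t[of "\<not> \<delta>"] by (intro joins_red') (auto simp: rev_letter_pow)
    next
      case (commute y z \<delta>' \<epsilon>)
      then have "z = Gx (\<iota> D l)"
        using u overlap by (auto simp: commuting_pair_def local_gens_def)
      then show ?thesis
        using u overlap commute dual.overlap_x_s_t[of \<delta> \<epsilon>]
        by (auto simp: joins_def dual.joins_def rev_letter_pow)
    qed (use u overlap in \<open>auto simp: blue_loops_def red_loops_def commuting_pair_def local_gens_def blue_verts_def red_verts_def\<close>)
  next
    case u: (red_t_x' l \<delta>)
    interpret dual: stable_letter_reduction "\<lambda>u v. rev u \<leadsto> rev v" "Gx (\<iota> D l)" "Gr l" "Gs l" "(Gt l, False)" "(Gt l, True)" "loop_int D l"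
      by (rule stable_letter_reduction_red[OF u(3)])
    from 2 show ?thesis
    proof cases
      case (cancel z' \<epsilon>')
      then show ?thesis
        using u overlap dual.overlap_x_x_t'[of "\<not> \<delta>"] by (intro joins_red') (auto simp: rev_letter_pow)
    qed (use u overlap in \<open>auto simp: blue_loops_def red_loops_def commuting_pair_def local_gens_def blue_verts_def red_verts_def\<close>)
  qed
qed


text \<open>
  Apart from the words \<open>a\<^sub>v\<^sub>1\<^sup>-\<^sup>1 W b\<^sub>v\<^sub>1\<close> every left-hand side has two letters. Longer overlaps, and redexes
  inside others, would need a left-hand side of two letters inside such a word, or the start of one
  such word inside another. The latter is excluded because \<open>W\<close> contains no letter \<open>a\<^sub>1\<close>. The former is
  excluded because the word is freely reduced and consists of letters that commute with \<open>x\<^sub>v\<close>: no rule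
  exchanges two such letters, none of them is a stable letter, and \<open>a\<^sub>v\<^sub>1\<close> and \<open>b\<^sub>v\<^sub>1\<close> are separated by
  \<open>W\<close>.
\<close>

lemma long_lhs:
  assumes "(u, w) \<in> uniform_rules D"
  obtains c d where "u = [c, d]" | v where "v \<in> Vs D" "surface_word D v \<noteq> []" "u = amalgam_lhs D v False True"
  using assms
proof cases
  case (amalgam v \<alpha> \<beta>)
  show thesis
  proof (cases "\<not> \<alpha> \<and> \<beta> \<and> surface_word D v \<noteq> []")
    case True
    then show thesis using amalgam that(2) by auto
  next
    case False
    then have "u = [(Ga v 1, \<alpha>), (Gb v 1, \<beta>)]"
      using amalgam by (auto simp: amalgam_lhs_def)
    then show thesis by (rule that(1))
  qed
qed (use that in blast)+

lemma ends_determine_rule: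
  assumes "(u, w) \<in> uniform_rules D" "(u', w') \<in> uniform_rules D" "hd u = hd u'" "last u = last u'"
  shows "w = w'"
proof -
  have commute: "\<not> commuting_pair D (Ga v i) (Gb v' j)" "\<not> commuting_pair D y (Gt k)"
    "\<not> commuting_pair D (Gt k) y" for v v' i j y k
    using commuting_pair_neq_Gt[of y "Gt k" k] commuting_pair_neq_Gt[of "Gt k" y k]
    by (simp add: commuting_pair_def, blast, blast)
  show ?thesis
    by (cases rule: uniform_rules.cases[OF assms(1)]; cases rule: uniform_rules.cases[OF assms(2)];
        insert assms(3,4); auto simp: commute commuting_pair_irrefl blue_loops_def red_loops_def)
qed

lemma fst_amalgam_lhs: "v \<in> Vs D \<Longrightarrow> c \<in> set (amalgam_lhs D v \<alpha> \<beta>) \<Longrightarrow> fst c \<in> local_gens D v"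
  using amalgam_local(1) by blast

lemma local_gens_not_commuting:
  assumes "v \<in> Vs D" "y \<in> local_gens D v" "z \<in> local_gens D v"
  shows "\<not> commuting_pair D y z"
proof
  assume "commuting_pair D y z"
  then consider (blue) v' where "v' \<in> Vs D" "blue D v'" "y = Gx v'" "z \<in> local_gens D v'"
    | (red) w where "w \<in> Vs D" "\<not> blue D w" "z = Gx w" "y \<in> local_gens D w"
    by (auto simp: commuting_pair_def blue_verts_def red_verts_def)
  then show False
  proof cases
    case blue
    then have "\<not> blue D v"
      using assms(2) by (auto simp: local_gens_def)
    then show False
      using blue assms(3) by (auto simp: local_gens_def) (metis ends_colour)
  next
    case red
    then have "blue D v"
      using assms(3) by (auto simp: local_gens_def)
    then show False
      using red assms(2) by (auto simp: local_gens_def) (metis ends_colour)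
  qed
qed

lemma surface_word_letters:
  assumes "v \<in> Vs D"
  shows "(Ga v 1, \<epsilon>) \<notin> set (surface_word D v)" "(Gb v 1, \<epsilon>) \<notin> set (surface_word D v)"
  using set_boundary_word[OF assms, of "(Ga v 1, \<epsilon>)"] set_boundary_word[OF assms, of "(Gb v 1, \<epsilon>)"]
    set_comms_down[of "(Ga v 1, \<epsilon>)" v] set_comms_down[of "(Gb v 1, \<epsilon>)" v]
  by (auto simp: surface_word_def)

lemma amalgam_lhs_freely_reduced:
  assumes "v \<in> Vs D"
  shows "successively (\<lambda>c d. \<not> (fst c = fst d \<and> snd c \<noteq> snd d)) (amalgam_lhs D v \<alpha> \<beta>)"
proof -
  let ?P = "\<lambda>c d :: ('v, 'e) gen \<times> bool. \<not> (fst c = fst d \<and> snd c \<noteq> snd d)"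
  have pos: "successively ?P w" if "\<And>c. c \<in> set w \<Longrightarrow> snd c" for w
    using that by (induction w rule: induct_list012) auto
  have boundary: "snd c \<and> (\<forall>j. fst c \<noteq> Ga v j \<and> fst c \<noteq> Gb v j)" if "c \<in> set (boundary_word D v)" for c
    using set_boundary_word[OF assms that] by auto
  have comms: "successively ?P (concat (map (\<lambda>j. comm_word (wb v j) (wa v j)) js))" for js
    by (induction js rule: induct_list012) (auto simp: comm_word_def successively_append_iff)
  have W: "successively ?P (surface_word D v)"
    unfolding surface_word_def successively_append_iff
  proof (intro conjI)
    show "successively ?P (boundary_word D v)" using boundary by (intro pos) blast
    show "successively ?P (comms_down D v)" unfolding comms_down_def by (rule comms)
    show "boundary_word D v = [] \<or> comms_down D v = [] \<or>
        \<not> (fst (last (boundary_word D v)) = fst (hd (comms_down D v)) \<and>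
          snd (last (boundary_word D v)) \<noteq> snd (hd (comms_down D v)))"
      using boundary[OF last_in_set] set_comms_down[OF hd_in_set] by metis
  qed
  have "fst c \<noteq> Ga v 1" "fst c \<noteq> Gb v 1" if "c \<in> set (surface_word D v)" for c
    using surface_word_letters[OF assms] that by (cases c; auto)+
  then have "fst (hd (surface_word D v)) \<noteq> Ga v 1" "fst (last (surface_word D v)) \<noteq> Gb v 1"
    if "surface_word D v \<noteq> []"
    using that hd_in_set last_in_set by blast+
  with W show ?thesis
    by (cases "surface_word D v = []")
      (auto simp: amalgam_lhs_def successively_Cons successively_append_iff)
qed

lemma no_short_lhs_in_long_lhs:
  assumes v: "v \<in> Vs D" "surface_word D v \<noteq> []" and eq: "amalgam_lhs D v False True = p @ [c, d] @ r"
  shows "([c, d], w) \<notin> uniform_rules D"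
proof
  have cd: "fst c \<in> local_gens D v" "fst d \<in> local_gens D v"
    using fst_amalgam_lhs[OF v(1), of _ False True] eq by auto
  have set: "set (amalgam_lhs D v False True) = {(Ga v 1, False), (Gb v 1, True)} \<union> set (surface_word D v)"
    by (auto simp: amalgam_lhs_def)
  assume "([c, d], w) \<in> uniform_rules D"
  then show False
  proof cases
    case (cancel z \<epsilon>)
    then show False
      using amalgam_lhs_freely_reduced[OF v(1), of False True] eq
      by (auto simp: successively_append_iff)
  next
    case (commute y z \<delta> \<epsilon>)
    then show False
      using cd local_gens_not_commuting[OF v(1)] by auto
  next
    case (amalgam v' \<alpha> \<beta>)
    then have c: "c = (Ga v' 1, \<alpha>)" and d: "d = (Gb v' 1, \<beta>)"
      by (auto simp: amalgam_lhs_def split: if_splits)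
    then have "v' = v"
      using cd by (auto simp: local_gens_def)
    have "c \<in> set (amalgam_lhs D v False True)" "d \<in> set (amalgam_lhs D v False True)"
      unfolding eq by simp_all
    then have "\<not> \<alpha> \<and> \<beta>"
      unfolding c d \<open>v' = v\<close> set
      using surface_word_letters(1)[OF v(1), of \<alpha>] surface_word_letters(2)[OF v(1), of \<beta>]
      by (cases \<alpha>; cases \<beta>) simp_all
    then show False
      using amalgam \<open>v' = v\<close> v(2) by (auto simp: amalgam_lhs_def)
  qed (use cd in \<open>auto simp: local_gens_def\<close>)
qed

lemma long_lhs_only_at_start:
  assumes "v \<in> Vs D" "amalgam_lhs D v False True = p @ q" "hd q = (Ga v' 1, False)" "q \<noteq> []"
  shows "p = []"
proof (rule ccontr)
  assume "p \<noteq> []"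
  then have "hd q \<in> set (tl (amalgam_lhs D v False True))"
    using assms(2,4) by auto
  then have q: "(Ga v' 1, False) \<in> set (surface_word D v)"
    using assms(3) by (auto simp: amalgam_lhs_def)
  then have "Ga v' 1 \<in> local_gens D v"
    using surface_word_local[OF assms(1)] by (metis fst_conv image_subset_iff)
  then show False
    using q surface_word_letters[OF assms(1)] by (auto simp: local_gens_def)
qed

lemma locally_confluent_rules: "locally_confluent (rules D)"
proof (rule critical_pairs_imp_locally_confluent)
  fix p u r w w'
  assume "(p @ u @ r, w) \<in> rules D" "(u, w') \<in> rules D"
  then have 1: "(p @ u @ r, w) \<in> uniform_rules D" and 2: "(u, w') \<in> uniform_rules D"
    by (simp_all add: rules_eq)
  have "p = [] \<and> r = []"
    using 1
  proof (cases rule: long_lhs)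
    case (1 c d)
    from 2 have "length u \<ge> 2"
      by (cases rule: long_lhs) (auto simp: amalgam_lhs_def)
    moreover have "length p + length u + length r = 2"
      using arg_cong[OF 1, of length] by simp
    ultimately have "length p = 0 \<and> length r = 0" by linarith
    then show ?thesis by simp
  next
    case long: (2 v)
    from 2 show ?thesis
    proof (cases rule: long_lhs)
      case (1 c d)
      then show ?thesis
        using no_short_lhs_in_long_lhs[OF long(1,2), of p c d r w'] long(3) 2 by auto
    next
      case (2 v')
      then have "hd (u @ r) = (Ga v' 1, False)" "u \<noteq> []"
        by (auto simp: amalgam_lhs_def)
      then have p: "p = []"
        using long_lhs_only_at_start[OF long(1), of p "u @ r" v'] long(3) by simp
      then have "hd (amalgam_lhs D v False True) = hd u"
        using long(3)[symmetric] \<open>u \<noteq> []\<close> by simp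
      then have "v = v'"
        using 2 by simp
      then show ?thesis
        using p long(3) 2 by simp
    qed
  qed
  then show "joinable (rules D) w (p @ w' @ r)"
    using ends_determine_rule[of u w u w'] 1 2 by (simp add: joinable_refl)
next
  fix p q r w w'
  assume "(p @ q, w) \<in> rules D" "(q @ r, w') \<in> rules D"
    and ne: "p \<noteq> []" "q \<noteq> []" "r \<noteq> []"
  then have 1: "(p @ q, w) \<in> uniform_rules D" and 2: "(q @ r, w') \<in> uniform_rules D"
    by (simp_all add: rules_eq)
  have "\<exists>c. q = [c]"
    using 2
  proof (cases rule: long_lhs)
    case (1 c d)
    then show ?thesis
      using ne by (auto simp: append_eq_Cons_conv)
  next
    case long: (2 v)
    from 1 show ?thesis
    proof (cases rule: long_lhs)
      case (1 c d)
      then show ?thesis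
        using ne by (auto simp: append_eq_Cons_conv)
    next
      case (2 v')
      have "hd q = (Ga v 1, False)"
        using arg_cong[OF long(3), of hd] ne by simp
      then show ?thesis
        using long_lhs_only_at_start[OF 2(1), of p q v] 2(3) ne by simp
    qed
  qed
  then obtain c where q: "q = [c]" by blast
  then show "joinable (rules D) (w @ r) (p @ w')"
    using overlap_joins[OF 1 2] by (simp add: joinable_iff_joins)
qed

end

section \<open>Relations that hold in a group\<close>

locale group_congruence = word_reduction eq
  for eq :: "'x gword \<Rightarrow> 'x gword \<Rightarrow> bool" (infix "\<approx>" 50) +
  assumes eq_sym: "u \<approx> v \<Longrightarrow> v \<approx> u"
    and eq_cancel: "[(z, \<epsilon>), (z, \<not> \<epsilon>)] \<approx> []"
begin

lemmas eq_trans = red_trans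
lemmas eq_at = red_at

lemma eq_inv_right: "w @ w\<^sup>- \<approx> []" and eq_inv_left: "w\<^sup>- @ w \<approx> []"
  by (intro cancel_word eq_cancel)+

lemma eq_pow_add: "letter s \<up> i @ letter s \<up> j \<approx> letter s \<up> (i + j)"
  by (intro letter_pow_add eq_cancel)

lemma eq_solve_left: "u @ v \<approx> w \<longleftrightarrow> v \<approx> u\<^sup>- @ w"
proof
  assume *: "u @ v \<approx> w"
  have "v \<approx> u\<^sup>- @ u @ v"
    by (rule eq_at[OF eq_sym[OF eq_inv_left[of u]], of _ "[]" v]) simp_all
  also have "\<dots> \<approx> u\<^sup>- @ w"
    by (rule eq_at[OF *, of _ "u\<^sup>-" "[]"]) simp_all
  finally show "v \<approx> u\<^sup>- @ w" .
next
  assume *: "v \<approx> u\<^sup>- @ w"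
  have "u @ v \<approx> u @ u\<^sup>- @ w"
    by (rule eq_at[OF *, of _ u "[]"]) simp_all
  also have "\<dots> \<approx> w"
    by (rule eq_at[OF eq_inv_right[of u], of _ "[]" w]) simp_all
  finally show "u @ v \<approx> w" .
qed

lemma eq_solve_right: "u @ v \<approx> w \<longleftrightarrow> u \<approx> w @ v\<^sup>-"
proof
  assume *: "u @ v \<approx> w"
  have "u \<approx> u @ v @ v\<^sup>-"
    by (rule eq_at[OF eq_sym[OF eq_inv_right[of v]], of _ u "[]"]) simp_all
  also have "\<dots> \<approx> w @ v\<^sup>-"
    by (rule eq_at[OF *, of _ "[]" "v\<^sup>-"]) simp_all
  finally show "u \<approx> w @ v\<^sup>-" .
next
  assume *: "u \<approx> w @ v\<^sup>-"
  have "u @ v \<approx> w @ v\<^sup>- @ v"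
    by (rule eq_at[OF *, of _ "[]" v]) simp_all
  also have "\<dots> \<approx> w"
    by (rule eq_at[OF eq_inv_left[of v], of _ w "[]"]) simp_all
  finally show "u @ v \<approx> w" .
qed

lemma eq_inv: "u \<approx> v \<Longrightarrow> u\<^sup>- \<approx> v\<^sup>-"
  using eq_solve_left[of u "[]" v] eq_solve_right[of "u\<^sup>-" v "[]"] eq_sym by auto

text \<open>
  The relation \<open>t @ v \<approx> w @ t\<close> says that conjugation by \<open>t\<close> takes \<open>v\<close> to \<open>w\<close>; for \<open>v = w\<close> it says
  that \<open>t\<close> and \<open>v\<close> commute.
\<close>

lemma conj_flip: "t @ v \<approx> w @ t \<longleftrightarrow> t\<^sup>- @ w \<approx> v @ t\<^sup>-"
proof -
  have "t @ v \<approx> w @ t \<longleftrightarrow> v \<approx> t\<^sup>- @ w @ t"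
    by (rule eq_solve_left)
  also have "v \<approx> t\<^sup>- @ w @ t \<longleftrightarrow> v @ t\<^sup>- \<approx> t\<^sup>- @ w"
    using eq_solve_right[of v "t\<^sup>-" "t\<^sup>- @ w"] by simp
  also have "\<dots> \<longleftrightarrow> t\<^sup>- @ w \<approx> v @ t\<^sup>-"
    using eq_sym by auto
  finally show ?thesis .
qed

lemma conj_inv: "t @ v \<approx> w @ t \<Longrightarrow> t @ v\<^sup>- \<approx> w\<^sup>- @ t"
proof -
  assume "t @ v \<approx> w @ t"
  then have "t\<^sup>- @ w \<approx> v @ t\<^sup>-"
    by (rule conj_flip[THEN iffD1])
  from eq_inv[OF this] have "w\<^sup>- @ t \<approx> t @ v\<^sup>-"
    by simp
  then show ?thesis by (rule eq_sym)
qed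

lemma conj_append:
  assumes "t @ v \<approx> w @ t" "t @ v' \<approx> w' @ t"
  shows "t @ v @ v' \<approx> w @ w' @ t"
proof -
  have "t @ v @ v' \<approx> w @ t @ v'"
    by (rule eq_at[OF assms(1), of _ "[]" v']) simp_all
  also have "\<dots> \<approx> w @ w' @ t"
    by (rule eq_at[OF assms(2), of _ w "[]"]) simp_all
  finally show ?thesis .
qed

lemma conj_letter_pow:
  assumes "t @ letter y \<approx> letter z @ t"
  shows "t @ letter y \<up> i \<approx> letter z \<up> i @ t"
proof -
  have "t @ [(y, \<epsilon>)] \<approx> [(z, \<epsilon>)] @ t" for \<epsilon>
    using assms conj_inv[OF assms] by (cases \<epsilon>) simp_all
  then have "t @ replicate j (y, \<epsilon>) \<approx> replicate j (z, \<epsilon>) @ t" for j \<epsilon>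
    by (induction j) (use conj_append in fastforce)+
  then show ?thesis
    by (simp add: letter_pow)
qed

lemma commute_letters:
  assumes "letter y @ letter z \<approx> letter z @ letter y"
  shows "[(y, \<delta>), (z, \<epsilon>)] \<approx> [(z, \<epsilon>), (y, \<delta>)]"
proof -
  have 1: "letter y @ [(z, \<epsilon>)] \<approx> [(z, \<epsilon>)] @ letter y"
    using assms conj_inv[OF assms] by (cases \<epsilon>) simp_all
  from conj_inv[OF eq_sym[OF this]] 1 show ?thesis
    by (cases \<delta>) (auto intro: eq_sym)
qed

end

lemma group_congruence_pres_cong:
  "group_congruence (\<lambda>u v. (u, v) \<in> pres_cong UNIV (cancellation_rules UNIV \<union> Q))"
proof unfold_locales
  fix u v p q :: "('a \<times> bool) list"
  assume "(u, v) \<in> pres_cong UNIV (cancellation_rules UNIV \<union> Q)"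
  then show "(p @ u @ q, p @ v @ q) \<in> pres_cong UNIV (cancellation_rules UNIV \<union> Q)"
    by (intro pres_cong.append) (auto intro: pres_cong.refl)
next
  fix z :: 'a and \<epsilon>
  show "([(z, \<epsilon>), (z, \<not> \<epsilon>)], []) \<in> pres_cong UNIV (cancellation_rules UNIV \<union> Q)"
    by (rule pres_cong.rel) (auto simp: cancellation_rules_def)
qed (auto intro: pres_cong.refl pres_cong.sym pres_cong.trans)

text \<open>The product \<open>p\<^sub>e \<dots> q\<^sub>e \<dots> r\<^sub>l s\<^sub>l\<close> of the surface relation, written over the alphabet.\<close>

definition boundary_product :: "('v, 'e) bundle_data \<Rightarrow> 'v \<Rightarrow> ('v, 'e) gen gword" where
  "boundary_product D v =
    concat (map (\<lambda>e. wx (\<tau> D e)) (out_edges D v)) @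
    concat (map (\<lambda>e. wx (\<iota> D e) @ wx (\<tau> D e) \<up> (- edge_int D e)) (in_edges D v)) @ loop_product D v"

text \<open>
  The surface relations can be brought into the form of the amalgam relators as soon as the fibres are
  known to be central, which is all that is assumed here.
\<close>

locale fibre_congruence = circle_bundles D + group_congruence eq
  for D :: "('v, 'e) bundle_data" and eq :: "('v, 'e) gen gword \<Rightarrow> ('v, 'e) gen gword \<Rightarrow> bool" (infix "\<approx>" 50) +
  assumes fibre_commutes: "v \<in> Vs D \<Longrightarrow> y \<in> local_gens D v \<Longrightarrow> wx v @ letter y \<approx> letter y @ wx v"
begin

lemma fibre_central:
  assumes "v \<in> Vs D" "fst ` set w \<subseteq> local_gens D v"
  shows "w @ wx v \<up> i \<approx> wx v \<up> i @ w"
proof (rule slide)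
  fix c d :: "('v, 'e) gen \<times> bool"
  assume "c \<in> set w" "d \<in> set (wx v \<up> i)"
  then show "[c, d] \<approx> [d, c]"
    using commute_letters[OF fibre_commutes, of v "fst c" "snd d" "snd c"] assms
    by (cases c) (auto simp: letter_pow intro: eq_sym)
qed

text \<open>
  The powers of \<open>x\<^sub>w\<close> contributed by the letters \<open>q\<^sub>e\<close> at a red vertex are central and add up to the twist.
\<close>

lemma boundary_product_eq:
  assumes v: "v \<in> Vs D"
  shows "boundary_product D v \<approx> wx v \<up> (- twist D v) @ boundary_word D v"
proof (cases "blue D v")
  case True
  then have "in_edges D v = []"
    using set_orders(3)[OF v] ends_colour by (metis (mono_tags, lifting) empty_Collect_eq set_empty)
  then show ?thesis
    using True by (simp add: boundary_product_def boundary_word_def twist_def \<Lambda>_def)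
next
  case False
  then have out: "out_edges D v = []"
    using set_orders(2)[OF v] ends_colour by (metis (mono_tags, lifting) empty_Collect_eq set_empty)
  have product: "concat (map (\<lambda>e. wx (\<iota> D e) @ wx (\<tau> D e) \<up> (- edge_int D e)) es) \<approx>
      wx v \<up> (- (\<Sum>e\<leftarrow>es. edge_int D e)) @ concat (map (\<lambda>e. wx (\<iota> D e)) es)"
    if "set es \<subseteq> {e \<in> Es D. \<tau> D e = v}" for es
    using that
  proof (induction es)
    case (Cons e es)
    let ?X = "\<lambda>i. wx v \<up> i" and ?u = "concat (map (\<lambda>e. wx (\<iota> D e)) es)" and ?n = "\<Sum>e\<leftarrow>es. edge_int D e"
    have local: "fst ` set (wx (\<iota> D e)) \<subseteq> local_gens D v"
      using Cons.prems by (auto simp: local_gens_def)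
    have e: "\<tau> D e = v" using Cons.prems by simp
    have "concat (map (\<lambda>e. wx (\<iota> D e) @ wx (\<tau> D e) \<up> (- edge_int D e)) (e # es)) \<approx>
        wx (\<iota> D e) @ ?X (- edge_int D e) @ ?X (- ?n) @ ?u"
      by (rule eq_at[OF Cons.IH, of _ "wx (\<iota> D e) @ ?X (- edge_int D e)" "[]"]) (use Cons.prems e in auto)
    also have "\<dots> \<approx> wx (\<iota> D e) @ ?X (- edge_int D e + - ?n) @ ?u"
      by (rule eq_at[OF eq_pow_add, of _ "wx (\<iota> D e)" _ "- edge_int D e" "- ?n" ?u]) simp_all
    also have "\<dots> \<approx> ?X (- edge_int D e + - ?n) @ wx (\<iota> D e) @ ?u"
      by (rule eq_at[OF fibre_central[OF v local, of "- edge_int D e + - ?n"], of _ "[]" ?u]) simp_all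
    finally show ?case by simp
  qed simp
  have sum: "(\<Sum>e\<leftarrow>in_edges D v. edge_int D e) = twist D v"
    using False set_orders(3,4)[OF v] by (simp add: twist_def n_red_def sum_list_distinct_conv_sum_set)
  show ?thesis
    using red_context[OF product[of "in_edges D v"], of "[]" "loop_product D v"] set_orders(3)[OF v]
    by (simp add: boundary_product_def boundary_word_def \<Omega>_def out False sum)
qed

text \<open>
  Solving \<open>P = [a\<^sub>1, b\<^sub>1] U\<close> for \<open>a\<^sub>1 b\<^sub>1\<close> gives \<open>P U\<^sup>-\<^sup>1 b\<^sub>1 a\<^sub>1\<close>, and the formal inverse of
  \<open>U = [a\<^sub>2, b\<^sub>2] \<dots> [a\<^sub>g, b\<^sub>g]\<close> is \<open>[b\<^sub>g, a\<^sub>g] \<dots> [b\<^sub>2, a\<^sub>2]\<close>.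
\<close>

lemma surface_relation_iff:
  assumes v: "v \<in> Vs D"
  shows "boundary_product D v \<approx> concat (map (\<lambda>j. comm_word (wa v j) (wb v j)) [1..<Suc (genus D v)]) \<longleftrightarrow>
    wa v 1 @ wb v 1 \<approx> wx v \<up> (- twist D v) @ surface_word D v @ wb v 1 @ wa v 1"
proof -
  let ?P = "wx v \<up> (- twist D v) @ boundary_word D v"
  have "[1..<Suc (genus D v)] = 1 # [2..<Suc (genus D v)]"
    using genus[OF v] by (simp add: upt_conv_Cons numeral_2_eq_2 del: upt_Suc)
  then have "concat (map (\<lambda>j. comm_word (wa v j) (wb v j)) [1..<Suc (genus D v)]) =
      comm_word (wa v 1) (wb v 1) @ comms_up D v"
    by (simp add: comms_up_def)
  moreover have "boundary_product D v \<approx> w \<longleftrightarrow> w \<approx> ?P" for w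
    using boundary_product_eq[OF v] by (blast intro: eq_sym eq_trans)
  ultimately have "boundary_product D v \<approx> concat (map (\<lambda>j. comm_word (wa v j) (wb v j)) [1..<Suc (genus D v)]) \<longleftrightarrow>
      wa v 1 @ wb v 1 @ (wa v 1)\<^sup>- @ (wb v 1)\<^sup>- @ comms_up D v \<approx> ?P"
    by (simp only: comm_word_def append_assoc)
  also have "\<dots> \<longleftrightarrow> wa v 1 @ wb v 1 \<approx> ?P @ ((wa v 1)\<^sup>- @ (wb v 1)\<^sup>- @ comms_up D v)\<^sup>-"
    using eq_solve_right[of "wa v 1 @ wb v 1" "(wa v 1)\<^sup>- @ (wb v 1)\<^sup>- @ comms_up D v" ?P] by simp
  also have "((wa v 1)\<^sup>- @ (wb v 1)\<^sup>- @ comms_up D v)\<^sup>- = comms_down D v @ wb v 1 @ wa v 1"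
    by (simp flip: inv_comms_down)
  finally show ?thesis
    by (simp add: surface_word_def)
qed

end

text \<open>
  The presentation of the fundamental group over the alphabet, after the elimination of \<open>p\<^sub>e\<close> and
  \<open>q\<^sub>e\<close>. It mediates between the relations of the fundamental group and the rules, which are never
  compared directly.
\<close>

locale bundle_congruence = fibre_congruence D eq
  for D :: "('v, 'e) bundle_data" and eq (infix "\<approx>" 50) +
  assumes surface: "v \<in> Vs D \<Longrightarrow>
      wa v 1 @ wb v 1 \<approx> wx v \<up> (- twist D v) @ surface_word D v @ wb v 1 @ wa v 1"
    and t_r: "l \<in> Ls D \<Longrightarrow> wt l @ wr l \<approx> wx (\<iota> D l) @ wt l"
    and t_x: "l \<in> Ls D \<Longrightarrow> wt l @ wx (\<iota> D l) \<approx> (ws l @ wx (\<iota> D l) \<up> loop_int D l) @ wt l"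
begin

text \<open>
  Each relator is the surface relation multiplied by suitable inverses, with the power of the central
  fibre collected at the left end.
\<close>

lemma amalgam_rules_hold:
  assumes v: "v \<in> Vs D"
  shows "amalgam_lhs D v \<alpha> \<beta> \<approx> wx v \<up> amalgam_twist D v \<alpha> \<beta> @ amalgam_rhs D v \<alpha> \<beta>"
proof -
  let ?n = "twist D v" and ?W = "surface_word D v"
  let ?X = "\<lambda>i. wx v \<up> i" and ?a = "wa v 1" and ?b = "wb v 1"
  note local = ab1_local[OF v] surface_word_local[OF v]
  have central: "w @ ?X i \<approx> ?X i @ w" if "fst ` set w \<subseteq> local_gens D v" for w i
    by (rule fibre_central[OF v that])
  show ?thesis
  proof (cases \<alpha>; cases \<beta>)
    assume \<alpha>: \<alpha> and \<beta>: \<beta>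
    show ?thesis
      using surface[OF v] by (simp add: amalgam_lhs_def amalgam_rhs_def amalgam_twist_def \<alpha> \<beta>)
  next
    assume \<alpha>: \<alpha> and \<beta>: "\<not> \<beta>"
    have "?X (- ?n) @ ?W @ ?b @ ?a \<approx> ?a @ ?b"
      by (rule eq_sym[OF surface[OF v]])
    then have "(?X (- ?n) @ ?W @ ?b) @ ?a @ ?b\<^sup>- \<approx> ?a"
      using eq_solve_right[of ?a ?b "?X (- ?n) @ ?W @ ?b @ ?a"] eq_sym surface[OF v] by simp
    then have "?a @ ?b\<^sup>- \<approx> ?b\<^sup>- @ ?W\<^sup>- @ ?X ?n @ ?a"
      by (subst (asm) eq_solve_left) (simp add: inv_letter_pow)
    also have "\<dots> \<approx> ?X ?n @ ?b\<^sup>- @ ?W\<^sup>- @ ?a"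
      by (rule eq_at[OF central[of "?b\<^sup>- @ ?W\<^sup>-" ?n], of _ "[]" ?a]) (use local in auto)
    finally show ?thesis
      by (simp add: amalgam_lhs_def amalgam_rhs_def amalgam_twist_def \<alpha> \<beta>)
  next
    assume \<alpha>: "\<not> \<alpha>" and \<beta>: \<beta>
    have "?a @ ?X ?n @ ?b @ ?a\<^sup>- \<approx> ?X ?n @ ?a @ ?b @ ?a\<^sup>-"
      by (rule eq_at[OF central[of ?a ?n], of _ "[]" "?b @ ?a\<^sup>-"]) (use local in auto)
    also have "\<dots> \<approx> ?X ?n @ ?X (- ?n) @ ?W @ ?b @ ?a @ ?a\<^sup>-"
      by (rule eq_at[OF surface[OF v], of _ "?X ?n" "?a\<^sup>-"]) simp_all
    also have "\<dots> \<approx> ?W @ ?b @ ?a @ ?a\<^sup>-"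
      by (rule eq_at[OF eq_pow_add[of _ ?n "- ?n"], of _ "[]" "Gx v" "?W @ ?b @ ?a @ ?a\<^sup>-"]) simp_all
    also have "\<dots> \<approx> ?W @ ?b"
      by (rule eq_at[OF eq_inv_right[of ?a], of _ "?W @ ?b" "[]"]) simp_all
    finally have "?X ?n @ ?b @ ?a\<^sup>- \<approx> ?a\<^sup>- @ ?W @ ?b"
      by (subst (asm) eq_solve_left)
    from eq_sym[OF this] show ?thesis
      by (simp add: amalgam_lhs_def amalgam_rhs_def amalgam_twist_def \<alpha> \<beta>)
  next
    assume \<alpha>: "\<not> \<alpha>" and \<beta>: "\<not> \<beta>"
    from eq_inv[OF surface[OF v]] have "?b\<^sup>- @ ?a\<^sup>- \<approx> (?a\<^sup>- @ ?b\<^sup>-) @ (?X (- ?n) @ ?W)\<^sup>-"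
      by simp
    then have "?b\<^sup>- @ ?a\<^sup>- @ ?X (- ?n) @ ?W \<approx> ?a\<^sup>- @ ?b\<^sup>-"
      using eq_solve_right[of "?b\<^sup>- @ ?a\<^sup>-" "?X (- ?n) @ ?W" "?a\<^sup>- @ ?b\<^sup>-"] by simp
    from eq_sym[OF this] have "?a\<^sup>- @ ?b\<^sup>- \<approx> ?b\<^sup>- @ ?a\<^sup>- @ ?X (- ?n) @ ?W" .
    also have "\<dots> \<approx> ?X (- ?n) @ ?b\<^sup>- @ ?a\<^sup>- @ ?W"
      by (rule eq_at[OF central[of "?b\<^sup>- @ ?a\<^sup>-" "- ?n"], of _ "[]" ?W]) (use local in auto)
    finally show ?thesis
      by (simp add: amalgam_lhs_def amalgam_rhs_def amalgam_twist_def \<alpha> \<beta>)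
  qed
qed

text \<open>
  The third relation expresses \<open>s\<^sub>l\<close> by the others: conjugation by \<open>t\<^sub>l\<close> takes \<open>r\<^sub>l\<close> to \<open>x\<close> and \<open>x\<close> to
  \<open>s\<^sub>l x\<^sup>m\<close>, hence \<open>r\<^sub>l\<^sup>-\<^sup>m x\<close> to \<open>x\<^sup>-\<^sup>m s\<^sub>l x\<^sup>m\<close>, which is \<open>s\<^sub>l\<close>.
\<close>

lemma stable_letter_conjugation:
  fixes l \<delta>
  defines "x \<equiv> Gx (\<iota> D l)" and "i \<equiv> signed_int \<delta> (loop_int D l)"
  assumes l: "l \<in> Ls D"
  shows "wt l @ [(Gr l, \<delta>)] \<approx> [(x, \<delta>)] @ wt l"
    "wt l @ [(x, \<delta>)] \<approx> ((Gs l, \<delta>) # letter x \<up> i) @ wt l"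
    "wt l @ letter (Gr l) \<up> (- i) @ [(x, \<delta>)] \<approx> [(Gs l, \<delta>)] @ wt l"
proof -
  have s_x: "[(Gs l, \<delta>)] @ letter x \<up> j \<approx> letter x \<up> j @ [(Gs l, \<delta>)]" for j
    unfolding x_def by (rule fibre_central) (use l loop_gens in auto)
  show 1: "wt l @ [(Gr l, \<delta>)] \<approx> [(x, \<delta>)] @ wt l"
    using t_r[OF l] conj_inv[OF t_r[OF l]] by (cases \<delta>) (auto simp: x_def)
  show 2: "wt l @ [(x, \<delta>)] \<approx> ((Gs l, \<delta>) # letter x \<up> i) @ wt l"
  proof (cases \<delta>)
    case True
    then show ?thesis using t_x[OF l] by (simp add: x_def i_def)
  next
    case False
    have "wt l @ [(x, \<delta>)] \<approx> letter x \<up> i @ [(Gs l, \<delta>)] @ wt l"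
      using conj_inv[OF t_x[OF l]] False by (simp add: x_def i_def inv_letter_pow)
    also have "\<dots> \<approx> [(Gs l, \<delta>)] @ letter x \<up> i @ wt l"
      by (rule eq_at[OF eq_sym[OF s_x], of _ "[]" i "wt l"]) simp_all
    finally show ?thesis by simp
  qed
  have "wt l @ letter (Gr l) \<up> (- i) @ [(x, \<delta>)] \<approx> letter x \<up> (- i) @ wt l @ [(x, \<delta>)]"
    by (rule eq_at[OF conj_letter_pow[OF t_r[OF l]], of _ "[]" "- i" "[(x, \<delta>)]"]) (simp_all add: x_def)
  also have "\<dots> \<approx> letter x \<up> (- i) @ (Gs l, \<delta>) # letter x \<up> i @ wt l"
    by (rule eq_at[OF 2, of _ "letter x \<up> (- i)" "[]"]) simp_all
  also have "\<dots> \<approx> (Gs l, \<delta>) # letter x \<up> (- i) @ letter x \<up> i @ wt l"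
    by (rule eq_at[OF eq_sym[OF s_x], of _ "[]" "- i" "letter x \<up> i @ wt l"]) simp_all
  also have "\<dots> \<approx> [(Gs l, \<delta>)] @ wt l"
    by (rule eq_at[OF eq_pow_add[of x "- i" i], of _ "[(Gs l, \<delta>)]" "wt l"]) simp_all
  finally show "wt l @ letter (Gr l) \<up> (- i) @ [(x, \<delta>)] \<approx> [(Gs l, \<delta>)] @ wt l" .
qed

lemma rules_hold:
  assumes "(u, v) \<in> uniform_rules D"
  shows "u \<approx> v"
proof -
  have loop: "l \<in> Ls D" "\<iota> D l \<in> Vs D" if "l \<in> blue_loops D \<or> l \<in> red_loops D" for l
    using that by (auto simp: blue_loops_def red_loops_def)
  from assms show ?thesis
  proof cases
    case (cancel z \<epsilon>)
    then show ?thesis by (simp add: eq_cancel)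
  next
    case (commute y z \<delta> \<epsilon>)
    then show ?thesis
      unfolding commuting_pair_def blue_verts_def red_verts_def
      by (auto intro: commute_letters fibre_commutes eq_sym[OF fibre_commutes])
  next
    case (amalgam v \<alpha> \<beta>)
    then show ?thesis by (simp add: amalgam_rules_hold)
  next
    case (blue_x_t k \<delta>)
    then show ?thesis
      using eq_sym[OF stable_letter_conjugation(1)[of k \<delta>]] loop by simp
  next
    case (blue_r_t k \<delta>)
    then show ?thesis
      using eq_sym[OF conj_flip[THEN iffD1, OF stable_letter_conjugation(1)[of k \<delta>]]] loop by simp
  next
    case (blue_s_t k \<delta>)
    then show ?thesis
      using eq_sym[OF stable_letter_conjugation(3)[of k \<delta>]] loop by simp
  next
    case (blue_x_t' k \<delta>)
    then show ?thesis
      using eq_sym[OF conj_flip[THEN iffD1, OF stable_letter_conjugation(2)[of k \<delta>]]] loop by simp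
  next
    case (red_t_x l \<delta>)
    then show ?thesis
      using conj_flip[THEN iffD1, OF stable_letter_conjugation(1)[of l \<delta>]] loop by simp
  next
    case (red_t_r l \<delta>)
    then show ?thesis
      using stable_letter_conjugation(1)[of l \<delta>] loop by simp
  next
    case (red_t_s l \<delta>)
    let ?r = "wr l \<up> (- signed_int \<delta> (loop_int D l))"
    have "u \<approx> ?r @ [(Gx (\<iota> D l), \<delta>)] @ [(Gt l, False)]"
      using red_t_s conj_flip[THEN iffD1, of "wt l" "wr l \<up> (- signed_int \<delta> (loop_int D l)) @ [(Gx (\<iota> D l), \<delta>)]" "[(Gs l, \<delta>)]"]
        stable_letter_conjugation(3)[of l \<delta>] loop by simp
    also have "\<dots> \<approx> [(Gx (\<iota> D l), \<delta>)] @ ?r @ [(Gt l, False)]"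
    proof -
      have l: "l \<in> Ls D" "\<iota> D l \<in> Vs D"
        using red_t_s loop by auto
      have "fst ` set ?r \<subseteq> {Gr l}"
        by (rule fst_set_letter_pow)
      also have "\<dots> \<subseteq> local_gens D (\<iota> D l)"
        using loop_gens(5)[OF l(1)] by simp
      finally have "fst ` set ?r \<subseteq> local_gens D (\<iota> D l)" .
      from fibre_central[OF l(2) this, of "signed_int \<delta> 1"]
      have "?r @ [(Gx (\<iota> D l), \<delta>)] \<approx> [(Gx (\<iota> D l), \<delta>)] @ ?r"
        unfolding letter_pow_unit .
      then show ?thesis
        by (rule eq_at[of _ _ _ "[]" "[(Gt l, False)]"]) simp_all
    qed
    finally show ?thesis
      using red_t_s by simp
  next
    case (red_t_x' l \<delta>)
    let ?x = "wx (\<iota> D l) \<up> signed_int \<delta> (loop_int D l)"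
    have "u \<approx> [(Gs l, \<delta>)] @ ?x @ wt l"
      using red_t_x' stable_letter_conjugation(2)[of l \<delta>] loop by simp
    also have "\<dots> \<approx> ?x @ [(Gs l, \<delta>)] @ wt l"
    proof -
      have "[(Gs l, \<delta>)] @ ?x \<approx> ?x @ [(Gs l, \<delta>)]"
        by (rule fibre_central) (use red_t_x' loop loop_gens in auto)
      then show ?thesis
        by (rule eq_at[of _ _ _ "[]" "wt l"]) simp_all
    qed
    finally show ?thesis
      using red_t_x' by simp
  qed
qed

end

section \<open>The presentation\<close>

text \<open>
  The Tietze transformation that replaces \<open>p\<^sub>e\<close> and \<open>q\<^sub>e\<close> by the words over the alphabet to which the
  gluing relations equate them.
\<close>

fun eliminate_pq :: "('v, 'e) bundle_data \<Rightarrow> ('v, 'e) gen \<Rightarrow> ('v, 'e) gen gword" where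
  "eliminate_pq D (Gp e) = wx (\<tau> D e)"
| "eliminate_pq D (Gq e) = wx (\<iota> D e) @ wx (\<tau> D e) \<up> (- edge_int D e)"
| "eliminate_pq D z = letter z"

definition eliminate ::
    "('v, 'e) bundle_data \<Rightarrow> ('v, 'e) gen gword \<Rightarrow> ('v, 'e) gen gword" where
  "eliminate D w = concat (map (\<lambda>(z, \<epsilon>). if \<epsilon> then eliminate_pq D z else (eliminate_pq D z)\<^sup>-) w)"

lemma eliminate_simps [simp]:
  "eliminate D [] = []"
  "eliminate D ((z, \<epsilon>) # w) = (if \<epsilon> then eliminate_pq D z else (eliminate_pq D z)\<^sup>-) @ eliminate D w"
  "eliminate D (u @ v) = eliminate D u @ eliminate D v"
  by (simp_all add: eliminate_def)

lemma eliminate_concat: "eliminate D (concat us) = concat (map (eliminate D) us)"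
  by (induction us) simp_all

lemma eliminate_id:
  assumes "\<And>z. z \<in> fst ` set w \<Longrightarrow> eliminate_pq D z = letter z"
  shows "eliminate D w = w"
  using assms by (induction w) (auto split: if_splits)

lemma eliminate_letter_pow: "eliminate_pq D z = letter z \<Longrightarrow> eliminate D (letter z \<up> i) = letter z \<up> i"
  by (rule eliminate_id) (auto simp: letter_pow)

lemma eliminate_pq_S_gens: "z \<in> S_gens D \<Longrightarrow> eliminate_pq D z = letter z"
  by (auto simp: S_gens_def)

text \<open>
  The isomorphism sends a class of words over \<open>A\<close> to the class over \<open>B\<close> that contains it; the two
  assumptions on the congruences make this map well defined, injective and onto.
\<close>

lemma monoid_presentation_of_presented_monoid:
  assumes A: "A \<subseteq> B"
    and cong: "\<And>u v. u \<in> lists A \<Longrightarrow> v \<in> lists A \<Longrightarrow> (u, v) \<in> pres_cong A R \<longleftrightarrow> (u, v) \<in> pres_cong B Q"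
    and onto: "\<And>u. u \<in> lists B \<Longrightarrow> \<exists>v \<in> lists A. (u, v) \<in> pres_cong B Q"
    and word_value: "\<And>w. w \<in> lists A \<Longrightarrow> word_value (presented_monoid B Q) \<phi> w = pres_cong B Q `` {w}"
  shows "is_monoid_presentation (presented_monoid B Q) A \<phi> R"
proof -
  define h where "h C = pres_cong B Q `` C" for C
  have lists: "w \<in> lists B" if "w \<in> lists A" for w
    using that A by (auto simp: in_lists_conv_set)
  have h: "h (pres_cong A R `` {w}) = pres_cong B Q `` {w}" if "w \<in> lists A" for w
  proof -
    have "(w, u) \<in> pres_cong B Q" if "(w, u) \<in> pres_cong A R" for u
      using that cong pres_cong_lists[OF that] by blast
    then have "h (pres_cong A R `` {w}) \<subseteq> pres_cong B Q `` {w}"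
      unfolding h_def by (blast intro: pres_cong.trans)
    moreover have "pres_cong B Q `` {w} \<subseteq> h (pres_cong A R `` {w})"
      unfolding h_def using pres_cong.refl[OF that, of R] by blast
    ultimately show ?thesis by blast
  qed
  have class_eq: "pres_cong C T `` {u} = pres_cong C T `` {v} \<longleftrightarrow> (u, v) \<in> pres_cong C T"
    if "u \<in> lists C" "v \<in> lists C" for C T and u v :: "'a list"
    using that by (intro eq_equiv_class_iff[OF equiv_pres_cong])
  have h_carrier: "h ` carrier (presented_monoid A R) \<subseteq> carrier (presented_monoid B Q)"
    unfolding carrier_presented_monoid
  proof (intro image_subsetI, elim imageE)
    fix x w
    assume "x = pres_cong A R `` {w}" "w \<in> lists A"
    then show "h x \<in> (\<lambda>w. pres_cong B Q `` {w}) ` lists B"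
      using h[of w] lists[of w] by (metis imageI)
  qed
  have "h \<in> iso (presented_monoid A R) (presented_monoid B Q)"
  proof (rule isoI)
    show "h \<in> hom (presented_monoid A R) (presented_monoid B Q)"
    proof (rule homI)
      fix x
      assume "x \<in> carrier (presented_monoid A R)"
      then show "h x \<in> carrier (presented_monoid B Q)"
        using h_carrier by blast
    next
      fix x y
      assume "x \<in> carrier (presented_monoid A R)" "y \<in> carrier (presented_monoid A R)"
      then obtain u v where "u \<in> lists A" "x = pres_cong A R `` {u}" "v \<in> lists A" "y = pres_cong A R `` {v}"
        unfolding carrier_presented_monoid by blast
      then show "h (x \<otimes>\<^bsub>presented_monoid A R\<^esub> y) = h x \<otimes>\<^bsub>presented_monoid B Q\<^esub> h y"
        by (simp add: pres_class_mult h lists)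
    qed
    have "inj_on h (carrier (presented_monoid A R))"
      unfolding carrier_presented_monoid
      using cong lists by (auto simp: inj_on_def h class_eq)
    moreover have "carrier (presented_monoid B Q) \<subseteq> h ` carrier (presented_monoid A R)"
    proof
      fix g
      assume "g \<in> carrier (presented_monoid B Q)"
      then obtain u where u: "u \<in> lists B" "g = pres_cong B Q `` {u}"
        by (auto simp: carrier_presented_monoid)
      then obtain v where v: "v \<in> lists A" "(u, v) \<in> pres_cong B Q"
        using onto by blast
      then have "g = h (pres_cong A R `` {v})"
        using u lists class_eq h by simp
      then show "g \<in> h ` carrier (presented_monoid A R)"
        using v by (auto simp: carrier_presented_monoid)
    qed
    ultimately show "bij_betw h (carrier (presented_monoid A R)) (carrier (presented_monoid B Q))"
      using h_carrier by (auto simp: bij_betw_def)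
  qed
  then show ?thesis
    unfolding is_monoid_presentation_def using h word_value by auto
qed

context circle_bundles
begin

definition pi1_congruent :: "('v, 'e) gen gword \<Rightarrow> ('v, 'e) gen gword \<Rightarrow> bool" where
  "pi1_congruent u v \<longleftrightarrow> (u, v) \<in> pres_cong UNIV (cancellation_rules UNIV \<union> pi1_relations D)"

definition rule_congruent :: "('v, 'e) gen gword \<Rightarrow> ('v, 'e) gen gword \<Rightarrow> bool" where
  "rule_congruent u v \<longleftrightarrow> (u, v) \<in> pres_cong UNIV (cancellation_rules UNIV \<union> rules D)"

lemma pi1_congruent_rel: "(u, v) \<in> pi1_relations D \<Longrightarrow> pi1_congruent u v"
  unfolding pi1_congruent_def by (rule pres_cong.rel) auto

lemma rule_congruent_rel: "(u, v) \<in> uniform_rules D \<Longrightarrow> rule_congruent u v"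
  unfolding rule_congruent_def by (rule pres_cong.rel) (auto simp: rules_eq)

lemma group_congruence_pi1_congruent: "group_congruence pi1_congruent"
  using group_congruence_pres_cong[of "pi1_relations D"] by (simp add: pi1_congruent_def[abs_def])

lemma group_congruence_rule_congruent: "group_congruence rule_congruent"
  using group_congruence_pres_cong[of "rules D"] by (simp add: rule_congruent_def[abs_def])

lemma bundle_congruence_rules: "bundle_congruence D rule_congruent"
proof -
  interpret group_congruence rule_congruent by (rule group_congruence_rule_congruent)
  note rule = rule_congruent_rel
  interpret fibre_congruence D rule_congruent
  proof unfold_locales
    fix v y
    assume "v \<in> Vs D" "y \<in> local_gens D v"
    then show "rule_congruent (wx v @ letter y) (letter y @ wx v)"
      using rule[OF uniform_rules.commute, of "Gx v" y True True]
        eq_sym[OF rule[OF uniform_rules.commute, of y "Gx v" True True]] commuting_pairI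
      by (cases "blue D v") simp_all
  qed
  show ?thesis
  proof unfold_locales
    fix v
    assume "v \<in> Vs D"
    from rule[OF uniform_rules.amalgam[OF this, of True True]]
    show "rule_congruent (wa v 1 @ wb v 1) (wx v \<up> (- twist D v) @ surface_word D v @ wb v 1 @ wa v 1)"
      by (simp add: amalgam_lhs_def amalgam_rhs_def amalgam_twist_def)
  next
    fix l
    assume l: "l \<in> Ls D"
    then have colour: "l \<in> blue_loops D \<or> l \<in> red_loops D"
      by (auto simp: blue_loops_def red_loops_def)
    then show "rule_congruent (wt l @ wr l) (wx (\<iota> D l) @ wt l)"
      using eq_sym[OF rule[OF uniform_rules.blue_x_t, of l True]]
        rule[OF uniform_rules.red_t_r, of l True] by auto
    from colour show "rule_congruent (wt l @ wx (\<iota> D l)) ((ws l @ wx (\<iota> D l) \<up> loop_int D l) @ wt l)"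
    proof
      assume "l \<in> blue_loops D"
      from eq_sym[OF rule[OF uniform_rules.blue_x_t'[OF this, of True]]]
      have "rule_congruent ((wt l)\<^sup>- @ ws l @ wx (\<iota> D l) \<up> loop_int D l) (wx (\<iota> D l) @ (wt l)\<^sup>-)"
        by simp
      then show ?thesis
        using conj_flip[of "wt l" "wx (\<iota> D l)" "ws l @ wx (\<iota> D l) \<up> loop_int D l"] by simp
    next
      assume "l \<in> red_loops D"
      from rule[OF uniform_rules.red_t_x'[OF this, of True]]
      have "rule_congruent (wt l @ wx (\<iota> D l)) (wx (\<iota> D l) \<up> loop_int D l @ ws l @ wt l)"
        by simp
      also have "rule_congruent (wx (\<iota> D l) \<up> loop_int D l @ ws l @ wt l)
          (ws l @ wx (\<iota> D l) \<up> loop_int D l @ wt l)"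
        by (rule eq_at[OF eq_sym[OF fibre_central[of "\<iota> D l" "ws l"]], of _ "[]" "loop_int D l" "wt l"])
          (use l loop_gens in auto)
      finally show ?thesis by simp
    qed
  qed
qed

lemma pi1_relationsI:
  "v \<in> Vs D \<Longrightarrow> (u, w) \<in> vertex_relations D v \<Longrightarrow> (u, w) \<in> pi1_relations D"
  "(u, w) \<in> gluing_relations D \<Longrightarrow> (u, w) \<in> pi1_relations D"
  by (auto simp: pi1_relations_def)

lemma pi1_gluing:
  "e \<in> Es D \<Longrightarrow> pi1_congruent (wx (\<iota> D e)) (wq e @ wx (\<tau> D e) \<up> edge_int D e)"
  "e \<in> Es D \<Longrightarrow> pi1_congruent (wp e) (wx (\<tau> D e))"
  "l \<in> Ls D \<Longrightarrow> pi1_congruent (wt l @ wx (\<iota> D l) @ (wt l)\<^sup>-) (ws l @ wx (\<iota> D l) \<up> loop_int D l)"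
  "l \<in> Ls D \<Longrightarrow> pi1_congruent (wt l @ wr l @ (wt l)\<^sup>-) (wx (\<iota> D l))"
  by (rule pi1_congruent_rel, rule pi1_relationsI(2), unfold gluing_relations_def, blast)+

lemma pi1_eliminate_pq:
  assumes "z \<in> pi1_gens D"
  shows "pi1_congruent (letter z) (eliminate_pq D z)"
proof -
  interpret group_congruence pi1_congruent by (rule group_congruence_pi1_congruent)
  have q: "pi1_congruent (wq e) (eliminate_pq D (Gq e))" if "e \<in> Es D" for e
    using eq_solve_right[of "wq e" "wx (\<tau> D e) \<up> edge_int D e" "wx (\<iota> D e)"] eq_sym[OF pi1_gluing(1)[OF that]]
    by (simp add: inv_letter_pow)
  show ?thesis
    using assms q pi1_gluing(2)
    by (cases z) (auto simp: pi1_gens_def surface_gens_def)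
qed

lemma pi1_eliminate:
  assumes "w \<in> lists (signed_letters (pi1_gens D))"
  shows "pi1_congruent w (eliminate D w)"
  using assms
proof (induction w)
  interpret group_congruence pi1_congruent by (rule group_congruence_pi1_congruent)
  case (Cons c w)
  then have "pi1_congruent [c] (eliminate D [c])"
    using pi1_eliminate_pq[of "fst c"] eq_inv[OF pi1_eliminate_pq[of "fst c"]]
    by (cases c) (auto simp: signed_letters_def)
  from red_append[OF this Cons.IH] show ?case
    by (cases c) simp
qed (simp add: pi1_congruent_def pres_cong.refl)

lemma surface_gens_pi1: "v \<in> Vs D \<Longrightarrow> surface_gens D v \<subseteq> pi1_gens D"
  by (auto simp: pi1_gens_def)

lemma set_loop_product:
  assumes "v \<in> Vs D"
  shows "fst ` set (loop_product D v) \<subseteq> Gr ` {l \<in> Ls D. \<iota> D l = v} \<union> Gs ` {l \<in> Ls D. \<iota> D l = v}"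
  using set_orders(1)[OF assms] by (auto simp: loop_product_def)

lemma pi1_relations_lists:
  "pi1_relations D \<subseteq> lists (signed_letters (pi1_gens D)) \<times> lists (signed_letters (pi1_gens D))"
proof -
  have pow: "fst ` set (letter s \<up> k) \<subseteq> X" if "s \<in> X" for s :: "('v, 'e) gen" and X k
    by (rule order_trans[OF fst_set_letter_pow]) (use that in simp)
  have fibre: "Gx v \<in> pi1_gens D" if "v \<in> Vs D" for v
    using that by (auto simp: pi1_gens_def)
  have edge: "Gp e \<in> pi1_gens D" "Gq e \<in> pi1_gens D" if "e \<in> Es D" for e
    using that by (force simp: pi1_gens_def surface_gens_def)+
  have loop: "Gr l \<in> pi1_gens D" "Gs l \<in> pi1_gens D" "Gt l \<in> pi1_gens D" if "l \<in> Ls D" for l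
    using that by (force simp: pi1_gens_def surface_gens_def)+
  have ab: "Ga v j \<in> pi1_gens D" "Gb v j \<in> pi1_gens D" if "v \<in> Vs D" "1 \<le> j" "j \<le> genus D v" for v j
    using that by (force simp: pi1_gens_def surface_gens_def)+
  have vertex: "fst ` set u \<subseteq> pi1_gens D \<and> fst ` set w \<subseteq> pi1_gens D"
    if "v \<in> Vs D" "(u, w) \<in> vertex_relations D v" for u w v
    using that(2) unfolding vertex_relations_def
  proof (elim UnE)
    assume uw: "(u, w) \<in> {(concat (map wp (out_edges D v)) @ concat (map wq (in_edges D v)) @ loop_product D v,
       concat (map (\<lambda>j. comm_word (wa v j) (wb v j)) [1..<Suc (genus D v)]))}"
    have "fst ` set (loop_product D v) \<subseteq> pi1_gens D"
      by (rule order_trans[OF set_loop_product[OF that(1)]]) (use loop in auto)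
    then have "fst ` set u \<subseteq> pi1_gens D"
      using uw set_orders(2,3)[OF that(1)] edge by (auto simp: image_Un)
    moreover have "fst ` set w \<subseteq> pi1_gens D"
      using uw ab[OF that(1)] by (auto simp: comm_word_def simp del: upt_Suc)
    ultimately show ?thesis by simp
  next
    assume "(u, w) \<in> {(wx v @ letter y, letter y @ wx v) | y. y \<in> surface_gens D v}"
    then show ?thesis
      using surface_gens_pi1[OF that(1)] fibre[OF that(1)] by auto
  qed
  have gluing: "fst ` set u \<subseteq> pi1_gens D \<and> fst ` set w \<subseteq> pi1_gens D"
    if "(u, w) \<in> gluing_relations D" for u w
    using that pow fibre edge loop unfolding gluing_relations_def
    by (elim UnE CollectE exE conjE) (simp_all add: image_Un)
  show ?thesis
    by (intro subrelI, unfold mem_Sigma_iff in_lists_signed_letters pi1_relations_def)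
      (use vertex gluing in blast)
qed

text \<open>
  Adjacent fibres commute because the fibre at the blue end commutes with \<open>p\<^sub>e\<close>, which is the fibre at
  the red end.
\<close>

lemma fibre_congruence_pi1: "fibre_congruence D pi1_congruent"
proof -
  interpret group_congruence pi1_congruent by (rule group_congruence_pi1_congruent)
  have surface: "pi1_congruent (wx v @ letter y) (letter y @ wx v)" if "v \<in> Vs D" "y \<in> surface_gens D v" for v y
    by (rule pi1_congruent_rel, rule pi1_relationsI(1)[OF that(1)]) (use that(2) in \<open>auto simp: vertex_relations_def\<close>)
  have edge: "pi1_congruent (wx (\<iota> D e) @ wx (\<tau> D e)) (wx (\<tau> D e) @ wx (\<iota> D e))" if e: "e \<in> Es D" for e
  proof -
    have "pi1_congruent (wx (\<iota> D e) @ wx (\<tau> D e)) (wx (\<iota> D e) @ wp e)"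
      by (rule red_append[OF red_refl eq_sym[OF pi1_gluing(2)[OF e]]])
    also have "pi1_congruent (wx (\<iota> D e) @ wp e) (wp e @ wx (\<iota> D e))"
      by (rule surface) (use e in \<open>auto simp: surface_gens_def\<close>)
    also have "pi1_congruent (wp e @ wx (\<iota> D e)) (wx (\<tau> D e) @ wx (\<iota> D e))"
      by (rule red_append[OF pi1_gluing(2)[OF e] red_refl])
    finally show ?thesis .
  qed
  show ?thesis
  proof unfold_locales
    fix v y
    assume v: "v \<in> Vs D" and "y \<in> local_gens D v"
    then consider "y \<in> surface_gens D v" | e where "e \<in> Es D" "\<iota> D e = v" "y = Gx (\<tau> D e)"
      | e where "e \<in> Es D" "\<tau> D e = v" "y = Gx (\<iota> D e)"
      by (auto simp: local_gens_def surface_gens_def)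
    then show "pi1_congruent (wx v @ letter y) (letter y @ wx v)"
      using surface[OF v] edge eq_sym[OF edge] by cases auto
  qed
qed

lemma eliminate_surface_relation:
  assumes "v \<in> Vs D"
  shows "eliminate D (concat (map wp (out_edges D v)) @ concat (map wq (in_edges D v)) @ loop_product D v) =
    boundary_product D v"
proof -
  have "eliminate D (loop_product D v) = loop_product D v"
    by (rule eliminate_id) (use set_loop_product[OF assms] in auto)
  then show ?thesis
    by (simp only: boundary_product_def eliminate_concat eliminate_simps(3) map_map comp_def) simp
qed

lemma bundle_congruence_pi1: "bundle_congruence D pi1_congruent"
proof -
  interpret fibre_congruence D pi1_congruent by (rule fibre_congruence_pi1)
  show ?thesis
  proof unfold_locales
    fix v
    assume v: "v \<in> Vs D"
    let ?u = "concat (map wp (out_edges D v)) @ concat (map wq (in_edges D v)) @ loop_product D v"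
    let ?w = "concat (map (\<lambda>j. comm_word (wa v j) (wb v j)) [1..<Suc (genus D v)])"
    have rel: "(?u, ?w) \<in> pi1_relations D"
      by (rule pi1_relationsI(1)[OF v]) (simp add: vertex_relations_def)
    then have "?u \<in> lists (signed_letters (pi1_gens D))"
      using pi1_relations_lists by blast
    from pi1_eliminate[OF this] have "pi1_congruent ?u (boundary_product D v)"
      unfolding eliminate_surface_relation[OF v] .
    then have "pi1_congruent (boundary_product D v) ?w"
      using eq_sym eq_trans pi1_congruent_rel[OF rel] by blast
    then show "pi1_congruent (wa v 1 @ wb v 1) (wx v \<up> (- twist D v) @ surface_word D v @ wb v 1 @ wa v 1)"
      using surface_relation_iff[OF v] by blast
  next
    fix l
    assume l: "l \<in> Ls D"
    show "pi1_congruent (wt l @ wr l) (wx (\<iota> D l) @ wt l)"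
      using eq_solve_right[of "wt l @ wr l" "(wt l)\<^sup>-" "wx (\<iota> D l)"] pi1_gluing(4)[OF l] by simp
    show "pi1_congruent (wt l @ wx (\<iota> D l)) ((ws l @ wx (\<iota> D l) \<up> loop_int D l) @ wt l)"
      using eq_solve_right[of "wt l @ wx (\<iota> D l)" "(wt l)\<^sup>-" "ws l @ wx (\<iota> D l) \<up> loop_int D l"]
        pi1_gluing(3)[OF l] by simp
  qed
qed

lemma eliminate_pi1_relations:
  assumes "(u, w) \<in> pi1_relations D"
  shows "rule_congruent (eliminate D u) (eliminate D w)"
proof -
  interpret bundle_congruence D rule_congruent by (rule bundle_congruence_rules)
  have fibre: "eliminate D (wx v \<up> i) = wx v \<up> i" for v i
    by (rule eliminate_letter_pow) simp
  consider (surface) v where "v \<in> Vs D" "u = concat (map wp (out_edges D v)) @ concat (map wq (in_edges D v)) @ loop_product D v"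
      "w = concat (map (\<lambda>j. comm_word (wa v j) (wb v j)) [1..<Suc (genus D v)])"
    | (commute) v y where "v \<in> Vs D" "y \<in> surface_gens D v" "u = wx v @ letter y" "w = letter y @ wx v"
    | (gluing) "(u, w) \<in> gluing_relations D"
    using assms unfolding pi1_relations_def vertex_relations_def by blast
  then show ?thesis
  proof cases
    case surface
    have "eliminate D w = w"
      unfolding surface by (rule eliminate_id) (auto simp: comm_word_def simp del: upt_Suc)
    then show ?thesis
      using surface_relation_iff[OF surface(1)] bundle_congruence.surface[OF bundle_congruence_rules surface(1)]
        eliminate_surface_relation[OF surface(1)] surface by simp
  next
    case commute
    \<comment> \<open>Only \<open>q\<^sub>e\<close> is not eliminated to a single letter.\<close>
    have "rule_congruent (wx v @ eliminate_pq D y) (eliminate_pq D y @ wx v)"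
    proof (cases "\<exists>e. y = Gq e")
      case True
      then obtain e where e: "y = Gq e" "e \<in> Es D" "\<tau> D e = v"
        using commute(2) by (auto simp: surface_gens_def)
      have "rule_congruent (wx v @ wx (\<iota> D e)) (wx (\<iota> D e) @ wx v)"
        by (rule fibre_commutes) (use e in \<open>auto simp: local_gens_def\<close>)
      moreover have "rule_congruent (wx v @ wx v \<up> i) (wx v \<up> i @ wx v)" for i
        by (rule conj_letter_pow) simp
      ultimately show ?thesis
        using e conj_append[of "wx v" "wx (\<iota> D e)" "wx (\<iota> D e)" "wx v \<up> (- edge_int D e)"] by simp
    next
      case False
      then have "\<exists>z \<in> local_gens D v. eliminate_pq D y = letter z"
        using commute(2) by (auto simp: surface_gens_def local_gens_def)
      then show ?thesis
        using fibre_commutes[OF commute(1)] by auto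
    qed
    then show ?thesis
      using commute by simp
  next
    case gluing
    then consider e where "e \<in> Es D" "u = wx (\<iota> D e)" "w = wq e @ wx (\<tau> D e) \<up> edge_int D e"
      | e where "e \<in> Es D" "u = wp e" "w = wx (\<tau> D e)"
      | l where "l \<in> Ls D" "u = wt l @ wx (\<iota> D l) @ (wt l)\<^sup>-" "w = ws l @ wx (\<iota> D l) \<up> loop_int D l"
      | l where "l \<in> Ls D" "u = wt l @ wr l @ (wt l)\<^sup>-" "w = wx (\<iota> D l)"
      unfolding gluing_relations_def by blast
    then show ?thesis
    proof cases
      case (1 e)
      have "rule_congruent (wx (\<iota> D e) @ wx (\<tau> D e) \<up> (- edge_int D e) @ wx (\<tau> D e) \<up> edge_int D e) (wx (\<iota> D e))"
        by (rule eq_at[OF eq_pow_add[of _ "- edge_int D e" "edge_int D e"], of _ "wx (\<iota> D e)" _ "[]"]) simp_all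
      then show ?thesis
        using 1 eq_sym by (simp add: fibre)
    next
      case (3 l)
      then show ?thesis
        using eq_solve_right[of "wt l @ wx (\<iota> D l)" "(wt l)\<^sup>-" "ws l @ wx (\<iota> D l) \<up> loop_int D l"]
          t_x[of l] by (simp add: fibre)
    next
      case (4 l)
      then show ?thesis
        using eq_solve_right[of "wt l @ wr l" "(wt l)\<^sup>-" "wx (\<iota> D l)"] t_r[of l] by simp
    qed simp
  qed
qed

lemma eliminate_pi1_congruent:
  assumes "pi1_congruent u v"
  shows "rule_congruent (eliminate D u) (eliminate D v)"
proof -
  interpret group_congruence rule_congruent by (rule group_congruence_rule_congruent)
  from assms show ?thesis
    unfolding pi1_congruent_def
  proof induction
    case (rel u v)
    then consider "(u, v) \<in> pi1_relations D" | z \<epsilon> where "u = [(z, \<epsilon>), (z, \<not> \<epsilon>)]" "v = []"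
      by (auto simp: cancellation_rules_def)
    then show ?case
      using eliminate_pi1_relations eq_inv_left eq_inv_right by cases auto
  next
    case (append u v u' v')
    then show ?case by (simp add: red_append)
  qed (auto intro: eq_sym eq_trans)
qed

abbreviation pi1_cong :: "(('v, 'e) gen gword \<times> ('v, 'e) gen gword) set" where
  "pi1_cong \<equiv> pres_cong (signed_letters (pi1_gens D)) (cancellation_rules (pi1_gens D) \<union> pi1_relations D)"

lemma alphabet_subset: "alphabet D \<subseteq> signed_letters (pi1_gens D)"
  by (force simp: alphabet_def signed_letters_def S_gens_def pi1_gens_def surface_gens_def)

lemma alphabet_lists: "u \<in> lists (alphabet D) \<Longrightarrow> u \<in> lists (signed_letters (pi1_gens D))"
  using alphabet_subset by (auto simp: in_lists_conv_set)

lemma pi1_cong_iff: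
  assumes "u \<in> lists (signed_letters (pi1_gens D))" "v \<in> lists (signed_letters (pi1_gens D))"
  shows "(u, v) \<in> pi1_cong \<longleftrightarrow> pi1_congruent u v"
proof
  assume "(u, v) \<in> pi1_cong"
  then show "pi1_congruent u v"
    unfolding pi1_congruent_def
    by (rule pres_cong_mono) (auto simp: cancellation_rules_def intro!: pres_cong.rel)
next
  assume "pi1_congruent u v"
  then show "(u, v) \<in> pi1_cong"
    unfolding pi1_congruent_def by (rule pres_cong_UNIV_imp_pres_cong[OF pi1_relations_lists _ assms])
qed

text \<open>
  The rules are relations of the fundamental group, and the elimination of \<open>p\<^sub>e\<close> and \<open>q\<^sub>e\<close>, which
  fixes the words over the alphabet, turns relations of the fundamental group into consequences of
  the rules.
\<close>

lemma rules_cong_iff_pi1_cong: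
  assumes u: "u \<in> lists (alphabet D)" and v: "v \<in> lists (alphabet D)"
  shows "(u, v) \<in> pres_cong (alphabet D) (rules D) \<longleftrightarrow> (u, v) \<in> pi1_cong"
proof
  have rule: "(u, v) \<in> pi1_cong" if "(u, v) \<in> rules D" for u v
  proof -
    have "u \<in> lists (alphabet D)" "v \<in> lists (alphabet D)"
      using rules_subset that by blast+
    moreover have "pi1_congruent u v"
      using bundle_congruence.rules_hold[OF bundle_congruence_pi1] that by (simp add: rules_eq)
    ultimately show ?thesis
      using pi1_cong_iff alphabet_lists by simp
  qed
  assume "(u, v) \<in> pres_cong (alphabet D) (rules D)"
  then show "(u, v) \<in> pi1_cong"
    by (rule pres_cong_mono) (use rule alphabet_subset in auto)
next
  have fixed: "eliminate D w = w" if "w \<in> lists (alphabet D)" for w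
    using that by (intro eliminate_id eliminate_pq_S_gens) (auto simp: alphabet_def in_lists_signed_letters)
  have "cancellation_rules (S_gens D) \<union> rules D = rules D"
    by (auto simp: rules_def)
  moreover assume "(u, v) \<in> pi1_cong"
  then have "rule_congruent u v"
    using eliminate_pi1_congruent[of u v] pi1_cong_iff[of u v] alphabet_lists fixed u v by simp
  ultimately show "(u, v) \<in> pres_cong (alphabet D) (rules D)"
    using pres_cong_UNIV_imp_pres_cong[of "rules D" "S_gens D" u v] rules_subset u v
    by (simp add: rule_congruent_def alphabet_def)
qed

lemma eliminate_alphabet:
  assumes "u \<in> lists (signed_letters (pi1_gens D))"
  shows "eliminate D u \<in> lists (alphabet D)"
proof -
  have "fst ` set (eliminate_pq D z) \<subseteq> S_gens D" if "z \<in> pi1_gens D" for z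
  proof -
    have pow: "fst ` set (wx v \<up> i) \<subseteq> S_gens D" if "v \<in> Vs D" for v i
      by (rule order_trans[OF fst_set_letter_pow]) (use Gx_in_S_gens[OF that] in simp)
    show ?thesis
    proof (cases z)
      case (Gq e)
      then have "e \<in> Es D"
        using that by (auto simp: pi1_gens_def surface_gens_def)
      then show ?thesis
        using Gq pow[of "\<tau> D e" "- edge_int D e"] Gx_in_S_gens by (simp add: image_Un)
    qed (use that in \<open>auto simp: pi1_gens_def surface_gens_def S_gens_def\<close>)
  qed
  then show ?thesis
    using assms unfolding alphabet_def in_lists_signed_letters
  proof (induction u)
    case (Cons c u)
    then show ?case by (cases c) (simp add: image_Un)
  qed simp
qed

lemma pi1_cong_eliminate:
  assumes "u \<in> lists (signed_letters (pi1_gens D))"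
  shows "(u, eliminate D u) \<in> pi1_cong"
  using assms pi1_eliminate pi1_cong_iff alphabet_lists eliminate_alphabet by simp

lemma word_value_pi1:
  "w \<in> lists (alphabet D) \<Longrightarrow> word_value (pi1 D) (pi1_letter D) w = pi1_cong `` {w}"
  unfolding pi1_def pi1_letter_def by (intro word_value_presented_group alphabet_lists)

end

theorem theorem2:
  fixes D :: "('v, 'e) bundle_data"
  assumes "fin_digraph (base D)"
    and "connected (base D)"
    and "undirected_tree (remove_loops (base D))"
    and "alternating_colouring D"
    and "valid_orders D"
    and "\<And>v. v \<in> verts (base D) \<Longrightarrow> genus D v \<ge> 1"
  shows "finite_complete_rewriting_system (pi1 D) (alphabet D) (pi1_letter D) (rules D)"
proof -
  have "circle_bundles D"
    using assms by (intro circle_bundles.intro)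
  then interpret circle_bundle_rewriting D
    by (rule circle_bundle_rewriting.intro)
  let ?A = "alphabet D" and ?G = "pi1 D" and ?\<phi> = "pi1_letter D" and ?R = "rules D"
  have carrier: "carrier ?G = (\<lambda>w. pi1_cong `` {w}) ` lists (signed_letters (pi1_gens D))"
    by (simp add: pi1_def presented_group_def carrier_presented_monoid)
  have class_eq: "pi1_cong `` {u} = pi1_cong `` {v} \<longleftrightarrow> (u, v) \<in> pi1_cong"
    if "u \<in> lists (signed_letters (pi1_gens D))" "v \<in> lists (signed_letters (pi1_gens D))" for u v
    using that by (intro eq_equiv_class_iff[OF equiv_pres_cong])
  have onto: "word_value ?G ?\<phi> ` lists ?A = carrier ?G"
  proof
    show "word_value ?G ?\<phi> ` lists ?A \<subseteq> carrier ?G"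
      unfolding carrier by (intro image_subsetI, rule image_eqI, erule word_value_pi1) (rule alphabet_lists)
    show "carrier ?G \<subseteq> word_value ?G ?\<phi> ` lists ?A"
    proof
      fix g
      assume "g \<in> carrier ?G"
      then obtain u where u: "u \<in> lists (signed_letters (pi1_gens D))" "g = pi1_cong `` {u}"
        unfolding carrier by blast
      then have "g = word_value ?G ?\<phi> (eliminate D u)"
        using class_eq pi1_cong_eliminate word_value_pi1 eliminate_alphabet alphabet_lists by simp
      then show "g \<in> word_value ?G ?\<phi> ` lists ?A"
        using eliminate_alphabet[OF u(1)] by blast
    qed
  qed
  have presentation: "is_monoid_presentation ?G ?A ?\<phi> ?R"
    unfolding pi1_def presented_group_def
  proof (rule monoid_presentation_of_presented_monoid[OF alphabet_subset])
    show "\<exists>v \<in> lists ?A. (u, v) \<in> pi1_cong" if "u \<in> lists (signed_letters (pi1_gens D))" for u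
      using that eliminate_alphabet pi1_cong_eliminate by blast
  qed (use rules_cong_iff_pi1_cong word_value_pi1 in \<open>simp_all add: pi1_def presented_group_def\<close>)
  have unique: "\<exists>!w. w \<in> lists ?A \<and> word_value ?G ?\<phi> w = g \<and> (\<forall>(u, v) \<in> ?R. \<not> sublist u w)"
    if g: "g \<in> carrier ?G" for g
  proof -
    obtain u where u: "u \<in> lists ?A" "g = word_value ?G ?\<phi> u"
      using g unfolding onto[symmetric] by blast
    have "w \<in> lists ?A \<and> word_value ?G ?\<phi> w = g \<longleftrightarrow> (u, w) \<in> pres_cong ?A ?R" for w
    proof (cases "w \<in> lists ?A")
      case True
      then show ?thesis
        using u class_eq[of u w] rules_cong_iff_pi1_cong[OF u(1) True]
        by (simp add: word_value_pi1 alphabet_lists eq_commute[of "pi1_cong `` {w}"])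
    next
      case False
      then show ?thesis
        using pres_cong_lists[of u w ?A ?R] by auto
    qed
    with ex1_irreducible[OF rules_subset wf_rules locally_confluent_rules u(1)] show ?thesis
      by (simp add: conj_assoc[symmetric])
  qed
  have terminating: "\<nexists>w :: nat \<Rightarrow> _. \<forall>i. (w i, w (Suc i)) \<in> rewrite_step ?A ?R"
  proof -
    have "rewrite_step ?A ?R \<subseteq> rewrite_step UNIV ?R"
      by (auto simp: rewrite_step_def)
    then show ?thesis
      using wf_rules unfolding wf_iff_no_infinite_down_chain by blast
  qed
  have letters: "?\<phi> a \<in> carrier ?G" if "a \<in> ?A" for a
    using that alphabet_subset unfolding carrier pi1_letter_def group_letter_def by auto
  have group: "group ?G"
    unfolding pi1_def by (rule group_presented_group)
  have finite: "finite ?A"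
    using finite_S_gens by (simp add: alphabet_def signed_letters_def)
  show ?thesis
    unfolding finite_complete_rewriting_system_def
    by (intro conjI ballI group finite letters onto finite_rules rules_subset presentation unique
        terminating)
qed

end
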